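(* Let $\psi:[0,1]\to[0,1]$ be a full-branch piecewise $C^2$ expanding map as described in the context, with constants $\vartheta,\eta_-,\eta_+$ and absolutely continuous invariant probability measure $\pi$. Let $\chi:(0,1)\to\mathbb{R}$ be continuous and such that its right derivative $\chi'(x+)$ and left derivative $\chi'(x-)$ exist at every $x\in(0,1)$. Suppose that $\chi-\pi(\chi)$ is not a $\psi$-coboundary in $L^2(\pi)$, and that there exist constants $a,b>0$ such that $$|\chi(x)|\lesssim x^{-a}(1-x)^{-a}\quad\text{and}\quad \max\{|\chi'(x+)|,|\chi'(x-)|\}\lesssim x^{-b}(1-x)^{-b}\qquad (x\in(0,1)),$$ and $$a<\min\left\{\vartheta,\frac1b,\frac12\right\}\cdot\min\left\{1,\frac{\log\eta_-}{\log\eta_+}\right\}.$$ Then, for every $x\in\mathbb{R}$, $$\pi\left(\frac{S_n(\chi)-n\,\pi(\chi)}{\sigma\sqrt n}\le x\right)-\mathfrak{N}(x)=o(1)\qquad\text{as } n\to\infty .$$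
   Context: Let $I=[0,1]$ and let $\lambda_I$ be Lebesgue measure on $I$. Let $0=c_0<c_1<\dots<c_k=1$ and let $\psi:I\to I$ satisfy: (1) for each $j\in\{0,\dots,k-1\}$ there is a $C^2$ map $\psi_{j+1}:[c_j,c_{j+1}]\to I$ with $|\psi_{j+1}'|>1$, range equal to $I$, and $\psi_{j+1}=\psi$ on $(c_j,c_{j+1})$; (2) the derivatives of the inverse branches are uniformly $\vartheta$-Hölder: there is $c$ such that for all $j$, all $\varepsilon>0$, all $z\in I$ and all $x,y\in[z-\varepsilon,z+\varepsilon]\cap I$, $|(\psi_{j+1}^{-1})'(x)-(\psi_{j+1}^{-1})'(y)|\le c\,|(\psi_{j+1}^{-1})'(z)|\,\varepsilon^{\vartheta}$. Define $\eta_+=\max_j\|\psi_{j+1}'\|_\infty<\infty$ and $\eta_->1$ by $1/\eta_-=\max_j\|(\psi_{j+1}^{-1})'\|_\infty$. Such a map has exactly one absolutely continuous invariant probability measure, denoted $\pi$. Notation: $S_n(\chi)=\sum_{k=0}^{n-1}\chi\circ\psi^k$; $\pi(\chi)=\int\chi\,d\pi$; $\sigma^2=\lim_{n\to\infty}\int\big(\frac{S_n(\chi)-n\pi(\chi)}{\sqrt n}\big)^2d\pi$ is the asymptotic variance, $\sigma\ge0$; $\mathfrak{N}(x)=\int_{-\infty}^x\frac{1}{\sqrt{2\pi}}e^{-y^2/2}\,dy$ (here $\pi$ inside $\sqrt{2\pi}$ is the number). A function $f$ is a $\psi$-coboundary in $L^2(\pi)$ if $f=\ell\circ\psi-\ell$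 for some $\ell\in L^2(\pi)$. $f\lesssim g$ means there is a constant $K>0$ with $f(x)\le Kg(x)$ for all $x$ in the domain. *)

theory Defs
  imports "HOL-Probability.Probability" "HOL-Library.Landau_Symbols"
begin

text \<open>Derivatives are taken within \<open>S\<close>, so they are one-sided at the endpoints of a closed interval.\<close>

definition C2_on :: "real set \<Rightarrow> (real \<Rightarrow> real) \<Rightarrow> bool" where
  "C2_on S f \<longleftrightarrow>
     (\<exists>f' f''. (\<forall>x\<in>S. (f has_real_derivative f' x) (at x within S)) \<and>
               (\<forall>x\<in>S. (f' has_real_derivative f'' x) (at x within S)) \<and>
               continuous_on S f'')"

definition deriv_on :: "real set \<Rightarrow> (real \<Rightarrow> real) \<Rightarrow> real \<Rightarrow> real" where
  "deriv_on S f x = vector_derivative f (at x within S)"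

definition cell :: "(nat \<Rightarrow> real) \<Rightarrow> nat \<Rightarrow> real set" where
  "cell c j = {c j..c (Suc j)}"

text \<open>
  Branches are numbered from \<open>0\<close>: \<open>g j\<close> is the branch on \<open>cell c j\<close>, usually written
  \<open>\<psi>\<^sub>j\<^sub>+\<^sub>1\<close>. Only its values on that cell matter.
\<close>

definition inv_branch :: "(nat \<Rightarrow> real) \<Rightarrow> (nat \<Rightarrow> real \<Rightarrow> real) \<Rightarrow> nat \<Rightarrow> real \<Rightarrow> real" where
  "inv_branch c g j = inv_into (cell c j) (g j)"

definition full_branch_expanding ::
  "nat \<Rightarrow> (nat \<Rightarrow> real) \<Rightarrow> (nat \<Rightarrow> real \<Rightarrow> real) \<Rightarrow> real \<Rightarrow> (real \<Rightarrow> real) \<Rightarrow> bool" where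
  "full_branch_expanding k c g \<theta> \<psi> \<longleftrightarrow>
     c 0 = 0 \<and> c k = 1 \<and> (\<forall>j<k. c j < c (Suc j)) \<and>
     \<psi> \<in> {0..1} \<rightarrow> {0..1} \<and>
     (\<forall>j<k. C2_on (cell c j) (g j) \<and>
            (\<forall>x\<in>cell c j. 1 < \<bar>deriv_on (cell c j) (g j) x\<bar>) \<and>
            g j ` cell c j = {0..1} \<and>
            (\<forall>x\<in>{c j<..<c (Suc j)}. g j x = \<psi> x)) \<and>
     (\<exists>C. \<forall>j<k. \<forall>\<epsilon>>0. \<forall>z\<in>{0..1}. \<forall>x\<in>{z-\<epsilon>..z+\<epsilon>} \<inter> {0..1}. \<forall>y\<in>{z-\<epsilon>..z+\<epsilon>} \<inter> {0..1}.
        \<bar>deriv_on {0..1} (inv_branch c g j) x - deriv_on {0..1} (inv_branch c g j) y\<bar>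
          \<le> C * \<bar>deriv_on {0..1} (inv_branch c g j) z\<bar> * \<epsilon> powr \<theta>)"

definition eta_plus :: "nat \<Rightarrow> (nat \<Rightarrow> real) \<Rightarrow> (nat \<Rightarrow> real \<Rightarrow> real) \<Rightarrow> real" where
  "eta_plus k c g = (MAX j\<in>{..<k}. SUP x\<in>cell c j. \<bar>deriv_on (cell c j) (g j) x\<bar>)"

definition eta_minus :: "nat \<Rightarrow> (nat \<Rightarrow> real) \<Rightarrow> (nat \<Rightarrow> real \<Rightarrow> real) \<Rightarrow> real" where
  "eta_minus k c g =
     1 / (MAX j\<in>{..<k}. SUP x\<in>{0..1}. \<bar>deriv_on {0..1} (inv_branch c g j) x\<bar>)"

definition abs_cont_invariant_prob :: "(real \<Rightarrow> real) \<Rightarrow> real measure \<Rightarrow> bool" where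
  "abs_cont_invariant_prob \<psi> \<pi> \<longleftrightarrow>
     prob_space \<pi> \<and>
     sets \<pi> = sets (restrict_space lborel {0..1}) \<and>
     absolutely_continuous (restrict_space lborel {0..1}) \<pi> \<and>
     \<psi> \<in> measurable \<pi> \<pi> \<and> distr \<pi> \<pi> \<psi> = \<pi>"

definition L2_coboundary :: "real measure \<Rightarrow> (real \<Rightarrow> real) \<Rightarrow> (real \<Rightarrow> real) \<Rightarrow> bool" where
  "L2_coboundary \<pi> \<psi> f \<longleftrightarrow>
     (\<exists>l. l \<in> borel_measurable \<pi> \<and> integrable \<pi> (\<lambda>x. (l x)\<^sup>2) \<and>
          (AE x in \<pi>. f x = l (\<psi> x) - l x))"

definition birkhoff_sum :: "(real \<Rightarrow> real) \<Rightarrow> (real \<Rightarrow> real) \<Rightarrow> nat \<Rightarrow> real \<Rightarrow> real" where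
  "birkhoff_sum \<psi> f n x = (\<Sum>i<n. f ((\<psi> ^^ i) x))"

text \<open>
  \<open>lim\<close> is unspecified for a divergent sequence, so a statement about this value
  carries the existence of the limit as part of its claim.
\<close>

definition asymp_variance :: "real measure \<Rightarrow> (real \<Rightarrow> real) \<Rightarrow> (real \<Rightarrow> real) \<Rightarrow> real" where
  "asymp_variance \<pi> \<psi> f =
     lim (\<lambda>n. \<integral>x. ((birkhoff_sum \<psi> f n x - real n * (\<integral>y. f y \<partial>\<pi>)) / sqrt (real n))\<^sup>2 \<partial>\<pi>)"

definition lesssim_on :: "real set \<Rightarrow> (real \<Rightarrow> real) \<Rightarrow> (real \<Rightarrow> real) \<Rightarrow> bool" where
  "lesssim_on A f g \<longleftrightarrow> (\<exists>K>0. \<forall>x\<in>A. f x \<le> K * g x)"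

end

theory Submission imports Defs
begin

text \<open>
  Let \<open>P\<close> be the transfer operator with respect to the invariant measure. By bounded distortion it
  contracts the cone of log-Lipschitz densities, so \<open>P\<^sup>n \<phi>\<close> tends to the mean of \<open>\<phi>\<close> uniformly and
  exponentially fast for Lipschitz \<open>\<phi>\<close>; by density, \<open>P\<^sup>n v \<longlonglongrightarrow> \<integral>v\<close> in \<open>L\<^sup>1\<close> for all integrable \<open>v\<close>.
  Truncating the observable at distance \<open>\<tau>\<^sup>n\<close> from the endpoints costs only a factor exponential in \<open>n\<close>
  in the Lipschitz norm, and since \<open>a < 1/2\<close> the error is exponentially small in \<open>L\<^sup>2\<close>. Hence \<open>\<Sum>P\<^sup>n f\<close>
  converges in \<open>L\<^sup>2\<close> for the centred observable \<open>f\<close>, and Gordin's method writes \<open>f\<close> as a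
  reverse martingale difference \<open>d\<close> plus an \<open>L\<^sup>2\<close> coboundary. The characteristic functions
  \<open>\<phi>\<^sub>m\<close> of the sums of \<open>s d\<close> satisfy \<open>\<phi>\<^sub>m\<^sub>+\<^sub>1 = (1 - s\<^sup>2\<sigma>\<^sup>2/2) \<phi>\<^sub>m + o(s\<^sup>2)\<close> uniformly in \<open>m\<close>, because
  the conditional variance may be replaced by its mean by exactness. With \<open>s = t / sqrt n\<close> this is the
  central limit theorem.
\<close>

section \<open>Contraction of log-Lipschitz cones\<close>

text \<open>The locale \<open>log_lipschitz_kernel\<close> is used twice. Over Lebesgue measure,
  with weights \<open>\<bar>v' j\<bar>\<close>, the iterates of 1 converge to a log-Lipschitz
  invariant density \<open>h\<close>. Conjugation by \<open>h\<close> yields weights that sum to 1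
  and are again log-Lipschitz, so the same contraction runs over the measure with density
  \<open>h\<close>. That measure is exact, and exactness allows no other invariant probability
  absolutely continuous with respect to it; this identifies it with the given \<open>\<pi>\<close>.
  The cone contraction is a coupling, not an estimate in a projective metric: two positive functions
  of equal mean lose the same constant, which cancels in their difference. The sigma-algebras pulled
  back by \<open>T ^^ n\<close> decrease, so the sums are martingales only in reversed time. No
  filtration is set up: the martingale property is orthogonality of \<open>d\<close> to the square
  integrable functions of \<open>T x\<close>. The conditional variance of \<open>d\<close> is not
  constant and \<open>d\<^sup>2\<close> is merely integrable, which is why exactness is extended
  from Lipschitz functions to all integrable ones.\<close>

definition log_lip :: "real \<Rightarrow> (real \<Rightarrow> real) \<Rightarrow> bool" where
  "log_lip A \<phi> \<longleftrightarrow> (\<forall>x\<in>{0..1}. 0 < \<phi> x) \<and>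
     (\<forall>x\<in>{0..1}. \<forall>y\<in>{0..1}. \<phi> x \<le> \<phi> y * exp (A * \<bar>x - y\<bar>))"

lemma log_lip_pos: "log_lip A \<phi> \<Longrightarrow> x \<in> {0..1} \<Longrightarrow> 0 < \<phi> x"
  by (simp add: log_lip_def)

lemma log_lipD: "log_lip A \<phi> \<Longrightarrow> x \<in> {0..1} \<Longrightarrow> y \<in> {0..1} \<Longrightarrow> \<phi> x \<le> \<phi> y * exp (A * \<bar>x - y\<bar>)"
  by (simp add: log_lip_def)

lemma log_lip_mono:
  assumes "log_lip A \<phi>" "A \<le> B"
  shows "log_lip B \<phi>"
  unfolding log_lip_def
proof (intro conjI ballI)
  fix x y :: real assume xy: "x \<in> {0..1}" "y \<in> {0..1}"
  have "\<phi> x \<le> \<phi> y * exp (A * \<bar>x - y\<bar>)" using log_lipD[OF assms(1) xy] .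
  also have "\<dots> \<le> \<phi> y * exp (B * \<bar>x - y\<bar>)"
    using log_lip_pos[OF assms(1) xy(2)] assms(2) by (intro mult_left_mono) (auto intro: mult_right_mono)
  finally show "\<phi> x \<le> \<phi> y * exp (B * \<bar>x - y\<bar>)" .
qed (use assms log_lip_pos in auto)

lemma log_lip_const: "0 < c \<Longrightarrow> 0 \<le> A \<Longrightarrow> log_lip A (\<lambda>_. c)"
  by (auto simp: log_lip_def)

lemma log_lip_mult:
  assumes "log_lip A \<phi>" "log_lip B \<psi>"
  shows "log_lip (A + B) (\<lambda>x. \<phi> x * \<psi> x)"
  unfolding log_lip_def
proof (intro conjI ballI)
  fix x y :: real assume xy: "x \<in> {0..1}" "y \<in> {0..1}"
  have "\<phi> x * \<psi> x \<le> (\<phi> y * exp (A * \<bar>x - y\<bar>)) * (\<psi> y * exp (B * \<bar>x - y\<bar>))"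
    using assms xy by (intro mult_mono log_lipD) (auto simp: log_lip_pos less_imp_le)
  then show "\<phi> x * \<psi> x \<le> \<phi> y * \<psi> y * exp ((A + B) * \<bar>x - y\<bar>)"
    by (simp add: exp_add algebra_simps)
qed (use assms in \<open>auto simp: log_lip_pos\<close>)

lemma log_lip_inverse:
  assumes "log_lip A \<phi>"
  shows "log_lip A (\<lambda>x. 1 / \<phi> x)"
  unfolding log_lip_def
proof (intro conjI ballI)
  fix x y :: real assume xy: "x \<in> {0..1}" "y \<in> {0..1}"
  have "\<phi> y \<le> \<phi> x * exp (A * \<bar>x - y\<bar>)"
    using log_lipD[OF assms xy(2,1)] by (simp add: abs_minus_commute)
  then show "1 / \<phi> x \<le> 1 / \<phi> y * exp (A * \<bar>x - y\<bar>)"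
    using log_lip_pos[OF assms xy(1)] log_lip_pos[OF assms xy(2)] by (simp add: field_simps)
qed (use assms in \<open>auto simp: log_lip_pos\<close>)

lemma log_lip_compose:
  assumes "log_lip A \<phi>" "0 \<le> A" "\<And>x. x \<in> {0..1} \<Longrightarrow> v x \<in> {0..1}"
    and "\<And>x y. x \<in> {0..1} \<Longrightarrow> y \<in> {0..1} \<Longrightarrow> \<bar>v x - v y\<bar> \<le> \<beta> * \<bar>x - y\<bar>"
  shows "log_lip (A * \<beta>) (\<lambda>x. \<phi> (v x))"
  unfolding log_lip_def
proof (intro conjI ballI)
  fix x y :: real assume xy: "x \<in> {0..1}" "y \<in> {0..1}"
  have "\<phi> (v x) \<le> \<phi> (v y) * exp (A * \<bar>v x - v y\<bar>)" using assms xy by (intro log_lipD) auto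
  also have "\<dots> \<le> \<phi> (v y) * exp (A * (\<beta> * \<bar>x - y\<bar>))"
    using assms xy log_lip_pos[OF assms(1) assms(3)[OF xy(2)]]
    by (intro mult_left_mono) (auto intro: mult_left_mono)
  finally show "\<phi> (v x) \<le> \<phi> (v y) * exp (A * \<beta> * \<bar>x - y\<bar>)" by (simp add: mult.assoc)
qed (use assms in \<open>auto simp: log_lip_pos\<close>)

text \<open>This is where the multiplicative form of the definition pays: the inequality is
  inherited term by term, which is not visible for the logarithm of a sum.\<close>

lemma log_lip_sum:
  assumes "finite I" "I \<noteq> {}" "\<And>i. i \<in> I \<Longrightarrow> log_lip A (\<phi> i)"
  shows "log_lip A (\<lambda>x. \<Sum>i\<in>I. \<phi> i x)"
  unfolding log_lip_def
proof (intro conjI ballI)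
  fix x y :: real assume xy: "x \<in> {0..1}" "y \<in> {0..1}"
  show "(\<Sum>i\<in>I. \<phi> i x) \<le> (\<Sum>i\<in>I. \<phi> i y) * exp (A * \<bar>x - y\<bar>)"
    unfolding sum_distrib_right by (intro sum_mono log_lipD assms xy)
next
  show "\<And>x. x \<in> {0..1} \<Longrightarrow> 0 < (\<Sum>i\<in>I. \<phi> i x)"
    by (rule sum_pos[OF assms(1,2)]) (rule log_lip_pos[OF assms(3)])
qed

text \<open>\<open>\<phi> 0 * exp A\<close> bounds \<open>\<phi>\<close> on the unit interval, and
  \<open>A * exp A\<close> bounds the relative increment, since
  \<open>exp t - 1 \<le> t * exp t\<close> and \<open>t \<le> A\<close>.\<close>

lemma log_lip_lipschitz:
  assumes "log_lip A \<phi>" "0 \<le> A" "x \<in> {0..1}" "y \<in> {0..1}"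
  shows "\<bar>\<phi> x - \<phi> y\<bar> \<le> \<phi> 0 * exp A * (A * exp A) * \<bar>x - y\<bar>"
proof -
  have *: "\<phi> x - \<phi> y \<le> \<phi> 0 * exp A * (A * exp A) * \<bar>x - y\<bar>" if xy: "x \<in> {0..1}" "y \<in> {0..1}" for x y
  proof -
    define t where "t = A * \<bar>x - y\<bar>"
    have t: "0 \<le> t" "t \<le> A" using assms(2) xy by (auto simp: t_def intro!: mult_left_le)
    have "1 - t \<le> exp (-t)" using exp_ge_add_one_self[of "-t"] by simp
    then have "(1 - t) * exp t \<le> exp (-t) * exp t" by (rule mult_right_mono) simp
    then have "exp t - 1 \<le> t * exp t" by (simp add: exp_minus algebra_simps)
    also have "\<dots> \<le> t * exp A" using t by (intro mult_left_mono) auto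
    finally have e: "exp t - 1 \<le> t * exp A" .
    have "\<phi> y \<le> \<phi> 0 * exp (A * \<bar>y - 0\<bar>)" using assms(1) xy by (intro log_lipD) auto
    also have "\<dots> \<le> \<phi> 0 * exp A" using log_lip_pos[OF assms(1), of 0] assms(2) xy
      by (intro mult_left_mono) (auto intro!: mult_left_le)
    finally have y: "\<phi> y \<le> \<phi> 0 * exp A" .
    have "\<phi> x - \<phi> y \<le> \<phi> y * (exp t - 1)"
      using log_lipD[OF assms(1) xy] by (simp add: t_def algebra_simps)
    also have "\<dots> \<le> (\<phi> 0 * exp A) * (t * exp A)"
      using y e t log_lip_pos[OF assms(1), of 0] by (intro mult_mono) auto
    finally show ?thesis by (simp add: t_def algebra_simps)
  qed
  show ?thesis using *[OF assms(3,4)] *[OF assms(4,3)] by (simp add: abs_minus_commute abs_le_iff)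
qed

lemma log_lip_continuous:
  assumes "log_lip A \<phi>" "0 \<le> A"
  shows "continuous_on {0..1} \<phi>"
proof -
  have "(\<phi> 0 * exp A * (A * exp A))-lipschitz_on {0..1} \<phi>"
    using log_lip_lipschitz[OF assms] log_lip_pos[OF assms(1), of 0] assms(2)
    by (intro lipschitz_onI) (auto simp: dist_real_def)
  then show ?thesis by (rule lipschitz_on_continuous_on)
qed

text \<open>The hypothesis on \<open>q\<close> amounts to
  \<open>\<phi> x - q \<ge> \<phi> x / r\<close>, so relative variations grow at most by the factor
  \<open>r\<close>.\<close>

lemma log_lip_minus_const:
  assumes "log_lip A \<phi>" "0 \<le> A" "1 < r" and q: "0 \<le> q" "\<And>x. x \<in> {0..1} \<Longrightarrow> q * r \<le> \<phi> x * (r - 1)"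
  shows "log_lip (r * A) (\<lambda>x. \<phi> x - q)"
  unfolding log_lip_def
proof (intro conjI ballI)
  fix x :: real assume x: "x \<in> {0..1}"
  have "q * r < \<phi> x * r" 
    using q(2)[OF x] log_lip_pos[OF assms(1) x] by (simp add: algebra_simps)
  then show "0 < \<phi> x - q" using \<open>1 < r\<close> by simp
next
  fix x y :: real assume xy: "x \<in> {0..1}" "y \<in> {0..1}"
  define u p where "u = A * \<bar>x - y\<bar>" and "p = \<phi> y"
  have u: "0 \<le> u" using assms by (simp add: u_def)
  have pq: "q \<le> (p - q) * (r - 1)" using q(2)[OF xy(2)] by (simp add: p_def algebra_simps)
  then have "0 \<le> p - q" using q(1) \<open>1 < r\<close> by (smt (verit) mult_neg_pos)
  \<comment> \<open>The goal \<open>p * exp u - q \<le> (p - q) * exp (r * u)\<close> is divided by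
    \<open>exp u\<close>, and each remaining exponential is compared with its tangent
    \<open>1 + x \<le> exp x\<close>. What is left is linear in \<open>u\<close> and follows from
    \<open>pq\<close>.\<close>
  have 1: "p - q * (1 - u) \<le> (p - q) * (1 + (r - 1) * u)"
    using mult_right_mono[OF pq u] by (simp add: algebra_simps)
  have "p - q * exp (-u) \<le> p - q * (1 - u)"
    using q(1) exp_ge_add_one_self[of "-u"] by (intro diff_left_mono mult_left_mono) auto
  also note 1
  also have "(p - q) * (1 + (r - 1) * u) \<le> (p - q) * exp ((r - 1) * u)"
    using \<open>0 \<le> p - q\<close> exp_ge_add_one_self by (intro mult_left_mono) auto
  finally have "(p - q * exp (-u)) * exp u \<le> (p - q) * exp ((r - 1) * u) * exp u"
    by (rule mult_right_mono) simp
  then have "p * exp u - q \<le> (p - q) * exp (r * u)"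
    by (simp add: exp_minus left_diff_distrib flip: exp_add) (simp add: mult.assoc flip: exp_add)
  moreover have "\<phi> x \<le> p * exp u" using log_lipD[OF assms(1) xy] by (simp add: p_def u_def)
  ultimately show "\<phi> x - q \<le> (\<phi> y - q) * exp (r * A * \<bar>x - y\<bar>)"
    by (simp add: p_def u_def mult.assoc)
qed

text \<open>Conservation of the integral is asked for continuous functions only, which covers the
  cone. Constants need not be fixed by the operator; both stronger properties are added in
  \<open>transfer_kernel\<close>.\<close>

locale log_lipschitz_kernel = prob_space m for m :: "real measure" +
  fixes k :: nat and w v :: "nat \<Rightarrow> real \<Rightarrow> real" and \<beta> D :: real
  assumes sets_m: "sets m = sets (restrict_space borel {0..1})"
    and k_pos: "0 < k"
    and beta: "0 < \<beta>" "\<beta> < 1"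
    and D_nonneg: "0 \<le> D"
    and w_log_lip: "\<And>j. j < k \<Longrightarrow> log_lip D (w j)"
    and v_in: "\<And>j x. j < k \<Longrightarrow> x \<in> {0..1} \<Longrightarrow> v j x \<in> {0..1}"
    and v_lip: "\<And>j x y. j < k \<Longrightarrow> x \<in> {0..1} \<Longrightarrow> y \<in> {0..1} \<Longrightarrow> \<bar>v j x - v j y\<bar> \<le> \<beta> * \<bar>x - y\<bar>"
    and integral_continuous: "\<And>\<phi>. continuous_on {0..1} \<phi> \<Longrightarrow>
      (\<integral>x. (\<Sum>j<k. w j x * \<phi> (v j x)) \<partial>m) = (\<integral>x. \<phi> x \<partial>m)"
begin

definition W :: "(real \<Rightarrow> real) \<Rightarrow> real \<Rightarrow> real" where
  "W \<phi> x = (\<Sum>j<k. w j x * \<phi> (v j x))"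

lemma space_m: "space m = {0..1}"
  using sets_eq_imp_space_eq[OF sets_m] by (simp add: space_restrict_space)

lemma measurable_m: "borel_measurable m = borel_measurable (restrict_space borel {0..1})"
  by (rule measurable_cong_sets) (simp_all add: sets_m)

lemma continuous_integrable:
  fixes \<phi> :: "real \<Rightarrow> real"
  assumes "continuous_on {0..1} \<phi>"
  shows "integrable m \<phi>"
proof -
  have "\<phi> \<in> borel_measurable m" unfolding measurable_m
    using assms by (rule borel_measurable_continuous_on_restrict)
  moreover have "bounded (\<phi> ` {0..1})" by (intro compact_imp_bounded compact_continuous_image assms) auto
  then obtain B where "\<And>x. x \<in> {0..1} \<Longrightarrow> norm (\<phi> x) \<le> B" unfolding bounded_iff by blast
  ultimately show ?thesis by (intro integrable_const_bound[where B=B]) (auto simp: space_m)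
qed

text \<open>A Harnack-type comparison: on an interval of length 1 any two values differ at most by
  the factor \<open>exp A\<close>, and one of them may be averaged over the probability
  \<open>m\<close>.\<close>

lemma log_lip_integral_bounds:
  assumes "log_lip A \<phi>" "0 \<le> A" "x \<in> {0..1}"
  shows "exp (-A) * (\<integral>y. \<phi> y \<partial>m) \<le> \<phi> x" "\<phi> x \<le> exp A * (\<integral>y. \<phi> y \<partial>m)"
proof -
  have i: "integrable m \<phi>" by (rule continuous_integrable[OF log_lip_continuous[OF assms(1,2)]])
  have le: "\<phi> a \<le> exp A * \<phi> b" if "a \<in> {0..1}" "b \<in> {0..1}" for a b
  proof -
    have "\<phi> a \<le> \<phi> b * exp (A * \<bar>a - b\<bar>)" by (intro log_lipD assms that)
    also have "\<dots> \<le> \<phi> b * exp A" using log_lip_pos[OF assms(1) that(2)] assms(2) that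
      by (intro mult_left_mono) (auto intro!: mult_left_le)
    finally show ?thesis by (simp add: mult.commute)
  qed
  have "(\<integral>y. \<phi> y \<partial>m) \<le> (\<integral>y. exp A * \<phi> x \<partial>m)"
    by (intro integral_mono i) (use le assms(3) in \<open>auto simp: space_m\<close>)
  then have "(\<integral>y. \<phi> y \<partial>m) \<le> exp A * \<phi> x" by (simp add: prob_space)
  then show "exp (-A) * (\<integral>y. \<phi> y \<partial>m) \<le> \<phi> x" by (simp add: exp_minus field_simps)
  have "(\<integral>y. \<phi> x \<partial>m) \<le> (\<integral>y. exp A * \<phi> y \<partial>m)"
    by (intro integral_mono integrable_mult_right i) (use le assms(3) in \<open>auto simp: space_m\<close>)
  then show "\<phi> x \<le> exp A * (\<integral>y. \<phi> y \<partial>m)" by (simp add: prob_space)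
qed

text \<open>Multiplicative form of a Lasota-Yorke inequality: composition with the contraction
  \<open>v j\<close> shrinks the parameter by \<open>\<beta>\<close>, and the weight adds its
  distortion \<open>D\<close>.\<close>

lemma W_log_lip:
  assumes "log_lip A \<phi>" "0 \<le> A"
  shows "log_lip (A * \<beta> + D) (W \<phi>)"
proof -
  have "log_lip (D + A * \<beta>) (\<lambda>x. w j x * \<phi> (v j x))" if "j < k" for j
    by (rule log_lip_mult[OF w_log_lip[OF that] log_lip_compose[OF assms v_in[OF that] v_lip[OF that]]])
  then show ?thesis
    unfolding W_def add.commute[of _ D] using k_pos by (intro log_lip_sum) auto
qed

lemma W_cong: "(\<And>x. x \<in> {0..1} \<Longrightarrow> \<phi> x = \<psi> x) \<Longrightarrow> x \<in> {0..1} \<Longrightarrow> W \<phi> x = W \<psi> x"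
  unfolding W_def using v_in by (intro sum.cong refl arg_cong2[of _ _ _ _ "(*)"]) (metis lessThan_iff)

lemma W_diff: "W (\<lambda>x. \<phi> x - \<psi> x) = (\<lambda>x. W \<phi> x - W \<psi> x)"
  by (auto simp: W_def fun_eq_iff algebra_simps sum_subtractf)

lemma W_add: "W (\<lambda>x. \<phi> x + \<psi> x) = (\<lambda>x. W \<phi> x + W \<psi> x)"
  by (auto simp: W_def fun_eq_iff algebra_simps sum.distrib)

lemma W_pow_diff: "(W ^^ n) (\<lambda>x. \<phi> x - \<psi> x) = (\<lambda>x. (W ^^ n) \<phi> x - (W ^^ n) \<psi> x)"
  by (induction n) (auto simp: W_diff)

lemma W_pow_add: "(W ^^ n) (\<lambda>x. \<phi> x + \<psi> x) = (\<lambda>x. (W ^^ n) \<phi> x + (W ^^ n) \<psi> x)"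
  by (induction n) (auto simp: W_add)

lemma integral_W: "continuous_on {0..1} \<phi> \<Longrightarrow> (\<integral>x. W \<phi> x \<partial>m) = (\<integral>x. \<phi> x \<partial>m)"
  unfolding W_def by (rule integral_continuous)

text \<open>The cone of parameter \<open>cone_const\<close> still absorbs \<open>W \<psi>\<close> when \<open>\<psi>\<close> lies in the cone
  of the larger parameter \<open>ratio * cone_const\<close>; this slack pays for subtracting a constant.\<close>

definition ratio :: real where "ratio = (1 + 1 / \<beta>) / 2"

definition cone_const :: real where "cone_const = D / (1 - ratio * \<beta>) + 1"

text \<open>The complement of the share of the mean that is removed in one step: a cone function is
  at least \<open>exp (- cone_const)\<close> times its mean, and the fraction
  \<open>(ratio - 1) / ratio\<close> of this lower bound can be subtracted while the parameter grows
  only by the factor \<open>ratio\<close>.\<close>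

definition rate :: real where "rate = 1 - exp (- cone_const) * ((ratio - 1) / ratio)"

lemma ratio: "1 < ratio" "ratio * \<beta> < 1"
  using beta by (auto simp: ratio_def field_simps)

lemma cone_const_pos: "0 < cone_const"
  using ratio D_nonneg by (auto simp: cone_const_def add_nonneg_pos)

text \<open>The summand \<open>D / (1 - ratio * \<beta>)\<close> alone would give equality; the 1
  added to it keeps the parameter positive when \<open>D = 0\<close>. The denominator is positive
  because \<open>ratio\<close> is the midpoint of 1 and \<open>1 / \<beta>\<close>.\<close>

lemma cone_const_absorbs: "ratio * cone_const * \<beta> + D \<le> cone_const"
proof -
  have "cone_const * (1 - ratio * \<beta>) = D + (1 - ratio * \<beta>)"
    using ratio by (simp add: cone_const_def field_simps)
  then show ?thesis using ratio by (simp add: algebra_simps)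
qed

lemma rate: "0 < rate" "rate < 1"
proof -
  define p q where "p = exp (- cone_const)" and "q = (ratio - 1) / ratio"
  have pq: "0 < p" "p < 1" "0 < q" "q < 1" using ratio cone_const_pos by (auto simp: p_def q_def)
  then have "0 < p * q" "p * q < p * 1" by (intro mult_pos_pos mult_strict_left_mono; simp)+
  with pq have "0 < p * q" "p * q < 1" by auto
  then show "0 < rate" "rate < 1" by (auto simp: rate_def p_def q_def)
qed

lemma W_cone: "log_lip cone_const \<phi> \<Longrightarrow> log_lip cone_const (W \<phi>)"
proof -
  assume "log_lip cone_const \<phi>"
  then have "log_lip (cone_const * \<beta> + D) (W \<phi>)" using cone_const_pos by (intro W_log_lip) auto
  moreover have "cone_const * \<beta> + D \<le> cone_const"
  proof -
    have "cone_const * \<beta> * 1 \<le> cone_const * \<beta> * ratio"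
      using ratio cone_const_pos beta by (intro mult_left_mono) auto
    then show ?thesis using cone_const_absorbs by (simp add: algebra_simps)
  qed
  ultimately show ?thesis by (rule log_lip_mono)
qed

lemma W_pow_cone: "log_lip cone_const \<phi> \<Longrightarrow> log_lip cone_const ((W ^^ n) \<phi>)"
  by (induction n) (auto intro: W_cone)

lemma integral_W_pow_cone: "log_lip cone_const \<phi> \<Longrightarrow> (\<integral>x. (W ^^ n) \<phi> x \<partial>m) = (\<integral>x. \<phi> x \<partial>m)"
proof (induction n)
  case (Suc n)
  then have "continuous_on {0..1} ((W ^^ n) \<phi>)"
    using cone_const_pos log_lip_continuous[OF W_pow_cone] by simp
  then show ?case using Suc by (simp add: integral_W)
qed simp

text \<open>Subtracting \<open>q\<close> leads to the cone of parameter
  \<open>ratio * cone_const\<close>, and \<open>W\<close> leads back. As \<open>q\<close> depends on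
  \<open>\<phi>\<close> only through its mean, functions of equal mean lose the same amount.\<close>

lemma cone_step:
  assumes "log_lip cone_const \<phi>"
  defines "q \<equiv> (1 - rate) * (\<integral>x. \<phi> x \<partial>m)"
  shows "log_lip cone_const (W (\<lambda>x. \<phi> x - q))"
    and "(\<integral>x. W (\<lambda>x. \<phi> x - q) x \<partial>m) = rate * (\<integral>x. \<phi> x \<partial>m)"
proof -
  define I where "I = (\<integral>x. \<phi> x \<partial>m)"
  have I: "0 < I"
  proof -
    have "0 < exp cone_const * I" using log_lip_integral_bounds(2)[OF assms(1), of 0]
        log_lip_pos[OF assms(1), of 0] cone_const_pos by (auto simp: I_def)
    then show ?thesis by (simp add: zero_less_mult_iff)
  qed
  have cont: "continuous_on {0..1} \<phi>" using assms(1) cone_const_pos by (intro log_lip_continuous) auto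
  have q: "q = exp (- cone_const) * ((ratio - 1) / ratio) * I" by (simp add: q_def rate_def I_def)
  have "log_lip (ratio * cone_const) (\<lambda>x. \<phi> x - q)"
  proof (rule log_lip_minus_const[OF assms(1) _ ratio(1)])
    show "0 \<le> q" using rate I by (simp add: q_def flip: I_def)
    fix x :: real assume x: "x \<in> {0..1}"
    have "q * ratio = (exp (- cone_const) * I) * (ratio - 1)" using ratio by (simp add: q)
    also have "\<dots> \<le> \<phi> x * (ratio - 1)"
      using log_lip_integral_bounds(1)[OF assms(1) _ x] cone_const_pos ratio
      by (intro mult_right_mono) (auto simp: I_def)
    finally show "q * ratio \<le> \<phi> x * (ratio - 1)" .
  qed (use cone_const_pos in auto)
  then have "log_lip (ratio * cone_const * \<beta> + D) (W (\<lambda>x. \<phi> x - q))"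
    using ratio cone_const_pos by (intro W_log_lip) auto
  then show "log_lip cone_const (W (\<lambda>x. \<phi> x - q))" using cone_const_absorbs by (rule log_lip_mono)
  have "(\<integral>x. W (\<lambda>x. \<phi> x - q) x \<partial>m) = (\<integral>x. \<phi> x - q \<partial>m)"
    by (intro integral_W continuous_intros cont)
  also have "\<dots> = rate * I"
    using continuous_integrable[OF cont] by (simp add: prob_space q_def algebra_simps flip: I_def)
  finally show "(\<integral>x. W (\<lambda>x. \<phi> x - q) x \<partial>m) = rate * (\<integral>x. \<phi> x \<partial>m)" by (simp add: I_def)
qed

text \<open>The difference of the iterates is carried by two cone functions \<open>\<phi>'\<close>
  and \<open>\<psi>'\<close> whose common mean is multiplied by \<open>rate\<close> in every step.
  Both lie between 0 and \<open>exp cone_const\<close> times that mean, hence so does the absolute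
  value of their difference.\<close>

lemma cone_contraction:
  assumes "log_lip cone_const \<phi>" "log_lip cone_const \<psi>" and eq: "(\<integral>x. \<phi> x \<partial>m) = (\<integral>x. \<psi> x \<partial>m)"
    and x: "x \<in> {0..1}"
  shows "\<bar>(W ^^ n) \<phi> x - (W ^^ n) \<psi> x\<bar> \<le> exp cone_const * (\<integral>x. \<phi> x \<partial>m) * rate ^ n"
proof -
  define I where "I = (\<integral>x. \<phi> x \<partial>m)"
  have "\<exists>\<phi>' \<psi>'. log_lip cone_const \<phi>' \<and> log_lip cone_const \<psi>' \<and> (\<integral>x. \<phi>' x \<partial>m) = rate ^ n * I \<and>
          (\<integral>x. \<psi>' x \<partial>m) = rate ^ n * I \<and>
          (\<forall>x\<in>{0..1}. (W ^^ n) \<phi> x - (W ^^ n) \<psi> x = \<phi>' x - \<psi>' x)"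
  proof (induction n)
    case 0
    then show ?case using assms by (intro exI[of _ \<phi>] exI[of _ \<psi>]) (auto simp: I_def)
  next
    case (Suc n)
    then obtain \<phi>' \<psi>' where *: "log_lip cone_const \<phi>'" "log_lip cone_const \<psi>'" "(\<integral>x. \<phi>' x \<partial>m) = rate ^ n * I"
       "(\<integral>x. \<psi>' x \<partial>m) = rate ^ n * I"
       and d: "\<And>x. x\<in>{0..1} \<Longrightarrow> (W ^^ n) \<phi> x - (W ^^ n) \<psi> x = \<phi>' x - \<psi>' x" by blast
    define q where "q = (1 - rate) * (rate ^ n * I)"
    have "(W ^^ Suc n) \<phi> x - (W ^^ Suc n) \<psi> x = W (\<lambda>x. \<phi>' x - q) x - W (\<lambda>x. \<psi>' x - q) x"
      if x: "x \<in> {0..1}" for x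
    proof -
      have "(W ^^ Suc n) \<phi> x - (W ^^ Suc n) \<psi> x = W (\<lambda>x. (W ^^ n) \<phi> x - (W ^^ n) \<psi> x) x"
        by (simp add: W_diff)
      also have "\<dots> = W (\<lambda>x. (\<phi>' x - q) - (\<psi>' x - q)) x" by (rule W_cong[OF _ x]) (simp add: d)
      finally show ?thesis by (simp only: W_diff)
    qed
    then show ?case using cone_step[OF *(1)] cone_step[OF *(2)] unfolding *(3,4) q_def[symmetric]
      by (intro exI[of _ "W (\<lambda>x. \<phi>' x - q)"] exI[of _ "W (\<lambda>x. \<psi>' x - q)"]) auto
  qed
  then obtain \<phi>' \<psi>' where *: "log_lip cone_const \<phi>'" "log_lip cone_const \<psi>'" "(\<integral>x. \<phi>' x \<partial>m) = rate ^ n * I"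
       "(\<integral>x. \<psi>' x \<partial>m) = rate ^ n * I" "(W ^^ n) \<phi> x - (W ^^ n) \<psi> x = \<phi>' x - \<psi>' x" using x by blast
  have "\<phi>' x \<le> exp cone_const * (rate ^ n * I)" "\<psi>' x \<le> exp cone_const * (rate ^ n * I)" "0 < \<phi>' x" "0 < \<psi>' x"
    using log_lip_integral_bounds(2)[OF *(1) _ x] log_lip_integral_bounds(2)[OF *(2) _ x] cone_const_pos *
      log_lip_pos[OF *(1) x] log_lip_pos[OF *(2) x] by auto
  then show ?thesis unfolding *(5) I_def[symmetric] mult.assoc mult.commute[of I] by linarith
qed

text \<open>In \<open>lipschitz_decay\<close> the function shifted into the cone has mean at most
  \<open>\<Lambda> * (2 + 1 / cone_const)\<close>; \<open>exp cone_const\<close> is the factor from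
  \<open>cone_contraction\<close>.\<close>

definition decay_const :: real where "decay_const = exp cone_const * (2 + 1 / cone_const)"

text \<open>Since \<open>W\<close> need not fix constants here, the comparison is with the iterates
  of the constant mean and not with the mean itself.\<close>

lemma lipschitz_decay:
  assumes "\<And>x y. x \<in> {0..1} \<Longrightarrow> y \<in> {0..1} \<Longrightarrow> \<bar>\<phi> x - \<phi> y\<bar> \<le> \<Lambda> * \<bar>x - y\<bar>" "0 < \<Lambda>"
    and x: "x \<in> {0..1}"
  shows "\<bar>(W ^^ n) \<phi> x - (W ^^ n) (\<lambda>_. \<integral>y. \<phi> y \<partial>m) x\<bar> \<le> decay_const * \<Lambda> * rate ^ n"
proof -
  \<comment> \<open>The shift \<open>c\<close> makes \<open>\<phi> x + c\<close> at least
    \<open>\<Lambda> / A\<close>, so the slope \<open>\<Lambda>\<close> is at most \<open>A\<close>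
    times the value and the shifted function lies in the cone. By linearity \<open>c\<close> cancels
    at the end.\<close>
  define A c where "A = cone_const" and "c = \<Lambda> + \<Lambda> / A - \<phi> 0"
  have A: "0 < A" using cone_const_pos by (simp add: A_def)
  have osc: "\<bar>\<phi> x - \<phi> 0\<bar> \<le> \<Lambda>" if "x \<in> {0..1}" for x
  proof -
    have "\<bar>\<phi> x - \<phi> 0\<bar> \<le> \<Lambda> * \<bar>x - 0\<bar>" using that by (intro assms) auto
    also have "\<dots> \<le> \<Lambda>" using that assms(2) by (intro mult_left_le) auto
    finally show ?thesis .
  qed
  have ge: "\<Lambda> / A \<le> \<phi> x + c" if "x \<in> {0..1}" for x
    using osc[OF that] by (simp add: c_def)
  have ll: "log_lip A (\<lambda>x. \<phi> x + c)" unfolding log_lip_def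
  proof (intro conjI ballI)
    fix x :: real assume "x \<in> {0..1}"
    then show "0 < \<phi> x + c" using ge[of x] A assms(2) by (smt (verit) divide_pos_pos)
  next
    fix x y :: real assume xy: "x \<in> {0..1}" "y \<in> {0..1}"
    have "\<Lambda> \<le> (\<phi> y + c) * A" using ge[OF xy(2)] A by (simp add: field_simps)
    have "\<phi> x + c \<le> (\<phi> y + c) + \<Lambda> * \<bar>x - y\<bar>" using assms(1)[OF xy] by auto
    also have "\<dots> \<le> (\<phi> y + c) + ((\<phi> y + c) * A) * \<bar>x - y\<bar>"
      using \<open>\<Lambda> \<le> (\<phi> y + c) * A\<close> by (intro add_left_mono mult_right_mono) auto
    also have "\<dots> = (\<phi> y + c) * (1 + A * \<bar>x - y\<bar>)" by (simp add: algebra_simps)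
    also have "\<dots> \<le> (\<phi> y + c) * exp (A * \<bar>x - y\<bar>)"
      using ge[OF xy(2)] A assms(2) by (intro mult_left_mono exp_ge_add_one_self) (smt (verit) divide_pos_pos)
    finally show "\<phi> x + c \<le> (\<phi> y + c) * exp (A * \<bar>x - y\<bar>)" .
  qed
  have "continuous_on {0..1} (\<lambda>x. \<phi> x + c)" using log_lip_continuous[OF ll] A by simp
  then have "continuous_on {0..1} (\<lambda>x. (\<phi> x + c) - c)"
    by (rule continuous_on_diff) (rule continuous_on_const)
  then have i: "integrable m \<phi>" by (intro continuous_integrable) simp
  define I where "I = (\<integral>y. \<phi> y \<partial>m)"
  have I': "(\<integral>y. \<phi> y + c \<partial>m) = I + c" using i by (simp add: prob_space I_def)
  have "(\<integral>y. \<phi> y + c \<partial>m) \<le> (\<integral>y. 2 * \<Lambda> + \<Lambda> / A \<partial>m)"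
  proof (intro integral_mono)
    fix y assume "y \<in> space m"
    then show "\<phi> y + c \<le> 2 * \<Lambda> + \<Lambda> / A" using osc[of y] by (auto simp: space_m c_def)
  qed (use i in auto)
  then have I1: "I + c \<le> 2 * \<Lambda> + \<Lambda> / A" by (simp add: prob_space I')
  have "(\<integral>y. \<Lambda> / A \<partial>m) \<le> (\<integral>y. \<phi> y + c \<partial>m)"
    by (intro integral_mono) (use i ge in \<open>auto simp: space_m\<close>)
  then have "\<Lambda> / A \<le> I + c" by (simp add: prob_space I')
  then have I2: "0 < I + c" using A assms(2) by (smt (verit) divide_pos_pos)
  have "\<bar>(W ^^ n) (\<lambda>x. \<phi> x + c) x - (W ^^ n) (\<lambda>_. I + c) x\<bar> \<le> exp A * (I + c) * rate ^ n"
    unfolding A_def using cone_contraction[of "\<lambda>x. \<phi> x + c" "\<lambda>_. I + c" x n] ll A I2 x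
    by (simp add: prob_space I' A_def log_lip_const)
  also have "\<dots> \<le> exp A * (2 * \<Lambda> + \<Lambda> / A) * rate ^ n"
    using I1 rate by (intro mult_right_mono mult_left_mono) auto
  also have "(W ^^ n) (\<lambda>x. \<phi> x + c) x - (W ^^ n) (\<lambda>_. I + c) x = (W ^^ n) \<phi> x - (W ^^ n) (\<lambda>_. I) x"
    unfolding W_pow_add by simp
  finally show ?thesis by (simp add: decay_const_def A_def I_def algebra_simps)
qed

end

section \<open>Exactness\<close>

lemma (in finite_measure) integrable_indicator_real: "A \<in> sets M \<Longrightarrow> integrable M (indicator A :: 'a \<Rightarrow> real)"
  by (rule integrable_real_indicator) (simp_all add: less_top[symmetric])

lemma integrable_mult_of_square_integrable:
  fixes f g :: "'a \<Rightarrow> real"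
  assumes [measurable]: "f \<in> borel_measurable M" "g \<in> borel_measurable M"
    and sq: "integrable M (\<lambda>x. (f x)\<^sup>2)" "integrable M (\<lambda>x. (g x)\<^sup>2)"
  shows "integrable M (\<lambda>x. f x * g x)"
proof (rule Bochner_Integration.integrable_bound[OF Bochner_Integration.integrable_add[OF sq]])
  have "\<bar>f x * g x\<bar> \<le> (f x)\<^sup>2 + (g x)\<^sup>2" for x
  proof -
    have "2 * (\<bar>f x\<bar> * \<bar>g x\<bar>) \<le> (f x)\<^sup>2 + (g x)\<^sup>2"
      using sum_squares_bound[of "\<bar>f x\<bar>" "\<bar>g x\<bar>"] by simp
    moreover have "0 \<le> \<bar>f x\<bar> * \<bar>g x\<bar>" by simp
    ultimately show ?thesis unfolding abs_mult by linarith
  qed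
  then show "AE x in M. norm (f x * g x) \<le> norm ((f x)\<^sup>2 + (g x)\<^sup>2)" by simp
qed simp

locale measure_preserving = prob_space M for M :: "'a measure" +
  fixes T :: "'a \<Rightarrow> 'a"
  assumes T_measurable [measurable]: "T \<in> measurable M M"
    and distr_T: "distr M M T = M"
begin

lemma T_pow_measurable [measurable]: "(T ^^ n) \<in> measurable M M"
  by (induction n) auto

lemma distr_T_pow: "distr M M (T ^^ n) = M"
proof (induction n)
  case (Suc n)
  have "distr M M (T ^^ Suc n) = distr (distr M M (T ^^ n)) M T"
    by (subst distr_distr) simp_all
  then show ?case by (simp only: Suc.IH distr_T)
qed (simp add: distr_id2)

lemma T_pow_space: "x \<in> space M \<Longrightarrow> (T ^^ n) x \<in> space M"
  by (rule measurable_space[OF T_pow_measurable])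

lemma integral_T_pow:
  fixes f :: "'a \<Rightarrow> 'b::{banach, second_countable_topology}"
  assumes [measurable]: "f \<in> borel_measurable M"
  shows "(\<integral>x. f ((T ^^ n) x) \<partial>M) = (\<integral>x. f x \<partial>M)"
  using integral_distr[OF T_pow_measurable[of n], of f] by (simp add: distr_T_pow)

lemma integrable_T_pow:
  fixes f :: "'a \<Rightarrow> 'b::{banach, second_countable_topology}"
  assumes [measurable]: "f \<in> borel_measurable M"
  shows "integrable M (\<lambda>x. f ((T ^^ n) x)) \<longleftrightarrow> integrable M f"
  using integrable_distr_eq[OF T_pow_measurable[of n], of f] by (simp add: distr_T_pow)

lemmas integral_T = integral_T_pow[where n=1, simplified]
lemmas integrable_T = integrable_T_pow[where n=1, simplified]

text \<open>Asymptotic independence of \<open>v\<close> from the tail \<open>\<sigma>\<close>-algebra, stated without the transfer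
  operator: \<open>\<parallel>P\<^sup>j v - \<integral> v\<parallel>\<^sub>1 \<longlonglongrightarrow> 0\<close>.\<close>

definition tail_mixing :: "('a \<Rightarrow> real) \<Rightarrow> bool" where
  "tail_mixing v \<longleftrightarrow> (\<forall>\<epsilon>>0. \<exists>j. \<forall>G\<in>borel_measurable M. (\<forall>x\<in>space M. \<bar>G x\<bar> \<le> 1) \<longrightarrow>
     \<bar>(\<integral>x. v x * G ((T ^^ j) x) \<partial>M) - (\<integral>x. v x \<partial>M) * (\<integral>x. G x \<partial>M)\<bar> \<le> \<epsilon>)"

text \<open>Passing from one time \<open>j\<close> to all later times \<open>i\<close> costs
  nothing: \<open>G\<close> composed with \<open>T ^^ (i - j)\<close> is again a test function, with
  the same mean by invariance.\<close>

lemma tail_mixingE: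
  assumes "tail_mixing v" "\<epsilon> > 0"
  obtains j where "\<And>i G. j \<le> i \<Longrightarrow> G \<in> borel_measurable M \<Longrightarrow> (\<And>x. x \<in> space M \<Longrightarrow> \<bar>G x\<bar> \<le> 1) \<Longrightarrow>
     \<bar>(\<integral>x. v x * G ((T ^^ i) x) \<partial>M) - (\<integral>x. v x \<partial>M) * (\<integral>x. G x \<partial>M)\<bar> \<le> \<epsilon>"
proof -
  obtain j where j: "\<And>G. G\<in>borel_measurable M \<Longrightarrow> (\<forall>x\<in>space M. \<bar>G x\<bar> \<le> 1) \<Longrightarrow>
     \<bar>(\<integral>x. v x * G ((T ^^ j) x) \<partial>M) - (\<integral>x. v x \<partial>M) * (\<integral>x. G x \<partial>M)\<bar> \<le> \<epsilon>"
    using assms unfolding tail_mixing_def by blast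
  show ?thesis
  proof (rule that)
    fix i and G :: "'a \<Rightarrow> real" assume *: "j \<le> i" "G \<in> borel_measurable M" "\<And>x. x \<in> space M \<Longrightarrow> \<bar>G x\<bar> \<le> 1"
    note [measurable] = *(2)
    have "\<bar>(\<integral>x. v x * G ((T ^^ (i - j)) ((T ^^ j) x)) \<partial>M) - (\<integral>x. v x \<partial>M) * (\<integral>x. G ((T ^^ (i - j)) x) \<partial>M)\<bar> \<le> \<epsilon>"
      by (intro j) (auto intro!: *(3) T_pow_space)
    moreover have "(T ^^ (i - j)) ((T ^^ j) x) = (T ^^ i) x" for x
      using *(1) by (simp flip: funpow_add[unfolded o_def, THEN fun_cong])
    ultimately show "\<bar>(\<integral>x. v x * G ((T ^^ i) x) \<partial>M) - (\<integral>x. v x \<partial>M) * (\<integral>x. G x \<partial>M)\<bar> \<le> \<epsilon>"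
      by (simp add: integral_T_pow)
  qed
qed

lemma integrable_mult_bounded:
  fixes v G :: "'a \<Rightarrow> real"
  assumes "integrable M v" "G \<in> borel_measurable M" "\<And>x. x \<in> space M \<Longrightarrow> \<bar>G x\<bar> \<le> 1"
  shows "integrable M (\<lambda>x. v x * G x)"
proof (rule Bochner_Integration.integrable_bound)
  show "integrable M (\<lambda>x. \<bar>v x\<bar>)" using assms by simp
  show "AE x in M. norm (v x * G x) \<le> norm \<bar>v x\<bar>"
    using assms(3) by (auto simp: abs_mult intro!: mult_left_le)
qed (use assms in simp)

lemma tail_mixing_add:
  assumes f: "integrable M f" "tail_mixing f" and g: "integrable M g" "tail_mixing g"
  shows "tail_mixing (\<lambda>x. f x + g x)"
  unfolding tail_mixing_def
proof (intro allI impI)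
  fix \<epsilon> :: real assume "\<epsilon> > 0"
  then have "\<epsilon> / 2 > 0" by simp
  obtain j1 where j1: "\<And>i G. j1 \<le> i \<Longrightarrow> G \<in> borel_measurable M \<Longrightarrow> (\<And>x. x \<in> space M \<Longrightarrow> \<bar>G x\<bar> \<le> 1) \<Longrightarrow>
     \<bar>(\<integral>x. f x * G ((T ^^ i) x) \<partial>M) - (\<integral>x. f x \<partial>M) * (\<integral>x. G x \<partial>M)\<bar> \<le> \<epsilon> / 2"
    using tail_mixingE[OF f(2) \<open>\<epsilon> / 2 > 0\<close>] by blast
  obtain j2 where j2: "\<And>i G. j2 \<le> i \<Longrightarrow> G \<in> borel_measurable M \<Longrightarrow> (\<And>x. x \<in> space M \<Longrightarrow> \<bar>G x\<bar> \<le> 1) \<Longrightarrow>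
     \<bar>(\<integral>x. g x * G ((T ^^ i) x) \<partial>M) - (\<integral>x. g x \<partial>M) * (\<integral>x. G x \<partial>M)\<bar> \<le> \<epsilon> / 2"
    using tail_mixingE[OF g(2) \<open>\<epsilon> / 2 > 0\<close>] by blast
  define j where "j = max j1 j2"
  show "\<exists>j. \<forall>G\<in>borel_measurable M. (\<forall>x\<in>space M. \<bar>G x\<bar> \<le> 1) \<longrightarrow>
     \<bar>(\<integral>x. (f x + g x) * G ((T ^^ j) x) \<partial>M) - (\<integral>x. f x + g x \<partial>M) * (\<integral>x. G x \<partial>M)\<bar> \<le> \<epsilon>"
  proof (intro exI[of _ j] ballI impI)
    fix G :: "'a \<Rightarrow> real" assume G[measurable]: "G \<in> borel_measurable M" and G1: "\<forall>x\<in>space M. \<bar>G x\<bar> \<le> 1"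
    have i: "integrable M (\<lambda>x. f x * G ((T ^^ j) x))" "integrable M (\<lambda>x. g x * G ((T ^^ j) x))"
      by (intro integrable_mult_bounded f g; use G1 T_pow_space in auto)+
    have "(\<integral>x. (f x + g x) * G ((T ^^ j) x) \<partial>M) - (\<integral>x. f x + g x \<partial>M) * (\<integral>x. G x \<partial>M) =
      ((\<integral>x. f x * G ((T ^^ j) x) \<partial>M) - (\<integral>x. f x \<partial>M) * (\<integral>x. G x \<partial>M)) +
      ((\<integral>x. g x * G ((T ^^ j) x) \<partial>M) - (\<integral>x. g x \<partial>M) * (\<integral>x. G x \<partial>M))"
      using i f g by (simp add: algebra_simps)
    moreover have "\<bar>(\<integral>x. f x * G ((T ^^ j) x) \<partial>M) - (\<integral>x. f x \<partial>M) * (\<integral>x. G x \<partial>M)\<bar> \<le> \<epsilon> / 2"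
      "\<bar>(\<integral>x. g x * G ((T ^^ j) x) \<partial>M) - (\<integral>x. g x \<partial>M) * (\<integral>x. G x \<partial>M)\<bar> \<le> \<epsilon> / 2"
      by (intro j1 j2; use G1 in \<open>simp add: j_def\<close>)+
    ultimately show "\<bar>(\<integral>x. (f x + g x) * G ((T ^^ j) x) \<partial>M) - (\<integral>x. f x + g x \<partial>M) * (\<integral>x. G x \<partial>M)\<bar> \<le> \<epsilon>"
      by linarith
  qed
qed

lemma tail_mixing_cmult:
  assumes f: "tail_mixing f"
  shows "tail_mixing (\<lambda>x. f x * c)"
  unfolding tail_mixing_def
proof (intro allI impI)
  fix \<epsilon> :: real assume "\<epsilon> > 0"
  then have "\<epsilon> / (\<bar>c\<bar> + 1) > 0" by simp
  then obtain j where j: "\<And>i G. j \<le> i \<Longrightarrow> G \<in> borel_measurable M \<Longrightarrow> (\<And>x. x \<in> space M \<Longrightarrow> \<bar>G x\<bar> \<le> 1) \<Longrightarrow>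
     \<bar>(\<integral>x. f x * G ((T ^^ i) x) \<partial>M) - (\<integral>x. f x \<partial>M) * (\<integral>x. G x \<partial>M)\<bar> \<le> \<epsilon> / (\<bar>c\<bar> + 1)"
    using tail_mixingE[OF f] by blast
  show "\<exists>j. \<forall>G\<in>borel_measurable M. (\<forall>x\<in>space M. \<bar>G x\<bar> \<le> 1) \<longrightarrow>
     \<bar>(\<integral>x. f x * c * G ((T ^^ j) x) \<partial>M) - (\<integral>x. f x * c \<partial>M) * (\<integral>x. G x \<partial>M)\<bar> \<le> \<epsilon>"
  proof (intro exI[of _ j] ballI impI)
    fix G :: "'a \<Rightarrow> real" assume G: "G \<in> borel_measurable M" "\<forall>x\<in>space M. \<bar>G x\<bar> \<le> 1"
    have "(\<integral>x. f x * c * G ((T ^^ j) x) \<partial>M) = (\<integral>x. c * (f x * G ((T ^^ j) x)) \<partial>M)"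
      by (simp add: mult_ac)
    then have "\<bar>(\<integral>x. f x * c * G ((T ^^ j) x) \<partial>M) - (\<integral>x. f x * c \<partial>M) * (\<integral>x. G x \<partial>M)\<bar> =
      \<bar>c\<bar> * \<bar>(\<integral>x. f x * G ((T ^^ j) x) \<partial>M) - (\<integral>x. f x \<partial>M) * (\<integral>x. G x \<partial>M)\<bar>"
      by (simp add: algebra_simps flip: abs_mult)
    also have "\<dots> \<le> (\<bar>c\<bar> + 1) * (\<epsilon> / (\<bar>c\<bar> + 1))"
      using j[of j G] G by (intro mult_mono) auto
    finally show "\<bar>(\<integral>x. f x * c * G ((T ^^ j) x) \<partial>M) - (\<integral>x. f x * c \<partial>M) * (\<integral>x. G x \<partial>M)\<bar> \<le> \<epsilon>"
      by (simp add: add_nonneg_eq_0_iff)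
  qed
qed

text \<open>The distance in \<open>L\<^sup>1\<close> controls both terms of the defining inequality
  uniformly in the test function and in time.\<close>

lemma tail_mixing_L1_closed:
  assumes f: "integrable M f"
    and s: "\<And>\<epsilon>. \<epsilon> > 0 \<Longrightarrow> \<exists>g. integrable M g \<and> tail_mixing g \<and> (\<integral>x. \<bar>f x - g x\<bar> \<partial>M) \<le> \<epsilon>"
  shows "tail_mixing f"
  unfolding tail_mixing_def
proof (intro allI impI)
  fix \<epsilon> :: real assume "\<epsilon> > 0"
  then have e: "\<epsilon> / 3 > 0" by simp
  obtain g where g: "integrable M g" "tail_mixing g" "(\<integral>x. \<bar>f x - g x\<bar> \<partial>M) \<le> \<epsilon> / 3" using s[OF e] by blast
  obtain j where j: "\<And>i G. j \<le> i \<Longrightarrow> G \<in> borel_measurable M \<Longrightarrow> (\<And>x. x \<in> space M \<Longrightarrow> \<bar>G x\<bar> \<le> 1) \<Longrightarrow>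
     \<bar>(\<integral>x. g x * G ((T ^^ i) x) \<partial>M) - (\<integral>x. g x \<partial>M) * (\<integral>x. G x \<partial>M)\<bar> \<le> \<epsilon> / 3"
    using tail_mixingE[OF g(2) e] by blast
  show "\<exists>j. \<forall>G\<in>borel_measurable M. (\<forall>x\<in>space M. \<bar>G x\<bar> \<le> 1) \<longrightarrow>
     \<bar>(\<integral>x. f x * G ((T ^^ j) x) \<partial>M) - (\<integral>x. f x \<partial>M) * (\<integral>x. G x \<partial>M)\<bar> \<le> \<epsilon>"
  proof (intro exI[of _ j] ballI impI)
    fix G :: "'a \<Rightarrow> real" assume G[measurable]: "G \<in> borel_measurable M" and G1: "\<forall>x\<in>space M. \<bar>G x\<bar> \<le> 1"
    have i: "integrable M (\<lambda>x. f x * G ((T ^^ j) x))" "integrable M (\<lambda>x. g x * G ((T ^^ j) x))"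
      by (intro integrable_mult_bounded f g; use G1 T_pow_space in auto)+
    have "\<bar>(\<integral>x. f x * G ((T ^^ j) x) \<partial>M) - (\<integral>x. g x * G ((T ^^ j) x) \<partial>M)\<bar> =
      \<bar>\<integral>x. f x * G ((T ^^ j) x) - g x * G ((T ^^ j) x) \<partial>M\<bar>" using i by simp
    also have "\<dots> \<le> (\<integral>x. \<bar>f x - g x\<bar> \<partial>M)"
      by (intro integral_abs_bound[THEN order_trans] integral_mono integrable_abs Bochner_Integration.integrable_diff i f g)
         (use G1 T_pow_space in \<open>auto simp: abs_mult simp flip: left_diff_distrib intro!: mult_left_le\<close>)
    finally have 1: "\<bar>(\<integral>x. f x * G ((T ^^ j) x) \<partial>M) - (\<integral>x. g x * G ((T ^^ j) x) \<partial>M)\<bar> \<le> \<epsilon> / 3" using g by simp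
    have "\<bar>(\<integral>x. f x \<partial>M) - (\<integral>x. g x \<partial>M)\<bar> = \<bar>\<integral>x. f x - g x \<partial>M\<bar>" using f g by simp
    also have "\<dots> \<le> \<epsilon> / 3" using g(3) integral_abs_bound[of M "\<lambda>x. f x - g x"] by linarith
    finally have 2: "\<bar>(\<integral>x. f x \<partial>M) - (\<integral>x. g x \<partial>M)\<bar> \<le> \<epsilon> / 3" .
    have "\<bar>\<integral>x. G x \<partial>M\<bar> \<le> (\<integral>x. \<bar>G x\<bar> \<partial>M)" by (rule integral_abs_bound)
    also have "\<dots> \<le> (\<integral>x. 1 \<partial>M)"
    proof (rule integral_mono)
      show "integrable M (\<lambda>x. \<bar>G x\<bar>)" by (rule integrable_const_bound[where B=1]) (use G1 in auto)
    qed (use G1 in auto)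
    finally have 3: "\<bar>\<integral>x. G x \<partial>M\<bar> \<le> 1" by (simp add: prob_space)
    have "\<bar>(\<integral>x. f x \<partial>M) - (\<integral>x. g x \<partial>M)\<bar> * \<bar>\<integral>x. G x \<partial>M\<bar> \<le> (\<epsilon> / 3) * 1"
      using 2 3 \<open>\<epsilon> > 0\<close> by (intro mult_mono) auto
    then have "\<bar>(\<integral>x. f x \<partial>M) * (\<integral>x. G x \<partial>M) - (\<integral>x. g x \<partial>M) * (\<integral>x. G x \<partial>M)\<bar> \<le> \<epsilon> / 3"
      by (simp add: left_diff_distrib flip: abs_mult)
    moreover have "\<bar>(\<integral>x. g x * G ((T ^^ j) x) \<partial>M) - (\<integral>x. g x \<partial>M) * (\<integral>x. G x \<partial>M)\<bar> \<le> \<epsilon> / 3"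
      using G1 by (intro j) auto
    ultimately show "\<bar>(\<integral>x. f x * G ((T ^^ j) x) \<partial>M) - (\<integral>x. f x \<partial>M) * (\<integral>x. G x \<partial>M)\<bar> \<le> \<epsilon>"
      using 1 by linarith
  qed
qed

lemma tail_mixing_dominated_limit:
  assumes s: "\<And>i. integrable M (s i)" "\<And>i. tail_mixing (s i)"
    and lim: "\<And>x. x \<in> space M \<Longrightarrow> (\<lambda>i. s i x) \<longlonglongrightarrow> f x"
    and bound: "\<And>i x. x \<in> space M \<Longrightarrow> \<bar>s i x\<bar> \<le> g x"
    and g: "integrable M g" and f: "f \<in> borel_measurable M"
  shows "tail_mixing f"
proof (rule tail_mixing_L1_closed)
  note [measurable] = f borel_measurable_integrable[OF s(1)]
  have fb: "\<bar>f x\<bar> \<le> g x" if "x \<in> space M" for x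
    by (rule LIMSEQ_le_const2[OF tendsto_rabs[OF lim[OF that]]]) (use bound that in auto)
  show "integrable M f" by (rule Bochner_Integration.integrable_bound[OF g f]) (use fb in force)
  have "(\<lambda>i. \<integral>x. \<bar>f x - s i x\<bar> \<partial>M) \<longlonglongrightarrow> (\<integral>x. 0 \<partial>M)"
  proof (rule integral_dominated_convergence[where w="\<lambda>x. 2 * g x"])
    show "AE x in M. (\<lambda>i. \<bar>f x - s i x\<bar>) \<longlonglongrightarrow> 0"
    proof (rule AE_I2)
      fix x assume "x \<in> space M"
      then have "(\<lambda>i. \<bar>f x - s i x\<bar>) \<longlonglongrightarrow> \<bar>f x - f x\<bar>" by (intro tendsto_intros lim)
      then show "(\<lambda>i. \<bar>f x - s i x\<bar>) \<longlonglongrightarrow> 0" by simp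
    qed
    show "AE x in M. norm \<bar>f x - s i x\<bar> \<le> 2 * g x" for i
      using fb bound[of _ i] by (intro AE_I2) (simp, smt (verit))
  qed (use g in auto)
  then have *: "(\<lambda>i. \<integral>x. \<bar>f x - s i x\<bar> \<partial>M) \<longlonglongrightarrow> 0" by simp
  fix \<epsilon> :: real assume "\<epsilon> > 0"
  from order_tendstoD(2)[OF * this] obtain i where "(\<integral>x. \<bar>f x - s i x\<bar> \<partial>M) < \<epsilon>"
    by (auto simp: eventually_sequentially)
  then show "\<exists>g. integrable M g \<and> tail_mixing g \<and> (\<integral>x. \<bar>f x - g x\<bar> \<partial>M) \<le> \<epsilon>"
    using s by (intro exI[of _ "s i"]) auto
qed

lemma tail_mixing_const: "tail_mixing (\<lambda>_. c)"
  unfolding tail_mixing_def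
proof (intro allI impI exI[of _ 0] ballI)
  fix \<epsilon> :: real and G :: "'a \<Rightarrow> real" assume "\<epsilon> > 0" "G \<in> borel_measurable M"
  show "\<bar>(\<integral>x. c * G ((T ^^ 0) x) \<partial>M) - (\<integral>x. c \<partial>M) * (\<integral>x. G x \<partial>M)\<bar> \<le> \<epsilon>"
    using \<open>\<epsilon> > 0\<close> by (simp add: prob_space)
qed

lemma tail_mixing_integrable:
  assumes ind: "\<And>A. A \<in> sets M \<Longrightarrow> tail_mixing (indicator A)" and "integrable M f"
  shows "tail_mixing f"
  using assms(2)
proof induction
  case (base A c)
  then show ?case using tail_mixing_cmult[OF ind, of A c] by simp
next
  case (add f g)
  then show ?case by (intro tail_mixing_add)
next
  case (lim f s)
  then show ?case
    by (intro tail_mixing_dominated_limit[of s f "\<lambda>x. 2 * \<bar>f x\<bar>"]) auto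
qed

text \<open>Dynkin's pi-lambda theorem: linearity and dominated limits close the class of sets with
  tail-mixing indicator under complements and disjoint countable unions.\<close>

lemma tail_mixing_generated:
  assumes sets: "sets M = sigma_sets (space M) E" and E: "Int_stable E" "E \<subseteq> Pow (space M)"
    and mix: "\<And>A. A \<in> E \<Longrightarrow> tail_mixing (indicator A)" and f: "integrable M f"
  shows "tail_mixing f"
proof (rule tail_mixing_integrable[OF _ f])
  fix A assume "A \<in> sets M"
  then have "A \<in> sigma_sets (space M) E" by (simp add: sets)
  with E show "tail_mixing (indicator A)"
  proof (induction rule: sigma_sets_induct_disjoint)
    case (basic A)
    then show ?case by (rule mix)
  next
    case empty
    then show ?case using tail_mixing_const[of 0] by (simp add: indicator_def)
  next
    case (compl A)
    then have [measurable]: "A \<in> sets M" by (simp add: sets)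
    have "tail_mixing (\<lambda>x. 1 + indicator A x * (- 1))"
      by (intro tail_mixing_add tail_mixing_const tail_mixing_cmult compl integrable_mult_left
            integrable_indicator_real) auto
    \<comment> \<open>The two functions agree only on \<open>space M\<close>; the definition sees
      them only through integrals over \<open>M\<close>.\<close>
    also have "?this \<longleftrightarrow> tail_mixing (indicator (space M - A))"
      unfolding tail_mixing_def
      by (intro all_cong1 imp_cong refl ex_cong1 ball_cong arg_cong2[of _ _ _ _ "(\<le>)"] arg_cong[where f=abs]
           arg_cong2[of _ _ _ _ "(-)"] arg_cong2[of _ _ _ _ "(*)"] Bochner_Integration.integral_cong)
         (auto simp: indicator_def)
    finally show ?case .
  next
    case (union A)
    then have [measurable]: "A i \<in> sets M" for i by (auto simp: sets)
    have fin: "tail_mixing (\<lambda>x. \<Sum>i<n. indicator (A i) x)" for n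
    proof (induction n)
      case (Suc n)
      then show ?case unfolding sum.lessThan_Suc using union(3)
        by (intro tail_mixing_add Bochner_Integration.integrable_sum integrable_indicator_real) auto
    qed (simp add: tail_mixing_const)
    have eq: "(\<Sum>i<n. indicator (A i) x) = (indicator (\<Union>i<n. A i) x :: real)" for n x
      using union(1) by (subst indicator_UN_disjoint) (auto intro: disjoint_family_on_mono)
    show ?case
    proof (rule tail_mixing_dominated_limit[where s="\<lambda>n x. \<Sum>i<n. indicator (A i) x" and g="\<lambda>_. 1"])
      show "(\<lambda>n. \<Sum>i<n. indicator (A i) x) \<longlonglongrightarrow> (indicator (\<Union>(range A)) x :: real)" for x
        unfolding eq by (rule LIMSEQ_indicator_UN)
      show "integrable M (\<lambda>x. \<Sum>i<n. indicator (A i) x :: real)" for n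
        by (intro Bochner_Integration.integrable_sum integrable_indicator_real) simp
      show "\<bar>\<Sum>i<n. indicator (A i) x\<bar> \<le> (1::real)" for n x
        unfolding eq by (simp add: indicator_def)
    qed (rule fin, simp, measurable)
  qed
qed

end

section \<open>A martingale central limit theorem\<close>

lemma norm_iexp_diff_le: "cmod (iexp x - 1) \<le> \<bar>x\<bar>"
  using iexp_approx1[of x 0] by simp

text \<open>The cubic bound makes the remainder small; the quadratic one supplies an integrable
  majorant when the variable has no third moment.\<close>

lemma iexp_quadratic_bound:
  "cmod (iexp y - (1 + \<i> * y - y\<^sup>2 / 2)) \<le> min (y\<^sup>2) (\<bar>y\<bar> ^ 3)"
proof -
  have eq: "(\<Sum>k\<le>2. (\<i> * y) ^ k / fact k) = 1 + \<i> * y - y\<^sup>2 / 2"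
    by (simp add: numeral_2_eq_2 power2_eq_square algebra_simps)
  have "cmod (iexp y - (1 + \<i> * y - y\<^sup>2 / 2)) \<le> 2 * \<bar>y\<bar> ^ 2 / fact 2"
    using iexp_approx2[of y 2] unfolding eq .
  then have 1: "cmod (iexp y - (1 + \<i> * y - y\<^sup>2 / 2)) \<le> y\<^sup>2" by simp
  have "cmod (iexp y - (1 + \<i> * y - y\<^sup>2 / 2)) \<le> \<bar>y\<bar> ^ 3 / fact 3"
    using iexp_approx1[of y 2] unfolding eq by (simp add: eval_nat_numeral)
  also have "\<dots> \<le> \<bar>y\<bar> ^ 3" by (simp add: fact_numeral field_simps)
  finally show ?thesis using 1 by simp
qed

locale exact_system = measure_preserving +
  assumes exact: "integrable M v \<Longrightarrow> tail_mixing v"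
begin

lemma exact_complex:
  fixes v :: "'a \<Rightarrow> real"
  assumes v: "integrable M v" "(\<integral>x. v x \<partial>M) = 0" and "\<epsilon> > 0"
  obtains j where "\<And>i G :: 'a \<Rightarrow> complex. j \<le> i \<Longrightarrow> G \<in> borel_measurable M \<Longrightarrow> (\<And>x. x \<in> space M \<Longrightarrow> cmod (G x) \<le> 1) \<Longrightarrow>
     cmod (\<integral>x. v x * G ((T ^^ i) x) \<partial>M) \<le> \<epsilon>"
proof -
  have e: "\<epsilon> / 2 > 0" using assms by simp
  obtain j where j: "\<And>i G. j \<le> i \<Longrightarrow> G \<in> borel_measurable M \<Longrightarrow> (\<And>x. x \<in> space M \<Longrightarrow> \<bar>G x\<bar> \<le> 1) \<Longrightarrow>
     \<bar>(\<integral>x. v x * G ((T ^^ i) x) \<partial>M) - (\<integral>x. v x \<partial>M) * (\<integral>x. G x \<partial>M)\<bar> \<le> \<epsilon> / 2"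
    using tail_mixingE[OF exact[OF v(1)] e] by blast
  show ?thesis
  proof (rule that)
    fix i and G :: "'a \<Rightarrow> complex"
    assume ij: "j \<le> i" and G[measurable]: "G \<in> borel_measurable M" and G1: "\<And>x. x \<in> space M \<Longrightarrow> cmod (G x) \<le> 1"
    have R: "\<bar>Re (G x)\<bar> \<le> 1" "\<bar>Im (G x)\<bar> \<le> 1" if "x \<in> space M" for x
      using G1[OF that] abs_Re_le_cmod[of "G x"] abs_Im_le_cmod[of "G x"] by auto
    have v': "v \<in> borel_measurable M" using v by simp
    have int: "integrable M (\<lambda>x. v x * G ((T ^^ i) x))"
    proof (rule Bochner_Integration.integrable_bound[OF v(1)])
      show "AE x in M. norm (v x * G ((T ^^ i) x)) \<le> norm (v x)"
        using G1 T_pow_space by (auto simp: norm_mult intro!: mult_left_le)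
    qed (use v' in measurable)
    have "\<bar>Re (\<integral>x. v x * G ((T ^^ i) x) \<partial>M)\<bar> \<le> \<epsilon> / 2"
    proof -
      have "Re (\<integral>x. v x * G ((T ^^ i) x) \<partial>M) = (\<integral>x. v x * Re (G ((T ^^ i) x)) \<partial>M)"
        using int by (simp flip: integral_Re)
      then show ?thesis using j[OF ij, of "\<lambda>x. Re (G x)"] R v by simp
    qed
    moreover have "\<bar>Im (\<integral>x. v x * G ((T ^^ i) x) \<partial>M)\<bar> \<le> \<epsilon> / 2"
    proof -
      have "Im (\<integral>x. v x * G ((T ^^ i) x) \<partial>M) = (\<integral>x. v x * Im (G ((T ^^ i) x)) \<partial>M)"
        using int by (simp flip: integral_Im)
      then show ?thesis using j[OF ij, of "\<lambda>x. Im (G x)"] R v by simp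
    qed
    ultimately show "cmod (\<integral>x. v x * G ((T ^^ i) x) \<partial>M) \<le> \<epsilon>"
      using cmod_le[of "\<integral>x. v x * G ((T ^^ i) x) \<partial>M"] by linarith
  qed
qed

end

text \<open>\<open>orthogonal\<close> expresses by duality that \<open>d\<close> has conditional
  expectation 0 given the sigma-algebra pulled back by \<open>T\<close>, whose measurable functions
  are those of the form \<open>G (T x)\<close>.\<close>

locale martingale_difference = exact_system +
  fixes d :: "'a \<Rightarrow> real"
  assumes d_measurable [measurable]: "d \<in> borel_measurable M"
    and d_square: "integrable M (\<lambda>x. (d x)\<^sup>2)"
    and orthogonal: "\<And>G. G \<in> borel_measurable M \<Longrightarrow> integrable M (\<lambda>x. (G x)\<^sup>2) \<Longrightarrow>
      (\<integral>x. d x * G (T x) \<partial>M) = 0"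
begin

definition S :: "nat \<Rightarrow> 'a \<Rightarrow> real" where "S n x = (\<Sum>i<n. d ((T ^^ i) x))"

definition var :: real where "var = (\<integral>x. (d x)\<^sup>2 \<partial>M)"

lemma S_measurable [measurable]: "S n \<in> borel_measurable M"
  unfolding S_def by measurable

lemma S_0: "S 0 x = 0" by (simp add: S_def)

text \<open>The first summand is split off, not the last: the rest is a function of
  \<open>T x\<close>, which is what \<open>orthogonal\<close> and exactness can be applied
  to.\<close>

lemma S_Suc: "S (Suc n) x = d x + S n (T x)"
  by (simp add: S_def sum.lessThan_Suc_shift funpow_swap1 del: sum.lessThan_Suc)

lemma S_split: "S (m + n) x = S m x + S n ((T ^^ m) x)"
  by (induction m arbitrary: x) (simp_all add: S_0 S_Suc funpow_swap1)

lemma d_integrable: "integrable M d"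
  by (rule square_integrable_imp_integrable) (use d_square in auto)

lemma centred_square: "integrable M (\<lambda>x. (d x)\<^sup>2 - var)" "(\<integral>x. (d x)\<^sup>2 - var \<partial>M) = 0"
  using d_square by (auto simp: prob_space var_def)

text \<open>The conditional variance may be replaced by its mean: modulo a small perturbation of the
  exponent, the first \<open>j\<close> summands can be dropped, and then exactness applies.\<close>

lemma char_correlation_small:
  assumes s: "s \<longlonglongrightarrow> 0" and "\<epsilon> > 0"
  shows "\<forall>\<^sub>F n in sequentially. \<forall>m.
    cmod (\<integral>x. ((d x)\<^sup>2 - var) * iexp (s n * S m (T x)) \<partial>M) \<le> \<epsilon>"
proof -
  define v where "v x = (d x)\<^sup>2 - var" for x
  have [measurable]: "v \<in> borel_measurable M" unfolding v_def by measurable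
  have v: "integrable M v" "(\<integral>x. v x \<partial>M) = 0" unfolding v_def using centred_square by auto
  have "\<epsilon> / 2 > 0" using \<open>\<epsilon> > 0\<close> by simp
  then obtain j where j: "\<And>i G :: 'a \<Rightarrow> complex. j \<le> i \<Longrightarrow> G \<in> borel_measurable M \<Longrightarrow> (\<And>x. x \<in> space M \<Longrightarrow> cmod (G x) \<le> 1) \<Longrightarrow>
     cmod (\<integral>x. v x * G ((T ^^ i) x) \<partial>M) \<le> \<epsilon> / 2"
    using exact_complex[OF v] by blast
  \<comment> \<open>\<open>B\<close> bounds the dropped part of the sum for every \<open>m\<close>
    at once; this is the source of the uniformity in \<open>m\<close>.\<close>
  define B where "B x = (\<Sum>i<j. \<bar>d ((T ^^ i) (T x))\<bar>)" for x
  have [measurable]: "B \<in> borel_measurable M" unfolding B_def by measurable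
  have B0: "0 \<le> B x" for x by (auto simp: B_def intro: sum_nonneg)
  have SB: "\<bar>S (min m j) (T x)\<bar> \<le> B x" for m x
  proof -
    have "\<bar>S (min m j) (T x)\<bar> \<le> (\<Sum>i<min m j. \<bar>d ((T ^^ i) (T x))\<bar>)"
      unfolding S_def by (rule sum_abs)
    also have "\<dots> \<le> B x" unfolding B_def by (rule sum_mono2) auto
    finally show ?thesis .
  qed
  \<comment> \<open>The product of \<open>v\<close> and \<open>B\<close> need not be integrable.
    Capping at 2, the trivial bound for the distance of two numbers of modulus 1, gives the
    integrable majorant \<open>2 * \<bar>v x\<bar>\<close>.\<close>
  have i1: "integrable M (\<lambda>x. \<bar>v x\<bar> * min 2 (\<bar>s n\<bar> * B x))" for n
    by (rule Bochner_Integration.integrable_bound[where f="\<lambda>x. 2 * v x"])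
       (use v B0 in \<open>auto simp: abs_mult mult.commute intro!: mult_mono\<close>)
  have "(\<lambda>n. \<integral>x. \<bar>v x\<bar> * min 2 (\<bar>s n\<bar> * B x) \<partial>M) \<longlonglongrightarrow> (\<integral>x. 0 \<partial>M)"
  proof (rule integral_dominated_convergence[where w="\<lambda>x. 2 * \<bar>v x\<bar>"])
    show "AE x in M. (\<lambda>n. \<bar>v x\<bar> * min 2 (\<bar>s n\<bar> * B x)) \<longlonglongrightarrow> 0"
    proof (rule AE_I2)
      fix x
      have "(\<lambda>n. \<bar>v x\<bar> * min 2 (\<bar>s n\<bar> * B x)) \<longlonglongrightarrow> \<bar>v x\<bar> * min 2 (\<bar>0\<bar> * B x)"
        by (intro tendsto_intros s)
      then show "(\<lambda>n. \<bar>v x\<bar> * min 2 (\<bar>s n\<bar> * B x)) \<longlonglongrightarrow> 0" by simp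
    qed
    show "AE x in M. norm (\<bar>v x\<bar> * min 2 (\<bar>s n\<bar> * B x)) \<le> 2 * \<bar>v x\<bar>" for n
      using B0 by (intro AE_I2) (auto simp: abs_mult mult.commute[of 2] intro!: mult_left_mono)
  qed (use v in auto)
  then have lim: "(\<lambda>n. \<integral>x. \<bar>v x\<bar> * min 2 (\<bar>s n\<bar> * B x) \<partial>M) \<longlonglongrightarrow> 0" by simp
  have "\<forall>\<^sub>F n in sequentially. (\<integral>x. \<bar>v x\<bar> * min 2 (\<bar>s n\<bar> * B x) \<partial>M) < \<epsilon> / 2"
    using order_tendstoD(2)[OF lim \<open>\<epsilon> / 2 > 0\<close>] .
  then show ?thesis
  proof (eventually_elim, intro allI)
    fix n m assume n: "(\<integral>x. \<bar>v x\<bar> * min 2 (\<bar>s n\<bar> * B x) \<partial>M) < \<epsilon> / 2"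
    define E1 where "E1 x = iexp (s n * S m (T x))" for x
    define E2 where "E2 x = iexp (s n * S (m - j) ((T ^^ Suc j) x))" for x
    have [measurable]: "E1 \<in> borel_measurable M" "E2 \<in> borel_measurable M"
      unfolding E1_def E2_def by measurable
    have i2: "integrable M (\<lambda>x. v x * E1 x)" "integrable M (\<lambda>x. v x * E2 x)"
      by (rule Bochner_Integration.integrable_bound[OF v(1)]; simp add: norm_mult E1_def E2_def)+
    have diff: "cmod (E1 x - E2 x) \<le> min 2 (\<bar>s n\<bar> * B x)" for x
    proof -
      have "cmod (E1 x - E2 x) \<le> cmod (E1 x) + cmod (E2 x)" by (rule norm_triangle_ineq4)
      then have 1: "cmod (E1 x - E2 x) \<le> 2" by (simp add: E1_def E2_def)
      \<comment> \<open>For \<open>m \<le> j\<close> the truncated difference \<open>m - j\<close>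
        is 0, so everything is dropped and \<open>E2\<close> is identically 1.\<close>
      have "S m (T x) = S (min m j) (T x) + S (m - j) ((T ^^ Suc j) x)"
      proof (cases "m \<le> j")
        case False
        then show ?thesis using S_split[of j "m - j" "T x"] by (simp add: funpow_swap1)
      qed (simp add: S_0)
      then have "E1 x = iexp (s n * S (min m j) (T x)) * E2 x"
        unfolding E1_def E2_def by (simp add: distrib_left exp_add)
      then have "E1 x - E2 x = (iexp (s n * S (min m j) (T x)) - 1) * E2 x" by (simp add: algebra_simps)
      then have "cmod (E1 x - E2 x) = cmod (iexp (s n * S (min m j) (T x)) - 1)"
        by (simp add: norm_mult E2_def)
      also have "\<dots> \<le> \<bar>s n * S (min m j) (T x)\<bar>" by (rule norm_iexp_diff_le)
      also have "\<dots> \<le> \<bar>s n\<bar> * B x" unfolding abs_mult by (intro mult_left_mono SB) auto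
      finally show ?thesis using 1 by simp
    qed
    have "cmod ((\<integral>x. v x * E1 x \<partial>M) - (\<integral>x. v x * E2 x \<partial>M)) = cmod (\<integral>x. v x * E1 x - v x * E2 x \<partial>M)"
      using i2 by simp
    also have "\<dots> \<le> (\<integral>x. cmod (v x * E1 x - v x * E2 x) \<partial>M)" by (rule integral_norm_bound)
    also have "\<dots> \<le> (\<integral>x. \<bar>v x\<bar> * min 2 (\<bar>s n\<bar> * B x) \<partial>M)"
    proof (rule integral_mono[OF _ i1])
      show "cmod (v x * E1 x - v x * E2 x) \<le> \<bar>v x\<bar> * min 2 (\<bar>s n\<bar> * B x)" for x
        using mult_left_mono[OF diff[of x], of "\<bar>v x\<bar>"] by (simp add: norm_mult flip: right_diff_distrib)
    qed (use i2 in auto)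
    finally have "cmod ((\<integral>x. v x * E1 x \<partial>M) - (\<integral>x. v x * E2 x \<partial>M)) \<le> \<epsilon> / 2" using n by simp
    moreover have "cmod (\<integral>x. v x * E2 x \<partial>M) \<le> \<epsilon> / 2"
      \<comment> \<open>Time \<open>Suc j\<close>: one step for the \<open>T\<close> in
        \<open>S m (T x)\<close> and \<open>j\<close> for the dropped summands.\<close>
      unfolding E2_def using j[of "Suc j" "\<lambda>x. iexp (s n * S (m - j) x)"] by simp
    ultimately have "cmod (\<integral>x. v x * E1 x \<partial>M) \<le> \<epsilon>"
      using norm_triangle_sub[of "\<integral>x. v x * E1 x \<partial>M" "\<integral>x. v x * E2 x \<partial>M"] by simp
    then show "cmod (\<integral>x. ((d x)\<^sup>2 - var) * iexp (s n * S m (T x)) \<partial>M) \<le> \<epsilon>"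
      by (simp add: E1_def v_def)
  qed
qed

definition phi :: "real \<Rightarrow> nat \<Rightarrow> complex" where
  "phi s n = (\<integral>x. iexp (s * S n x) \<partial>M)"

lemma phi_0: "phi s 0 = 1"
  by (simp add: phi_def S_0 prob_space)

text \<open>In the second-order expansion of \<open>iexp (s * d x)\<close> the linear term is killed
  by \<open>orthogonal\<close>. The two errors are the Taylor remainder and the deviation of
  \<open>(d x)\<^sup>2\<close> from \<open>var\<close>.\<close>

lemma phi_step:
  "cmod (phi s (Suc m) - (1 - s\<^sup>2 * var / 2) * phi s m) \<le>
     s\<^sup>2 * ((\<integral>x. min ((d x)\<^sup>2) (\<bar>s\<bar> * \<bar>d x\<bar> ^ 3) \<partial>M) +
       cmod (\<integral>x. ((d x)\<^sup>2 - var) * iexp (s * S m (T x)) \<partial>M) / 2)"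
proof -
  define G where "G x = iexp (s * S m x)" for x
  have Gm [measurable]: "G \<in> borel_measurable M" unfolding G_def by measurable
  have G1: "cmod (G x) = 1" for x by (simp add: G_def)
  define R where "R x = iexp (s * d x) - (1 + \<i> * (s * d x) - (s * d x)\<^sup>2 / 2)" for x
  have [measurable]: "R \<in> borel_measurable M" unfolding R_def by measurable
  have R: "cmod (R x) \<le> s\<^sup>2 * min ((d x)\<^sup>2) (\<bar>s\<bar> * \<bar>d x\<bar> ^ 3)" for x
  proof -
    have "cmod (R x) \<le> min ((s * d x)\<^sup>2) (\<bar>s * d x\<bar> ^ 3)"
      unfolding R_def using iexp_quadratic_bound[of "s * d x"] by simp
    also have "\<dots> = s\<^sup>2 * min ((d x)\<^sup>2) (\<bar>s\<bar> * \<bar>d x\<bar> ^ 3)"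
    proof -
      have "\<bar>s\<bar> ^ 3 = s\<^sup>2 * \<bar>s\<bar>" by (simp add: power3_eq_cube power2_eq_square)
      then show ?thesis by (simp add: min_mult_distrib_left power_mult_distrib abs_mult)
    qed
    finally show ?thesis .
  qed
  have im: "integrable M (\<lambda>x. min ((d x)\<^sup>2) (\<bar>s\<bar> * \<bar>d x\<bar> ^ 3))"
    by (rule Bochner_Integration.integrable_bound[OF d_square]) auto
  have iR: "integrable M R"
    by (rule Bochner_Integration.integrable_bound[OF integrable_mult_right[OF im, of "s\<^sup>2"]])
       (use R in \<open>auto simp: abs_mult\<close>)
  have times_G: "integrable M (\<lambda>x. f x * G (T x))" if "integrable M f" for f :: "'a \<Rightarrow> complex"
    by (rule Bochner_Integration.integrable_bound[OF that]) (use that in \<open>auto simp: norm_mult G1\<close>)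
  define v where "v x = (d x)\<^sup>2 - var" for x
  have v: "integrable M v" unfolding v_def by (rule centred_square)
  have iG: "integrable M (\<lambda>x. G (T x))" using times_G[of "\<lambda>_. 1"] by simp
  have id: "integrable M (\<lambda>x. complex_of_real (d x) * G (T x))" by (intro times_G integrable_of_real d_integrable)
  have iv: "integrable M (\<lambda>x. complex_of_real (v x) * G (T x))" by (intro times_G integrable_of_real v)
  have iRG: "integrable M (\<lambda>x. R x * G (T x))" by (intro times_G iR)
  have GT: "(\<integral>x. G (T x) \<partial>M) = phi s m" unfolding phi_def G_def by (rule integral_T) measurable
  have dG: "(\<integral>x. complex_of_real (d x) * G (T x) \<partial>M) = 0"
  proof -
    have sq: "integrable M (\<lambda>x. (f (G x))\<^sup>2)" if "\<And>z. \<bar>f z\<bar> \<le> cmod z" "f \<in> borel_measurable borel" for f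
    proof (rule integrable_const_bound[where B=1])
      show "AE x in M. norm ((f (G x))\<^sup>2) \<le> 1"
        using that(1)[of "G _"] by (auto simp: G1 abs_square_le_1)
    qed (use that(2) in measurable)
    have "Re (\<integral>x. complex_of_real (d x) * G (T x) \<partial>M) = (\<integral>x. d x * Re (G (T x)) \<partial>M)"
      using id by (simp flip: integral_Re)
    also have "\<dots> = 0" by (rule orthogonal) (use sq[of Re] in \<open>auto simp: abs_Re_le_cmod\<close>)
    finally have 1: "Re (\<integral>x. complex_of_real (d x) * G (T x) \<partial>M) = 0" .
    have "Im (\<integral>x. complex_of_real (d x) * G (T x) \<partial>M) = (\<integral>x. d x * Im (G (T x)) \<partial>M)"
      using id by (simp flip: integral_Im)
    also have "\<dots> = 0" by (rule orthogonal) (use sq[of Im] in \<open>auto simp: abs_Im_le_cmod\<close>)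
    finally show ?thesis using 1 by (simp add: complex_eq_iff)
  qed
  have "iexp (s * S (Suc m) x) = (1 - s\<^sup>2 * var / 2) * G (T x) + (\<i> * s) * (d x * G (T x))
      + (- (s\<^sup>2 / 2)) * (v x * G (T x)) + R x * G (T x)" for x
  proof -
    have "iexp (s * S (Suc m) x) = iexp (s * d x) * G (T x)"
      by (simp add: S_Suc G_def distrib_left exp_add)
    also have "iexp (s * d x) = (1 - s\<^sup>2 * var / 2) + (\<i> * s) * d x + (- (s\<^sup>2 / 2)) * v x + R x"
      by (simp add: R_def v_def power_mult_distrib field_simps)
    finally show ?thesis by (simp add: algebra_simps)
  qed
  then have "phi s (Suc m) = (\<integral>x. (1 - s\<^sup>2 * var / 2) * G (T x) + (\<i> * s) * (d x * G (T x))
      + (- (s\<^sup>2 / 2)) * (v x * G (T x)) + R x * G (T x) \<partial>M)"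
    by (simp add: phi_def)
  also have "\<dots> = (1 - s\<^sup>2 * var / 2) * phi s m + (- (s\<^sup>2 / 2)) * (\<integral>x. v x * G (T x) \<partial>M) + (\<integral>x. R x * G (T x) \<partial>M)"
  proof -
    have "(\<integral>x. (1 - s\<^sup>2 * var / 2) * G (T x) + (\<i> * s) * (d x * G (T x))
      + (- (s\<^sup>2 / 2)) * (v x * G (T x)) + R x * G (T x) \<partial>M)
      = (\<integral>x. (1 - s\<^sup>2 * var / 2) * G (T x) \<partial>M) + (\<integral>x. (\<i> * s) * (d x * G (T x)) \<partial>M)
      + (\<integral>x. (- (s\<^sup>2 / 2)) * (v x * G (T x)) \<partial>M) + (\<integral>x. R x * G (T x) \<partial>M)"
      by (simp only: Bochner_Integration.integral_add Bochner_Integration.integrable_add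
           integrable_mult_right iG id iv iRG)
    also have "\<dots> = (1 - s\<^sup>2 * var / 2) * phi s m + (- (s\<^sup>2 / 2)) * (\<integral>x. v x * G (T x) \<partial>M) + (\<integral>x. R x * G (T x) \<partial>M)"
      by (simp only: integral_mult_right_zero GT dG mult_zero_right add_0_right)
    finally show ?thesis .
  qed
  finally have "phi s (Suc m) - (1 - s\<^sup>2 * var / 2) * phi s m =
     (- (s\<^sup>2 / 2)) * (\<integral>x. v x * G (T x) \<partial>M) + (\<integral>x. R x * G (T x) \<partial>M)" by simp
  then have "cmod (phi s (Suc m) - (1 - s\<^sup>2 * var / 2) * phi s m) \<le>
     cmod ((- (s\<^sup>2 / 2)) * (\<integral>x. v x * G (T x) \<partial>M)) + cmod (\<integral>x. R x * G (T x) \<partial>M)"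
    by (simp only: norm_triangle_ineq)
  also have "cmod ((- (s\<^sup>2 / 2)) * (\<integral>x. v x * G (T x) \<partial>M)) = s\<^sup>2 / 2 * cmod (\<integral>x. v x * G (T x) \<partial>M)"
    by (simp add: norm_mult norm_divide norm_power)
  also have "cmod (\<integral>x. R x * G (T x) \<partial>M) \<le> (\<integral>x. cmod (R x * G (T x)) \<partial>M)" by (rule integral_norm_bound)
  also have "\<dots> \<le> (\<integral>x. s\<^sup>2 * min ((d x)\<^sup>2) (\<bar>s\<bar> * \<bar>d x\<bar> ^ 3) \<partial>M)"
    by (intro integral_mono integrable_mult_right im integrable_norm iRG) (simp add: norm_mult G1 R)
  finally show ?thesis by (simp add: G_def v_def algebra_simps)
qed

text \<open>The bound on \<open>s\<^sup>2 * var\<close> keeps the multiplier between 0 and 1, so the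
  one-step errors add up without being amplified.\<close>

lemma phi_iterate:
  assumes step: "\<And>m. cmod (phi s (Suc m) - (1 - s\<^sup>2 * var / 2) * phi s m) \<le> e"
    and s: "s\<^sup>2 * var \<le> 2"
  shows "cmod (phi s n - (1 - s\<^sup>2 * var / 2) ^ n) \<le> n * e"
proof (induction n)
  case (Suc n)
  have var: "0 \<le> var" by (simp add: var_def)
  define q :: complex where "q = 1 - s\<^sup>2 * var / 2"
  have "q = complex_of_real (1 - s\<^sup>2 * var / 2)" by (simp add: q_def)
  then have "cmod q = \<bar>1 - s\<^sup>2 * var / 2\<bar>" by (simp only: norm_of_real)
  also have "\<dots> \<le> 1" using s var by (auto simp: abs_le_iff)
  finally have q: "cmod q \<le> 1" .
  have "phi s (Suc n) - q ^ Suc n = (phi s (Suc n) - q * phi s n) + q * (phi s n - q ^ n)"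
    by (simp add: algebra_simps)
  then have "cmod (phi s (Suc n) - q ^ Suc n) \<le> cmod (phi s (Suc n) - q * phi s n) + cmod (q * (phi s n - q ^ n))"
    by (simp only: norm_triangle_ineq)
  also have "cmod (q * (phi s n - q ^ n)) \<le> 1 * cmod (phi s n - q ^ n)"
    unfolding norm_mult using q by (intro mult_right_mono) auto
  also have "cmod (phi s (Suc n) - q * phi s n) \<le> e" unfolding q_def by (rule step)
  also have "1 * cmod (phi s n - q ^ n) \<le> n * e" using Suc.IH by (simp add: q_def)
  finally show ?case by (simp add: q_def algebra_simps)
qed (simp add: phi_0)

theorem martingale_clt:
  "(\<lambda>n. phi (t / sqrt n) n) \<longlonglongrightarrow> exp (- (t\<^sup>2 * var / 2))"
proof -
  define s where "s n = t / sqrt (real n)" for n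
  have s: "s \<longlonglongrightarrow> 0" unfolding s_def by real_asymp
  define R where "R n = (\<integral>x. min ((d x)\<^sup>2) (\<bar>s n\<bar> * \<bar>d x\<bar> ^ 3) \<partial>M)" for n
  have "R \<longlonglongrightarrow> (\<integral>x. 0 \<partial>M)" unfolding R_def
  proof (rule integral_dominated_convergence[where w="\<lambda>x. (d x)\<^sup>2"])
    show "AE x in M. (\<lambda>n. min ((d x)\<^sup>2) (\<bar>s n\<bar> * \<bar>d x\<bar> ^ 3)) \<longlonglongrightarrow> 0"
    proof (rule AE_I2)
      fix x
      have "(\<lambda>n. min ((d x)\<^sup>2) (\<bar>s n\<bar> * \<bar>d x\<bar> ^ 3)) \<longlonglongrightarrow> min ((d x)\<^sup>2) (\<bar>0\<bar> * \<bar>d x\<bar> ^ 3)"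
        by (intro tendsto_intros s)
      then show "(\<lambda>n. min ((d x)\<^sup>2) (\<bar>s n\<bar> * \<bar>d x\<bar> ^ 3)) \<longlonglongrightarrow> 0" by simp
    qed
  qed (use d_square in auto)
  then have R0: "R \<longlonglongrightarrow> 0" by simp
  have "(\<lambda>n. phi (s n) n - (1 - (s n)\<^sup>2 * var / 2) ^ n) \<longlonglongrightarrow> 0"
  proof (rule tendstoI)
    fix e :: real assume "e > 0"
    \<comment> \<open>The accumulated error is \<open>n * (s n)\<^sup>2 = t\<^sup>2\<close> times
      \<open>3 * \<epsilon> / 2\<close>. The 1 in \<open>c\<close> covers \<open>t = 0\<close> and
      makes the final estimate strict.\<close>
    define c \<epsilon> where "c = t\<^sup>2 + 1" and "\<epsilon> = e / (2 * c)"
    have c: "c > 0" by (simp add: c_def add_nonneg_pos)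
    have \<epsilon>: "\<epsilon> > 0" using \<open>e > 0\<close> c by (simp add: \<epsilon>_def)
    have "(\<lambda>n. (s n)\<^sup>2 * var) \<longlonglongrightarrow> 0\<^sup>2 * var" by (intro tendsto_intros s)
    then have "\<forall>\<^sub>F n in sequentially. (s n)\<^sup>2 * var < 2" by (intro order_tendstoD) auto
    moreover have "\<forall>\<^sub>F n in sequentially. R n < \<epsilon>" using order_tendstoD(2)[OF R0 \<epsilon>] .
    moreover note char_correlation_small[OF s \<epsilon>]
    moreover have "\<forall>\<^sub>F n in sequentially. n > (0::nat)" by (rule eventually_gt_at_top)
    ultimately show "\<forall>\<^sub>F n in sequentially. dist (phi (s n) n - (1 - (s n)\<^sup>2 * var / 2) ^ n) 0 < e"
    proof eventually_elim
      case (elim n)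
      have "cmod (phi (s n) (Suc m) - (1 - (s n)\<^sup>2 * var / 2) * phi (s n) m) \<le> (s n)\<^sup>2 * (\<epsilon> + \<epsilon> / 2)" for m
        by (rule order_trans[OF phi_step], rule mult_left_mono, rule add_mono)
           (use elim in \<open>auto simp: R_def less_imp_le\<close>)
      then have "cmod (phi (s n) n - (1 - (s n)\<^sup>2 * var / 2) ^ n) \<le> n * ((s n)\<^sup>2 * (\<epsilon> + \<epsilon> / 2))"
        by (rule phi_iterate) (use elim in simp)
      also have "\<dots> = (n * (s n)\<^sup>2) * (\<epsilon> + \<epsilon> / 2)" by simp
      also have "n * (s n)\<^sup>2 = t\<^sup>2" using elim by (simp add: s_def power_divide)
      also have "t\<^sup>2 * (\<epsilon> + \<epsilon> / 2) < e"
      proof -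
        have "t\<^sup>2 * (\<epsilon> + \<epsilon> / 2) < c * (2 * \<epsilon>)"
          using \<epsilon> c by (intro mult_strict_mono) (auto simp: c_def)
        also have "\<dots> = e" using c by (simp add: \<epsilon>_def)
        finally show ?thesis .
      qed
      finally show ?case by simp
    qed
  qed
  moreover have "(\<lambda>n. (1 - (s n)\<^sup>2 * var / 2) ^ n) \<longlonglongrightarrow> exp (- (t\<^sup>2 * var / 2))"
  proof (rule Lim_transform_eventually[OF tendsto_exp_limit_sequentially])
    show "\<forall>\<^sub>F n in sequentially. (1 + - (t\<^sup>2 * var / 2) / real n) ^ n = (1 - (s n)\<^sup>2 * var / 2) ^ n"
      using eventually_gt_at_top[of 0] by eventually_elim (simp add: s_def power_divide mult.commute)
  qed
  then have "(\<lambda>n. complex_of_real ((1 - (s n)\<^sup>2 * var / 2) ^ n)) \<longlonglongrightarrow> complex_of_real (exp (- (t\<^sup>2 * var / 2)))"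
    by (rule tendsto_of_real)
  ultimately have "(\<lambda>n. phi (s n) n - (1 - (s n)\<^sup>2 * var / 2) ^ n + (1 - (s n)\<^sup>2 * var / 2) ^ n) \<longlonglongrightarrow>
      0 + complex_of_real (exp (- (t\<^sup>2 * var / 2)))"
    by (intro tendsto_add) simp_all
  then show ?thesis by (simp add: s_def flip: exp_of_real)
qed

lemma S_square: "integrable M (\<lambda>x. (S n x)\<^sup>2) \<and> (\<integral>x. (S n x)\<^sup>2 \<partial>M) = n * var"
proof (induction n)
  case (Suc n)
  have i1: "integrable M (\<lambda>x. (S n (T x))\<^sup>2)" and e1: "(\<integral>x. (S n (T x))\<^sup>2 \<partial>M) = n * var"
    using Suc integrable_T[of "\<lambda>x. (S n x)\<^sup>2"] integral_T[of "\<lambda>x. (S n x)\<^sup>2"] by auto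
  have i2: "integrable M (\<lambda>x. d x * S n (T x))"
    using d_square i1 by (intro integrable_mult_of_square_integrable) auto
  have e2: "(\<integral>x. d x * S n (T x) \<partial>M) = 0" using Suc by (intro orthogonal) auto
  have "(S (Suc n) x)\<^sup>2 = (d x)\<^sup>2 + 2 * (d x * S n (T x)) + (S n (T x))\<^sup>2" for x
    by (simp add: S_Suc power2_eq_square algebra_simps)
  moreover have "integrable M (\<lambda>x. 2 * (d x * S n (T x)))" using i2 by simp
  ultimately show ?case using i1 d_square e1 e2 by (simp add: var_def distrib_right)
qed (simp add: S_0)

end

section \<open>Adding a square integrable coboundary: limit law and asymptotic variance\<close>

locale martingale_coboundary = martingale_difference +
  fixes f u :: "'a \<Rightarrow> real"
  assumes f_measurable [measurable]: "f \<in> borel_measurable M"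
    and u_measurable [measurable]: "u \<in> borel_measurable M"
    and u_square: "integrable M (\<lambda>x. (u x)\<^sup>2)"
    and decomposition: "AE x in M. f x = d x + u x - u (T x)"
begin

definition Sf :: "nat \<Rightarrow> 'a \<Rightarrow> real" where "Sf n x = (\<Sum>i<n. f ((T ^^ i) x))"

lemma Sf_measurable [measurable]: "Sf n \<in> borel_measurable M"
  unfolding Sf_def by measurable

text \<open>The decomposition holds almost everywhere only. By invariance the exceptional null set
  stays null under each preimage by \<open>T ^^ i\<close>, so it holds along almost every orbit and
  telescopes.\<close>

lemma Sf_eq: "AE x in M. Sf n x = S n x + (u x - u ((T ^^ n) x))"
proof -
  have *: "AE x in M. f ((T ^^ i) x) = d ((T ^^ i) x) + u ((T ^^ i) x) - u (T ((T ^^ i) x))" for i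
    by (rule AE_distrD[OF T_pow_measurable[of i]]) (unfold distr_T_pow, rule decomposition)
  have "AE x in M. \<forall>i<n. f ((T ^^ i) x) = d ((T ^^ i) x) + u ((T ^^ i) x) - u (T ((T ^^ i) x))"
    by (subst AE_all_countable) (use * in auto)
  then show ?thesis
  proof eventually_elim
    case (elim x)
    have "Sf m x = S m x + (u x - u ((T ^^ m) x))" if "m \<le> n" for m
      using that by (induction m) (auto simp: Sf_def S_def elim[rule_format])
    then show ?case by simp
  qed
qed

lemma u_integrable: "integrable M u"
  by (rule square_integrable_imp_integrable[OF u_measurable u_square])

text \<open>The coboundary contributes \<open>u x - u ((T ^^ n) x)\<close>, whose mean absolute
  value is bounded independently of \<open>n\<close> and vanishes after division by
  \<open>sqrt n\<close>.\<close>

theorem coboundary_clt: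
  "(\<lambda>n. \<integral>x. iexp (t / sqrt n * Sf n x) \<partial>M) \<longlonglongrightarrow> exp (- (t\<^sup>2 * var / 2))"
proof -
  define U where "U = (\<integral>x. \<bar>u x\<bar> \<partial>M)"
  have bound: "cmod ((\<integral>x. iexp (s * Sf n x) \<partial>M) - phi s n) \<le> \<bar>s\<bar> * (2 * U)" for s n
  proof -
    have i: "integrable M (\<lambda>x. iexp (s * Sf n x))" "integrable M (\<lambda>x. iexp (s * S n x))"
      by (intro integrable_const_bound[where B=1]; simp)+
    have iu: "integrable M (\<lambda>x. \<bar>u x\<bar>)" "integrable M (\<lambda>x. \<bar>u ((T ^^ n) x)\<bar>)"
      using u_integrable integrable_T_pow[of u n] by auto
    have "cmod ((\<integral>x. iexp (s * Sf n x) \<partial>M) - phi s n) = cmod (\<integral>x. iexp (s * Sf n x) - iexp (s * S n x) \<partial>M)"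
      using i by (simp add: phi_def)
    also have "\<dots> \<le> (\<integral>x. cmod (iexp (s * Sf n x) - iexp (s * S n x)) \<partial>M)" by (rule integral_norm_bound)
    also have "\<dots> \<le> (\<integral>x. \<bar>s\<bar> * (\<bar>u x\<bar> + \<bar>u ((T ^^ n) x)\<bar>) \<partial>M)"
    proof (rule integral_mono_AE)
      show "AE x in M. cmod (iexp (s * Sf n x) - iexp (s * S n x)) \<le> \<bar>s\<bar> * (\<bar>u x\<bar> + \<bar>u ((T ^^ n) x)\<bar>)"
        using Sf_eq[of n]
      proof eventually_elim
        case (elim x)
        define w where "w = u x - u ((T ^^ n) x)"
        have "iexp (s * Sf n x) = iexp (s * S n x) * iexp (s * w)"
          unfolding elim w_def[symmetric] by (simp add: distrib_left exp_add)
        then have "iexp (s * Sf n x) - iexp (s * S n x) = iexp (s * S n x) * (iexp (s * w) - 1)"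
          by (simp add: algebra_simps)
        then have "cmod (iexp (s * Sf n x) - iexp (s * S n x)) = cmod (iexp (s * w) - 1)"
          by (simp add: norm_mult)
        also have "\<dots> \<le> \<bar>s * w\<bar>" by (rule norm_iexp_diff_le)
        also have "\<dots> \<le> \<bar>s\<bar> * (\<bar>u x\<bar> + \<bar>u ((T ^^ n) x)\<bar>)"
          unfolding abs_mult w_def by (intro mult_left_mono abs_triangle_ineq4) auto
        finally show ?case .
      qed
    qed (use i iu in auto)
    also have "\<dots> = \<bar>s\<bar> * (2 * U)"
      using iu integral_T_pow[of "\<lambda>x. \<bar>u x\<bar>" n] by (simp add: U_def)
    finally show ?thesis .
  qed
  have "(\<lambda>n. (\<integral>x. iexp (t / sqrt n * Sf n x) \<partial>M) - phi (t / sqrt n) n) \<longlonglongrightarrow> 0"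
  proof (rule Lim_null_comparison)
    show "\<forall>\<^sub>F n in sequentially. cmod ((\<integral>x. iexp (t / sqrt n * Sf n x) \<partial>M) - phi (t / sqrt n) n)
        \<le> \<bar>t / sqrt n\<bar> * (2 * U)"
      by (intro always_eventually allI bound)
    have "(\<lambda>n. t / sqrt (real n)) \<longlonglongrightarrow> 0" by real_asymp
    then have "(\<lambda>n. \<bar>t / sqrt (real n)\<bar> * (2 * U)) \<longlonglongrightarrow> \<bar>0\<bar> * (2 * U)" by (intro tendsto_intros)
    then show "(\<lambda>n. \<bar>t / sqrt (real n)\<bar> * (2 * U)) \<longlonglongrightarrow> 0" by simp
  qed
  from tendsto_add[OF this martingale_clt[of t]] show ?thesis by simp
qed

lemma variance_limit: "(\<lambda>n. \<integral>x. (Sf n x / sqrt n)\<^sup>2 \<partial>M) \<longlonglongrightarrow> var"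
proof -
  define U where "U = (\<integral>x. (u x)\<^sup>2 \<partial>M)"
  \<comment> \<open>The cross term is split by \<open>2 * \<bar>p\<bar> * \<bar>y\<bar> \<le>
    p\<^sup>2 / b n + b n * y\<^sup>2\<close>. What matters is that \<open>b n\<close> tends to
    infinity and \<open>b n / n\<close> to 0; the fourth root of \<open>n\<close> does both.\<close>
  define b where "b n = sqrt (sqrt (real n))" for n
  have est: "\<bar>(\<integral>x. (Sf n x / sqrt n)\<^sup>2 \<partial>M) - var\<bar> \<le> var / b n + 4 * U * (1 + b n) / n" if n: "n > 0" for n
  proof -
    define Y where "Y x = u x - u ((T ^^ n) x)" for x
    have [measurable]: "Y \<in> borel_measurable M" unfolding Y_def by measurable
    have iU: "integrable M (\<lambda>x. (u ((T ^^ n) x))\<^sup>2)" "(\<integral>x. (u ((T ^^ n) x))\<^sup>2 \<partial>M) = U"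
      using u_square integrable_T_pow[of "\<lambda>x. (u x)\<^sup>2" n] integral_T_pow[of "\<lambda>x. (u x)\<^sup>2" n]
      by (auto simp: U_def)
    have Yle: "(Y x)\<^sup>2 \<le> 2 * (u x)\<^sup>2 + 2 * (u ((T ^^ n) x))\<^sup>2" for x
      using zero_le_power2[of "u x + u ((T ^^ n) x)"] by (simp add: Y_def power2_sum power2_diff)
    have iY: "integrable M (\<lambda>x. (Y x)\<^sup>2)"
      by (rule Bochner_Integration.integrable_bound[where f="\<lambda>x. 2 * (u x)\<^sup>2 + 2 * (u ((T ^^ n) x))\<^sup>2"])
         (use u_square iU Yle in auto)
    have YU: "(\<integral>x. (Y x)\<^sup>2 \<partial>M) \<le> 4 * U"
    proof -
      have "(\<integral>x. (Y x)\<^sup>2 \<partial>M) \<le> (\<integral>x. 2 * (u x)\<^sup>2 + 2 * (u ((T ^^ n) x))\<^sup>2 \<partial>M)"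
        by (intro integral_mono iY Yle) (use u_square iU in auto)
      also have "\<dots> = 4 * U" using u_square iU by (simp add: U_def)
      finally show ?thesis .
    qed
    have bn: "b n > 0" using n by (simp add: b_def)
    have iSf: "integrable M (\<lambda>x. (Sf n x)\<^sup>2)"
    proof (rule Bochner_Integration.integrable_bound)
      show "integrable M (\<lambda>x. 2 * (S n x)\<^sup>2 + 2 * (Y x)\<^sup>2)" using S_square[of n] iY by auto
      show "AE x in M. norm ((Sf n x)\<^sup>2) \<le> norm (2 * (S n x)\<^sup>2 + 2 * (Y x)\<^sup>2)"
        using Sf_eq[of n]
      proof eventually_elim
        case (elim x)
        have "(S n x + Y x)\<^sup>2 \<le> 2 * (S n x)\<^sup>2 + 2 * (Y x)\<^sup>2"
          using zero_le_power2[of "S n x - Y x"] by (simp add: power2_sum power2_diff)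
        then show ?case by (simp add: elim Y_def)
      qed
    qed measurable
    have pt: "AE x in M. \<bar>(Sf n x)\<^sup>2 - (S n x)\<^sup>2\<bar> \<le> (S n x)\<^sup>2 / b n + (1 + b n) * (Y x)\<^sup>2"
      using Sf_eq[of n]
    proof eventually_elim
      case (elim x)
      define p y where "p = S n x" and "y = Y x"
      have "0 \<le> (\<bar>p\<bar> - b n * \<bar>y\<bar>)\<^sup>2 / b n" using bn by simp
      also have "\<dots> = p\<^sup>2 / b n + b n * y\<^sup>2 - 2 * \<bar>p\<bar> * \<bar>y\<bar>"
        using bn by (simp add: power2_diff power_mult_distrib diff_divide_distrib add_divide_distrib)
           (simp add: power2_eq_square)
      finally have "2 * \<bar>p\<bar> * \<bar>y\<bar> \<le> p\<^sup>2 / b n + b n * y\<^sup>2" by simp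
      moreover have "(p + y)\<^sup>2 - p\<^sup>2 = 2 * p * y + y\<^sup>2" by (simp add: power2_sum)
      moreover have "\<bar>2 * p * y + y\<^sup>2\<bar> \<le> 2 * \<bar>p\<bar> * \<bar>y\<bar> + y\<^sup>2"
        using abs_triangle_ineq[of "2 * p * y" "y\<^sup>2"] by (simp add: abs_mult)
      ultimately have "\<bar>(p + y)\<^sup>2 - p\<^sup>2\<bar> \<le> p\<^sup>2 / b n + (1 + b n) * y\<^sup>2"
        by (simp add: distrib_right)
      then show ?case unfolding elim by (simp add: p_def y_def Y_def)
    qed
    have "\<bar>(\<integral>x. (Sf n x)\<^sup>2 \<partial>M) - n * var\<bar> = \<bar>\<integral>x. (Sf n x)\<^sup>2 - (S n x)\<^sup>2 \<partial>M\<bar>"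
      using iSf S_square[of n] by simp
    also have "\<dots> \<le> (\<integral>x. \<bar>(Sf n x)\<^sup>2 - (S n x)\<^sup>2\<bar> \<partial>M)" by (rule integral_abs_bound)
    also have "\<dots> \<le> (\<integral>x. (S n x)\<^sup>2 / b n + (1 + b n) * (Y x)\<^sup>2 \<partial>M)"
      by (intro integral_mono_AE pt) (use iSf S_square[of n] iY in auto)
    also have "\<dots> = n * var / b n + (1 + b n) * (\<integral>x. (Y x)\<^sup>2 \<partial>M)"
      using S_square[of n] iY by simp
    also have "\<dots> \<le> n * var / b n + (1 + b n) * (4 * U)"
      using YU bn by (intro add_left_mono mult_left_mono) auto
    finally have "\<bar>(\<integral>x. (Sf n x)\<^sup>2 \<partial>M) - n * var\<bar> / n \<le> (n * var / b n + (1 + b n) * (4 * U)) / n"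
      by (rule divide_right_mono) simp
    also have "\<dots> = var / b n + 4 * U * (1 + b n) / n"
      using n by (simp add: add_divide_distrib mult.commute)
    also have "\<bar>(\<integral>x. (Sf n x)\<^sup>2 \<partial>M) - n * var\<bar> / n = \<bar>((\<integral>x. (Sf n x)\<^sup>2 \<partial>M) - n * var) / n\<bar>"
      using n by (simp add: abs_divide)
    also have "((\<integral>x. (Sf n x)\<^sup>2 \<partial>M) - n * var) / n = (\<integral>x. (Sf n x / sqrt n)\<^sup>2 \<partial>M) - var"
      using n by (simp add: power_divide diff_divide_distrib)
    finally show ?thesis .
  qed
  have "(\<lambda>n. (\<integral>x. (Sf n x / sqrt n)\<^sup>2 \<partial>M) - var) \<longlonglongrightarrow> 0"
  proof (rule Lim_null_comparison)
    show "\<forall>\<^sub>F n in sequentially. norm ((\<integral>x. (Sf n x / sqrt n)\<^sup>2 \<partial>M) - var) \<le> var / b n + 4 * U * (1 + b n) / n"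
      using eventually_gt_at_top[of 0] by eventually_elim (use est in simp)
    have "(\<lambda>n. 1 / b n) \<longlonglongrightarrow> 0" "(\<lambda>n. (1 + b n) / n) \<longlonglongrightarrow> 0"
      unfolding b_def by real_asymp+
    then have "(\<lambda>n. var * (1 / b n) + 4 * U * ((1 + b n) / n)) \<longlonglongrightarrow> var * 0 + 4 * U * 0"
      by (intro tendsto_intros)
    then show "(\<lambda>n. var / b n + 4 * U * (1 + b n) / n) \<longlonglongrightarrow> 0" by simp
  qed
  then show ?thesis by (simp add: LIM_zero_iff)
qed

text \<open>The double sign exhibits the shape \<open>l (T x) - l x\<close> of a coboundary, with
  \<open>l\<close> the negative of \<open>u\<close>.\<close>

lemma coboundary_if_var_0: "var = 0 \<Longrightarrow> AE x in M. f x = - u (T x) - (- u x)"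
proof -
  assume "var = 0"
  then have "AE x in M. (d x)\<^sup>2 = 0"
    using integral_nonneg_eq_0_iff_AE[OF d_square] by (simp add: var_def)
  then show ?thesis using decomposition by eventually_elim simp
qed


lemma normalized_sum_weak_limit:
  assumes "0 < var"
  shows "weak_conv_m (\<lambda>n. distr M borel (\<lambda>x. Sf n x / (sqrt var * sqrt n))) std_normal_distribution"
proof (rule levy_continuity)
  show "real_distribution (distr M borel (\<lambda>x. Sf n x / (sqrt var * sqrt n)))" for n
    by (rule real_distribution_distr) measurable
  show "real_distribution std_normal_distribution" by (rule real_dist_normal_dist)
  fix t :: real
  have "char (distr M borel (\<lambda>x. Sf n x / (sqrt var * sqrt n))) t = (\<integral>x. iexp (t / sqrt var / sqrt n * Sf n x) \<partial>M)" for n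
    unfolding char_def by (subst integral_distr) (simp_all add: mult.commute)
  moreover have "(t / sqrt var)\<^sup>2 * var / 2 = t\<^sup>2 / 2" using assms by (simp add: power_divide)
  moreover have "char std_normal_distribution t = exp (- (t\<^sup>2 / 2))"
    by (simp add: char_std_normal_distribution exp_of_real)
  ultimately show "(\<lambda>n. char (distr M borel (\<lambda>x. Sf n x / (sqrt var * sqrt n))) t) \<longlonglongrightarrow> char std_normal_distribution t"
    using coboundary_clt[of "t / sqrt var"] by simp
qed

lemma normalized_sum_cdf_limit:
  assumes "0 < var"
  shows "(\<lambda>n. measure M {y \<in> space M. Sf n y / (sqrt var * sqrt n) \<le> x}) \<longlonglongrightarrow> cdf std_normal_distribution x"
proof -
  interpret N: real_distribution std_normal_distribution by (rule real_dist_normal_dist)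
  have "emeasure std_normal_distribution {x} = 0"
    by (simp add: emeasure_density nn_integral_cmult_indicator)
  then have "isCont (cdf std_normal_distribution) x"
    by (simp add: N.isCont_cdf measure_def)
  then have "(\<lambda>n. cdf (distr M borel (\<lambda>x. Sf n x / (sqrt var * sqrt n))) x) \<longlonglongrightarrow> cdf std_normal_distribution x"
    using normalized_sum_weak_limit[OF assms] by (simp add: weak_conv_m_def weak_conv_def)
  moreover have "cdf (distr M borel (\<lambda>x. Sf n x / (sqrt var * sqrt n))) x =
      measure M {y \<in> space M. Sf n y / (sqrt var * sqrt n) \<le> x}" for n
    unfolding cdf_def by (subst measure_distr) (auto simp: vimage_def Int_def conj_commute)
  ultimately show ?thesis by simp
qed

end

section \<open>Normalised transfer operators\<close>

text \<open>Here \<open>W\<close> is the transfer operator of \<open>T\<close> with respect to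
  \<open>m\<close>. \<open>T_v\<close> holds only almost everywhere because a piecewise map is
  unrestricted at its break points, which the images of the branches \<open>v j\<close>
  contain.\<close>

locale transfer_kernel = log_lipschitz_kernel +
  fixes T :: "real \<Rightarrow> real"
  assumes T_meas [measurable]: "T \<in> measurable m m"
    and w_sum: "\<And>x. x \<in> {0..1} \<Longrightarrow> (\<Sum>j<k. w j x) = 1"
    and T_v: "AE x in m. \<forall>j<k. T (v j x) = x"
    and transfer: "\<And>F. integrable m F \<Longrightarrow> integrable m (W F) \<and> (\<integral>x. W F x \<partial>m) = (\<integral>x. F x \<partial>m)"
begin

lemma w_nonneg: "j < k \<Longrightarrow> x \<in> {0..1} \<Longrightarrow> 0 \<le> w j x"
  using log_lip_pos[OF w_log_lip] by (simp add: less_imp_le)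

lemma W_const: "x \<in> {0..1} \<Longrightarrow> W (\<lambda>_. c) x = c"
  by (simp add: W_def w_sum flip: sum_distrib_right)

lemma W_pow_const: "x \<in> {0..1} \<Longrightarrow> (W ^^ n) (\<lambda>_. c) x = c"
proof (induction n arbitrary: x)
  case (Suc n)
  have "(W ^^ Suc n) (\<lambda>_. c) x = W (\<lambda>_. c) x"
    unfolding funpow.simps o_def by (rule W_cong[OF _ Suc.prems]) (rule Suc.IH)
  then show ?case using Suc.prems by (simp add: W_const)
qed simp

lemma W_integrable: "integrable m f \<Longrightarrow> integrable m (W f)"
  using transfer by blast

lemma W_pow_integrable: "integrable m f \<Longrightarrow> integrable m ((W ^^ n) f)"
  by (induction n) (auto intro: W_integrable)

lemma W_mult_compose: "AE x in m. W (\<lambda>y. f y * g (T y)) x = W f x * g x"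
  using T_v by eventually_elim (simp add: W_def sum_distrib_right mult.assoc)

text \<open>Conservation of the integral is applied to the product of \<open>f\<close> and
  \<open>g (T x)\<close>, on which \<open>W\<close> acts by pulling \<open>g\<close> out.\<close>

lemma W_dual:
  assumes f: "integrable m f" and g[measurable]: "g \<in> borel_measurable m" and fg: "integrable m (\<lambda>x. f x * g (T x))"
  shows "integrable m (\<lambda>x. W f x * g x)" "(\<integral>x. W f x * g x \<partial>m) = (\<integral>x. f x * g (T x) \<partial>m)"
proof -
  note [measurable] = borel_measurable_integrable[OF W_integrable[OF f]]
    borel_measurable_integrable[OF W_integrable[OF fg]]
  show "integrable m (\<lambda>x. W f x * g x)"
    using W_integrable[OF fg] by (rule integrable_cong_AE_imp) (use W_mult_compose[of f g] in auto)
  have "(\<integral>x. W f x * g x \<partial>m) = (\<integral>x. W (\<lambda>y. f y * g (T y)) x \<partial>m)"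
    using W_mult_compose[of f g] by (intro integral_cong_AE) (measurable, auto)
  then show "(\<integral>x. W f x * g x \<partial>m) = (\<integral>x. f x * g (T x) \<partial>m)" using transfer[OF fg] by simp
qed

text \<open>Duality tested on the constant 1, which \<open>W\<close> fixes.\<close>

lemma T_preserves: "distr m m T = m"
proof (rule measure_eqI)
  fix A assume "A \<in> sets (distr m m T)"
  then have A[measurable]: "A \<in> sets m" by simp
  have "integrable m (\<lambda>x. indicator (T -` A \<inter> space m) x :: real)"
    by (rule integrable_indicator_real) measurable
  then have i: "integrable m (\<lambda>x. 1 * (indicator A (T x) :: real))"
    by (rule Bochner_Integration.integrable_cong[THEN iffD1, rotated -1]) (auto simp: indicator_def)
  have "measure m A = (\<integral>x. W (\<lambda>_. 1) x * indicator A x \<partial>m)"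
  proof -
    have "A \<inter> {0..1} = A" using sets.sets_into_space[OF A] by (auto simp: space_m)
    then show ?thesis
      by (subst Bochner_Integration.integral_cong[OF refl, where g="indicator A"])
         (auto simp: W_const space_m)
  qed
  also have "\<dots> = (\<integral>x. 1 * indicator A (T x) \<partial>m)"
    by (rule W_dual) (use i in auto)
  also have "\<dots> = (\<integral>x. indicator (T -` A \<inter> space m) x \<partial>m)"
    by (intro Bochner_Integration.integral_cong) (auto simp: indicator_def)
  also have "\<dots> = measure m (T -` A \<inter> space m)" by simp
  finally show "emeasure (distr m m T) A = emeasure m A"
    by (simp add: emeasure_distr emeasure_eq_measure)
qed simp

sublocale measure_preserving m T
  by unfold_locales (simp_all add: T_preserves)

lemma W_pow_dual:
  assumes f: "integrable m f" and g[measurable]: "g \<in> borel_measurable m" and g1: "\<And>x. x \<in> space m \<Longrightarrow> \<bar>g x\<bar> \<le> 1"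
  shows "(\<integral>x. (W ^^ n) f x * g x \<partial>m) = (\<integral>x. f x * g ((T ^^ n) x) \<partial>m)"
  using f
proof (induction n arbitrary: f)
  case (Suc n)
  have "(\<integral>x. (W ^^ Suc n) f x * g x \<partial>m) = (\<integral>x. (W ^^ n) (W f) x * g x \<partial>m)"
    by (simp add: funpow_swap1)
  also have "\<dots> = (\<integral>x. W f x * g ((T ^^ n) x) \<partial>m)" by (intro Suc.IH W_integrable Suc.prems)
  also have "\<dots> = (\<integral>x. f x * g ((T ^^ n) (T x)) \<partial>m)"
    by (intro W_dual Suc.prems integrable_mult_bounded) 
       (auto intro!: g1 T_pow_space measurable_space[OF T_meas])
  finally show ?case by (simp add: funpow_swap1)
qed simp

lemma tail_mixing_lipschitz:
  assumes "\<And>x y. x \<in> {0..1} \<Longrightarrow> y \<in> {0..1} \<Longrightarrow> \<bar>\<phi> x - \<phi> y\<bar> \<le> \<Lambda> * \<bar>x - y\<bar>" "0 < \<Lambda>"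
  shows "integrable m \<phi>" "tail_mixing \<phi>"
proof -
  have "\<Lambda>-lipschitz_on {0..1} \<phi>" using assms by (intro lipschitz_onI) (auto simp: dist_real_def)
  then have int: "integrable m \<phi>" by (intro continuous_integrable lipschitz_on_continuous_on)
  show "integrable m \<phi>" by fact
  show "tail_mixing \<phi>" unfolding tail_mixing_def
  proof (intro allI impI)
    fix \<epsilon> :: real assume "\<epsilon> > 0"
    define c where "c = (\<integral>x. \<phi> x \<partial>m)"
    have "(\<lambda>n. decay_const * \<Lambda> * rate ^ n) \<longlonglongrightarrow> decay_const * \<Lambda> * 0"
      by (intro tendsto_intros LIMSEQ_realpow_zero) (use rate in auto)
    then have "(\<lambda>n. decay_const * \<Lambda> * rate ^ n) \<longlonglongrightarrow> 0" by simp
    from order_tendstoD(2)[OF this \<open>\<epsilon> > 0\<close>] obtain n where n: "decay_const * \<Lambda> * rate ^ n < \<epsilon>"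
      by (auto simp: eventually_sequentially)
    show "\<exists>j. \<forall>G\<in>borel_measurable m. (\<forall>x\<in>space m. \<bar>G x\<bar> \<le> 1) \<longrightarrow>
     \<bar>(\<integral>x. \<phi> x * G ((T ^^ j) x) \<partial>m) - (\<integral>x. \<phi> x \<partial>m) * (\<integral>x. G x \<partial>m)\<bar> \<le> \<epsilon>"
    proof (intro exI[of _ n] ballI impI)
      fix G :: "real \<Rightarrow> real" assume G[measurable]: "G \<in> borel_measurable m" and G1: "\<forall>x\<in>space m. \<bar>G x\<bar> \<le> 1"
      have i: "integrable m (\<lambda>x. (W ^^ n) \<phi> x * G x)" "integrable m (\<lambda>x. c * G x)"
        by (intro integrable_mult_bounded W_pow_integrable int; use G1 in simp)+
      have "(\<integral>x. \<phi> x * G ((T ^^ n) x) \<partial>m) - c * (\<integral>x. G x \<partial>m) = (\<integral>x. (W ^^ n) \<phi> x * G x \<partial>m) - (\<integral>x. c * G x \<partial>m)"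
        using W_pow_dual[OF int G, of n] G1 by simp
      also have "\<dots> = (\<integral>x. (W ^^ n) \<phi> x * G x - c * G x \<partial>m)" using i by simp
      finally have eq: "(\<integral>x. \<phi> x * G ((T ^^ n) x) \<partial>m) - c * (\<integral>x. G x \<partial>m) =
        (\<integral>x. (W ^^ n) \<phi> x * G x - c * G x \<partial>m)" .
      have "\<bar>\<integral>x. (W ^^ n) \<phi> x * G x - c * G x \<partial>m\<bar> \<le> (\<integral>x. \<bar>(W ^^ n) \<phi> x * G x - c * G x\<bar> \<partial>m)" by (rule integral_abs_bound)
      also have "\<dots> \<le> (\<integral>x. \<epsilon> \<partial>m)"
      proof (intro integral_mono)
        fix x assume x: "x \<in> space m"
        have "\<bar>(W ^^ n) \<phi> x - c\<bar> \<le> decay_const * \<Lambda> * rate ^ n"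
          using lipschitz_decay[OF assms, of x n] x by (simp add: W_pow_const space_m c_def)
        then have "\<bar>(W ^^ n) \<phi> x - c\<bar> * \<bar>G x\<bar> \<le> \<epsilon> * 1"
          using n G1 x \<open>\<epsilon> > 0\<close> by (intro mult_mono) auto
        then show "\<bar>(W ^^ n) \<phi> x * G x - c * G x\<bar> \<le> \<epsilon>" by (simp add: abs_mult flip: left_diff_distrib)
      qed (use i in auto)
      finally show "\<bar>(\<integral>x. \<phi> x * G ((T ^^ n) x) \<partial>m) - (\<integral>x. \<phi> x \<partial>m) * (\<integral>x. G x \<partial>m)\<bar> \<le> \<epsilon>"
        unfolding eq[symmetric] by (simp add: prob_space c_def)
    qed
  qed
qed

lemma tail_mixing_atMost: "tail_mixing (indicator ({0..1} \<inter> {..a}))"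
proof (rule tail_mixing_dominated_limit[where g="\<lambda>_. 1"])
  \<comment> \<open>Ramps equal to 1 up to \<open>a\<close> and to 0 beyond
    \<open>a + 1 / Suc n\<close>. Their slope is \<open>Suc n\<close>, so the Lipschitz constant is
    positive already for \<open>n = 0\<close>.\<close>
  let ?s = "\<lambda>n x. max 0 (1 - real (Suc n) * max 0 (x - a))"
  have lip: "\<bar>?s n x - ?s n y\<bar> \<le> real (Suc n) * \<bar>x - y\<bar>" for n x y
  proof -
    have "\<bar>?s n x - ?s n y\<bar> \<le> \<bar>real (Suc n) * max 0 (x - a) - real (Suc n) * max 0 (y - a)\<bar>" by linarith
    also have "\<dots> = real (Suc n) * \<bar>max 0 (x - a) - max 0 (y - a)\<bar>"
      by (simp only: abs_mult abs_of_nat flip: right_diff_distrib)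
    also have "\<dots> \<le> real (Suc n) * \<bar>x - y\<bar>" by (intro mult_left_mono) auto
    finally show ?thesis .
  qed
  show "integrable m (?s n)" "tail_mixing (?s n)" for n
    by (rule tail_mixing_lipschitz[OF lip]; simp)+
  show "\<bar>?s n x\<bar> \<le> 1" for n x by (auto simp: max_def)
  show "(\<lambda>n. ?s n x) \<longlonglongrightarrow> indicator ({0..1} \<inter> {..a}) x" if "x \<in> space m" for x
  proof (cases "x \<le> a")
    case False
    obtain N where N: "1 / (x - a) < real N" using reals_Archimedean2 by blast
    have "?s n x = 0" if "n \<ge> N" for n
    proof -
      have "1 < real N * (x - a)" using N False by (simp add: field_simps)
      also have "\<dots> \<le> real (Suc n) * (x - a)" using that False by (intro mult_right_mono) auto
      finally show ?thesis using False by (simp add: max_def)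
    qed
    then have "\<forall>\<^sub>F n in sequentially. ?s n x = 0" by (auto simp: eventually_sequentially)
    then show ?thesis using False by (simp add: tendsto_eventually)
  qed (use that in \<open>simp add: space_m max_def\<close>)
  show "indicator ({0..1} \<inter> {..a}) \<in> borel_measurable m"
    unfolding measurable_m by (intro measurable_restrict_space1 borel_measurable_indicator) auto
qed simp

sublocale exact_system m T
proof unfold_locales
  fix f :: "real \<Rightarrow> real" assume "integrable m f"
  then show "tail_mixing f"
  proof (rule tail_mixing_generated[rotated -1])
    have "sets m = (\<inter>) {0..1} ` sigma_sets UNIV (range atMost)"
      unfolding sets_m sets_restrict_space borel_eq_atMost by (simp add: sets_measure_of_conv)
    also have "\<dots> = sigma_sets {0..1} ((\<inter>) {0..1} ` range atMost)"
      by (rule sigma_sets_Int) (use borel_eq_atMost in \<open>auto simp: borel_eq_atMost[THEN arg_cong[where f=sets], simplified, symmetric]\<close>)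
    finally show "sets m = sigma_sets (space m) ((\<inter>) {0..1} ` range atMost)" by (simp add: space_m)
    have "({0..1} \<inter> {..a}) \<inter> ({0..1} \<inter> {..b}) = {0..1} \<inter> {..min a b}" for a b :: real by auto
    then show "Int_stable ((\<inter>) {0..1} ` range atMost :: real set set)"
      unfolding Int_stable_def by blast
    show "tail_mixing (indicator A)" if "A \<in> (\<inter>) {0..1} ` range atMost" for A :: "real set"
      using that tail_mixing_atMost by blast
  qed (auto simp: space_m)
qed

text \<open>Jensen's inequality for the probability weights \<open>w j x\<close>: the weighted
  variance of the values \<open>f (v j x)\<close> around their mean \<open>A\<close> is
  nonnegative.\<close>

lemma W_square_le: "x \<in> {0..1} \<Longrightarrow> (W f x)\<^sup>2 \<le> W (\<lambda>y. (f y)\<^sup>2) x"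
proof -
  assume x: "x \<in> {0..1}"
  define A where "A = W f x"
  have "0 \<le> (\<Sum>j<k. w j x * (f (v j x) - A)\<^sup>2)" using x w_nonneg by (intro sum_nonneg) auto
  also have "\<dots> = W (\<lambda>y. (f y)\<^sup>2) x - 2 * A * W f x + A\<^sup>2 * (\<Sum>j<k. w j x)"
    unfolding W_def sum_distrib_left sum_subtractf[symmetric] sum.distrib[symmetric]
    by (intro sum.cong) (auto simp: power2_diff algebra_simps)
  also have "\<dots> = W (\<lambda>y. (f y)\<^sup>2) x - A\<^sup>2" using x by (simp add: w_sum A_def power2_eq_square)
  finally show ?thesis by (simp add: A_def)
qed

lemma W_square:
  assumes [measurable]: "f \<in> borel_measurable m" and sq: "integrable m (\<lambda>x. (f x)\<^sup>2)"
  shows "W f \<in> borel_measurable m" "integrable m (\<lambda>x. (W f x)\<^sup>2)"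
    "(\<integral>x. (W f x)\<^sup>2 \<partial>m) \<le> (\<integral>x. (f x)\<^sup>2 \<partial>m)"
proof -
  have "integrable m f" by (rule square_integrable_imp_integrable) (use sq in auto)
  from W_integrable[OF this] show [measurable]: "W f \<in> borel_measurable m" by simp
  have le: "(W f x)\<^sup>2 \<le> W (\<lambda>y. (f y)\<^sup>2) x" if "x \<in> space m" for x
    using that by (simp add: space_m W_square_le)
  have i: "integrable m (W (\<lambda>y. (f y)\<^sup>2))" by (rule W_integrable[OF sq])
  show i2: "integrable m (\<lambda>x. (W f x)\<^sup>2)"
    by (rule Bochner_Integration.integrable_bound[OF i]) (use le in \<open>fastforce+\<close>)
  show "(\<integral>x. (W f x)\<^sup>2 \<partial>m) \<le> (\<integral>x. (f x)\<^sup>2 \<partial>m)"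
    using integral_mono[OF i2 i le] transfer[OF sq] by simp
qed

lemma W_pow_square:
  assumes "f \<in> borel_measurable m" "integrable m (\<lambda>x. (f x)\<^sup>2)"
  shows "(W ^^ n) f \<in> borel_measurable m \<and> integrable m (\<lambda>x. ((W ^^ n) f x)\<^sup>2) \<and>
    (\<integral>x. ((W ^^ n) f x)\<^sup>2 \<partial>m) \<le> (\<integral>x. (f x)\<^sup>2 \<partial>m)"
proof (induction n)
  case (Suc n)
  then show ?case using W_square[of "(W ^^ n) f"] by auto
qed (use assms in auto)

text \<open>The approximation error is only kept from growing, since \<open>W\<close> contracts mean
  squares, while the Lipschitz part decays uniformly. Centring the error costs nothing, because
  subtracting the mean lowers the mean square.\<close>

lemma W_pow_square_decay:
  assumes f[measurable]: "f \<in> borel_measurable m" and sq: "integrable m (\<lambda>x. (f x)\<^sup>2)"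
    and \<phi>: "\<And>x y. x \<in> {0..1} \<Longrightarrow> y \<in> {0..1} \<Longrightarrow> \<bar>\<phi> x - \<phi> y\<bar> \<le> \<Lambda> * \<bar>x - y\<bar>" "0 < \<Lambda>"
  shows "(\<integral>x. ((W ^^ n) (\<lambda>x. f x - (\<integral>y. f y \<partial>m)) x)\<^sup>2 \<partial>m) \<le>
    2 * (\<integral>x. (f x - \<phi> x)\<^sup>2 \<partial>m) + 2 * (decay_const * \<Lambda> * rate ^ n)\<^sup>2"
proof -
  have fi: "integrable m f" by (rule square_integrable_imp_integrable) (use sq in auto)
  have \<phi>i: "integrable m \<phi>" using \<phi> by (rule tail_mixing_lipschitz)
  have cont: "continuous_on {0..1} \<phi>"
    by (rule lipschitz_on_continuous_on[of \<Lambda>]) (use \<phi> in \<open>auto intro!: lipschitz_onI simp: dist_real_def\<close>)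
  have \<phi>sq: "integrable m (\<lambda>x. (\<phi> x)\<^sup>2)" by (intro continuous_integrable continuous_intros cont)
  have [measurable]: "\<phi> \<in> borel_measurable m" using \<phi>i by simp
  define e c where "e x = f x - \<phi> x - (\<integral>y. f y - \<phi> y \<partial>m)" and "c = (\<integral>y. \<phi> y \<partial>m)" for x
  have [measurable]: "e \<in> borel_measurable m" unfolding e_def by measurable
  have fp: "integrable m (\<lambda>x. (f x - \<phi> x)\<^sup>2)"
  proof (rule Bochner_Integration.integrable_bound)
    show "integrable m (\<lambda>x. 2 * (f x)\<^sup>2 + 2 * (\<phi> x)\<^sup>2)" using sq \<phi>sq by auto
    have "(f x - \<phi> x)\<^sup>2 \<le> 2 * (f x)\<^sup>2 + 2 * (\<phi> x)\<^sup>2" for x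
      using zero_le_power2[of "f x + \<phi> x"] by (simp add: power2_sum power2_diff)
    then show "AE x in m. norm ((f x - \<phi> x)\<^sup>2) \<le> norm (2 * (f x)\<^sup>2 + 2 * (\<phi> x)\<^sup>2)" by simp
  qed measurable
  have e_sq: "integrable m (\<lambda>x. (e x)\<^sup>2)" and e_le: "(\<integral>x. (e x)\<^sup>2 \<partial>m) \<le> (\<integral>x. (f x - \<phi> x)\<^sup>2 \<partial>m)"
  proof -
    define g a where "g x = f x - \<phi> x" and "a = (\<integral>y. f y - \<phi> y \<partial>m)" for x
    have gi: "integrable m g" "(\<integral>x. g x \<partial>m) = a" unfolding g_def a_def using fi \<phi>i by auto
    have g2: "integrable m (\<lambda>x. (g x)\<^sup>2)" using fp by (simp add: g_def)
    have eq: "(e x)\<^sup>2 = (g x)\<^sup>2 - 2 * a * g x + a\<^sup>2" for x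
      by (simp add: e_def g_def[symmetric] power2_diff gi(2))
    show "integrable m (\<lambda>x. (e x)\<^sup>2)" unfolding eq using gi g2 by simp
    have "(\<integral>x. (e x)\<^sup>2 \<partial>m) = (\<integral>x. (g x)\<^sup>2 \<partial>m) - a\<^sup>2"
      unfolding eq using gi g2 by (simp add: prob_space power2_eq_square)
    then show "(\<integral>x. (e x)\<^sup>2 \<partial>m) \<le> (\<integral>x. (f x - \<phi> x)\<^sup>2 \<partial>m)" by (simp add: g_def)
  qed
  note we = W_pow_square[of e n, OF _ e_sq]
  define R where "R = decay_const * \<Lambda> * rate ^ n"
  have "(\<integral>x. ((W ^^ n) (\<lambda>x. f x - (\<integral>y. f y \<partial>m)) x)\<^sup>2 \<partial>m) \<le> (\<integral>x. 2 * ((W ^^ n) e x)\<^sup>2 + 2 * R\<^sup>2 \<partial>m)"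
  proof (rule integral_mono)
    show "integrable m (\<lambda>x. 2 * ((W ^^ n) e x)\<^sup>2 + 2 * R\<^sup>2)" using we by simp
    have "integrable m (\<lambda>x. (f x - (\<integral>y. f y \<partial>m))\<^sup>2)"
      using fi sq by (simp add: power2_diff)
    then show "integrable m (\<lambda>x. ((W ^^ n) (\<lambda>x. f x - (\<integral>y. f y \<partial>m)) x)\<^sup>2)"
      by (intro W_pow_square[THEN conjunct2, THEN conjunct1]) auto
    fix x assume "x \<in> space m"
    then have x: "x \<in> {0..1}" by (simp add: space_m)
    have "(\<lambda>x. f x - (\<integral>y. f y \<partial>m)) = (\<lambda>x. e x + (\<phi> x - c))"
      using fi \<phi>i by (simp add: e_def c_def fun_eq_iff)
    then have "(W ^^ n) (\<lambda>x. f x - (\<integral>y. f y \<partial>m)) x = (W ^^ n) e x + ((W ^^ n) \<phi> x - (W ^^ n) (\<lambda>_. c) x)"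
      by (simp add: W_pow_add W_pow_diff)
    moreover have "\<bar>(W ^^ n) \<phi> x - (W ^^ n) (\<lambda>_. c) x\<bar> \<le> R"
      using lipschitz_decay[OF \<phi> x, of n] by (simp add: R_def c_def)
    then have "((W ^^ n) \<phi> x - (W ^^ n) (\<lambda>_. c) x)\<^sup>2 \<le> R\<^sup>2" using power_mono[of "\<bar>_\<bar>" R 2] by simp
    moreover have pq: "(p + q)\<^sup>2 \<le> 2 * p\<^sup>2 + 2 * q\<^sup>2" for p q :: real
      using zero_le_power2[of "p - q"] by (simp add: power2_sum power2_diff)
    note pq[of "(W ^^ n) e x" "(W ^^ n) \<phi> x - (W ^^ n) (\<lambda>_. c) x"]
    ultimately show "((W ^^ n) (\<lambda>x. f x - (\<integral>y. f y \<partial>m)) x)\<^sup>2 \<le> 2 * ((W ^^ n) e x)\<^sup>2 + 2 * R\<^sup>2"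
      by simp
  qed
  also have "\<dots> = 2 * (\<integral>x. ((W ^^ n) e x)\<^sup>2 \<partial>m) + 2 * R\<^sup>2" using we by (simp add: prob_space)
  also have "\<dots> \<le> 2 * (\<integral>x. (f x - \<phi> x)\<^sup>2 \<partial>m) + 2 * R\<^sup>2" using we e_le by simp
  finally show ?thesis by (simp add: R_def)
qed

end

section \<open>Martingale-coboundary decomposition from exponential decay\<close>

lemma AE_summable_of_summable_integral:
  fixes g :: "nat \<Rightarrow> 'a \<Rightarrow> real"
  assumes int: "\<And>n. integrable M (g n)" and nonneg: "\<And>n x. 0 \<le> g n x"
    and sum: "summable (\<lambda>n. \<integral>x. g n x \<partial>M)"
  shows "AE x in M. summable (\<lambda>n. g n x)"
proof -
  have [measurable]: "g n \<in> borel_measurable M" for n using int by simp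
  have "(\<integral>\<^sup>+x. (\<Sum>n. ennreal (g n x)) \<partial>M) = (\<Sum>n. \<integral>\<^sup>+x. ennreal (g n x) \<partial>M)"
    by (rule nn_integral_suminf) measurable
  also have "\<dots> = (\<Sum>n. ennreal (\<integral>x. g n x \<partial>M))"
    using int nonneg by (simp add: nn_integral_eq_integral)
  also have "\<dots> = ennreal (\<Sum>n. \<integral>x. g n x \<partial>M)"
    using nonneg by (intro suminf_ennreal2 sum) (simp add: integral_nonneg_AE)
  finally have "(\<integral>\<^sup>+x. (\<Sum>n. ennreal (g n x)) \<partial>M) \<noteq> \<infinity>" by simp
  then have "AE x in M. (\<Sum>n. ennreal (g n x)) \<noteq> \<infinity>"
    by (intro nn_integral_PInf_AE) auto
  then show ?thesis
    by eventually_elim (use nonneg in \<open>auto intro: summable_suminf_not_top\<close>)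
qed

context transfer_kernel
begin

text \<open>Gordin's decomposition: \<open>u = (\<Sum>n\<ge>1. W\<^sup>n f)\<close> converges in \<open>L\<^sup>2\<close> because
  the weighted square function \<open>V\<close> is integrable.\<close>

lemma gordin_decomposition:
  assumes f[measurable]: "f \<in> borel_measurable m" and sq: "integrable m (\<lambda>x. (f x)\<^sup>2)"
    and decay: "\<And>n. (\<integral>x. ((W ^^ n) f x)\<^sup>2 \<partial>m) \<le> K * r ^ n" and r: "0 < r" "r < 1"
  obtains u where "u \<in> borel_measurable m" "integrable m (\<lambda>x. (u x)\<^sup>2)"
    "martingale_coboundary m T (\<lambda>x. f x + u x - u (T x)) f (\<lambda>x. - u x)"
proof -
  define F where "F n = (W ^^ n) f" for n
  have F: "F n \<in> borel_measurable m" "integrable m (\<lambda>x. (F n x)\<^sup>2)" for n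
    using W_pow_square[OF f sq, of n] by (auto simp: F_def)
  note [measurable] = F(1)
  have Fi: "integrable m (F n)" for n by (rule square_integrable_imp_integrable[OF F])
  \<comment> \<open>The rate is spent in portions: of \<open>r = q\<^sup>2\<close>, one factor
    \<open>q\<close> weights the square function \<open>V\<close> and the other makes its integral
    converge; then \<open>p = sqrt q\<close> is the pointwise rate in
    \<open>\<bar>F n x\<bar> \<le> sqrt (V x) * p ^ n\<close>.\<close>
  define q p where "q = sqrt r" and "p = sqrt q"
  have q: "0 < q" "q < 1" "q\<^sup>2 = r" using r by (auto simp: q_def)
  have p: "0 < p" "p < 1" "p\<^sup>2 = q" using q by (auto simp: p_def)
  have K0: "0 \<le> K" using order_trans[OF integral_nonneg_AE decay[of 0]] by simp
  have decay_q: "(\<integral>x. (F n x)\<^sup>2 / q ^ n \<partial>m) \<le> K * q ^ n" for n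
  proof -
    have "(\<integral>x. (F n x)\<^sup>2 / q ^ n \<partial>m) \<le> K * r ^ n / q ^ n"
      using decay[of n] q by (simp add: F_def divide_right_mono)
    also have "\<dots> = K * q ^ n" using q by (simp add: power2_eq_square power_mult_distrib flip: q(3))
    finally show ?thesis .
  qed
  have Vi: "integrable m (\<lambda>x. (F n x)\<^sup>2 / q ^ n)" for n using F by simp
  have V0: "0 \<le> (F n x)\<^sup>2 / q ^ n" for n x using q by simp
  have Ksum: "summable (\<lambda>n. K * q ^ n)" using q by (intro summable_mult summable_geometric) auto
  have Vsum: "summable (\<lambda>n. \<integral>x. (F n x)\<^sup>2 / q ^ n \<partial>m)"
    by (rule summable_comparison_test'[OF Ksum, of 0])
       (use decay_q V0 q in \<open>auto simp: integral_nonneg_AE\<close>)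
  define V where "V x = (\<Sum>n. (F n x)\<^sup>2 / q ^ n)" for x
  have AE_V: "AE x in m. summable (\<lambda>n. (F n x)\<^sup>2 / q ^ n)"
    by (rule AE_summable_of_summable_integral[OF Vi V0 Vsum])
  have V: "integrable m V" unfolding V_def
    by (rule integrable_suminf[OF Vi]) (use AE_V V0 Vsum q in auto)
  have bound: "\<bar>F n x\<bar> \<le> sqrt (V x) * p ^ n" if "summable (\<lambda>n. (F n x)\<^sup>2 / q ^ n)" for n x
  proof -
    have "(F n x)\<^sup>2 / q ^ n \<le> V x"
      unfolding V_def using sum_le_suminf[OF that, of "{n}"] V0 by auto
    then have "(F n x)\<^sup>2 \<le> V x * q ^ n" using q by (simp add: field_simps)
    then have "sqrt ((F n x)\<^sup>2) \<le> sqrt (V x * q ^ n)" by (rule real_sqrt_le_mono)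
    also have "\<dots> = sqrt (V x) * p ^ n" using q by (simp add: real_sqrt_mult real_sqrt_power p_def)
    finally show ?thesis by simp
  qed
  \<comment> \<open>Starting with \<open>F 1\<close> makes \<open>f + u\<close> the full series,
    which \<open>W\<close> maps to \<open>u\<close>. Hence \<open>f + u\<close> minus
    \<open>u\<close> composed with \<open>T\<close> is formally annihilated by
    \<open>W\<close>.\<close>
  define u where "u x = (\<Sum>n. F (Suc n) x)" for x
  have u_m[measurable]: "u \<in> borel_measurable m" unfolding u_def by measurable
  have geo: "summable (\<lambda>n. s * p ^ n)" for s using p by (intro summable_mult summable_geometric) auto
  have Fsum: "summable (\<lambda>n. \<bar>F n x\<bar>)" if "summable (\<lambda>n. (F n x)\<^sup>2 / q ^ n)" for x
    by (rule summable_comparison_test'[OF geo[of "sqrt (V x)"], of 0]) (use bound[OF that] in auto)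
  have Fsum': "summable (\<lambda>n. \<bar>F (Suc n) x\<bar>)" if "summable (\<lambda>n. (F n x)\<^sup>2 / q ^ n)" for x
    using Fsum[OF that] by (subst summable_Suc_iff)
  have u_sq: "integrable m (\<lambda>x. (u x)\<^sup>2)"
  proof (rule Bochner_Integration.integrable_bound)
    show "integrable m (\<lambda>x. V x * (1 / (1 - p))\<^sup>2)" using V by simp
    show "AE x in m. norm ((u x)\<^sup>2) \<le> norm (V x * (1 / (1 - p))\<^sup>2)"
      using AE_V
    proof eventually_elim
      case (elim x)
      have Vx: "0 \<le> V x" unfolding V_def by (rule suminf_nonneg[OF elim V0])
      have "\<bar>u x\<bar> \<le> (\<Sum>n. \<bar>F (Suc n) x\<bar>)"
        unfolding u_def by (rule summable_rabs[OF Fsum'[OF elim]])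
      also have "\<dots> \<le> (\<Sum>n. \<bar>F n x\<bar>)"
        using suminf_split_head[OF Fsum[OF elim]] by simp
      also have "\<dots> \<le> (\<Sum>n. sqrt (V x) * p ^ n)"
        by (rule suminf_le[OF bound[OF elim] Fsum[OF elim] geo])
      also have "\<dots> = sqrt (V x) * (1 / (1 - p))"
        using p by (simp add: suminf_mult suminf_geometric summable_geometric)
      finally have "\<bar>u x\<bar>\<^sup>2 \<le> (sqrt (V x) * (1 / (1 - p)))\<^sup>2" by (rule power_mono) simp
      then show ?case using Vx by (simp add: power_mult_distrib power_divide)
    qed
  qed measurable
  \<comment> \<open>Weak convergence of the series against square integrable functions is all that
    the orthogonality proof uses.\<close>
  have pairing: "(\<lambda>n. \<integral>x. F (Suc n) x * H x \<partial>m) sums (\<integral>x. u x * H x \<partial>m)"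
    if H[measurable]: "H \<in> borel_measurable m" and H2: "integrable m (\<lambda>x. (H x)\<^sup>2)" for H
  proof -
    have i: "integrable m (\<lambda>x. F (Suc n) x * H x)" for n
      by (intro integrable_mult_of_square_integrable F H H2)
    have "(\<lambda>n. \<integral>x. F (Suc n) x * H x \<partial>m) sums (\<integral>x. (\<Sum>n. F (Suc n) x * H x) \<partial>m)"
    proof (rule sums_integral[OF i])
      show "AE x in m. summable (\<lambda>n. norm (F (Suc n) x * H x))"
        using AE_V by eventually_elim (auto simp: abs_mult intro: summable_mult2 Fsum')
      have "(\<integral>x. norm (F (Suc n) x * H x) \<partial>m) \<le> K * q ^ Suc n + q ^ Suc n * (\<integral>x. (H x)\<^sup>2 \<partial>m)" for n
      proof -
        \<comment> \<open>With this weight in the arithmetic-geometric mean inequality both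
          resulting terms are geometric in \<open>n\<close>.\<close>
        define c where "c = q ^ Suc n"
        have c: "c > 0" using q by (simp add: c_def)
        have "\<bar>a * b\<bar> \<le> a\<^sup>2 / c + c * b\<^sup>2" for a b :: real
        proof -
          have "0 \<le> (\<bar>a\<bar> - c * \<bar>b\<bar>)\<^sup>2 / c" using c by simp
          also have "\<dots> = a\<^sup>2 / c + c * b\<^sup>2 - 2 * \<bar>a * b\<bar>"
            using c by (simp add: power2_diff power_mult_distrib diff_divide_distrib add_divide_distrib abs_mult)
               (simp add: power2_eq_square)
          finally have "2 * \<bar>a * b\<bar> \<le> a\<^sup>2 / c + c * b\<^sup>2" by simp
          then show ?thesis using abs_ge_zero[of "a * b"] by linarith
        qed
        then have "(\<integral>x. norm (F (Suc n) x * H x) \<partial>m) \<le> (\<integral>x. (F (Suc n) x)\<^sup>2 / c + c * (H x)\<^sup>2 \<partial>m)"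
          using i[of n] F(2)[of "Suc n"] H2 by (intro integral_mono) auto
        also have "\<dots> = (\<integral>x. (F (Suc n) x)\<^sup>2 / c \<partial>m) + c * (\<integral>x. (H x)\<^sup>2 \<partial>m)"
          using F(2)[of "Suc n"] H2 by simp
        also have "\<dots> \<le> K * c + c * (\<integral>x. (H x)\<^sup>2 \<partial>m)"
          using decay_q[of "Suc n"] by (simp add: c_def)
        finally show ?thesis by (simp add: c_def)
      qed
      then have le: "(\<integral>x. norm (F (Suc n) x * H x) \<partial>m) \<le> (K + (\<integral>x. (H x)\<^sup>2 \<partial>m)) * q ^ Suc n" for n
        by (simp add: algebra_simps)
      have "summable (\<lambda>n. (K + (\<integral>x. (H x)\<^sup>2 \<partial>m)) * q ^ Suc n)"
        using q by (intro summable_mult) (simp add: summable_geometric summable_mult)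
      then show "summable (\<lambda>n. \<integral>x. norm (F (Suc n) x * H x) \<partial>m)"
        by (rule summable_comparison_test'[of _ 0])
           (use le in \<open>auto simp: integral_nonneg_AE\<close>)
    qed
    also have "(\<integral>x. (\<Sum>n. F (Suc n) x * H x) \<partial>m) = (\<integral>x. u x * H x \<partial>m)"
    proof (rule integral_cong_AE)
      show "AE x in m. (\<Sum>n. F (Suc n) x * H x) = u x * H x"
        using AE_V
      proof eventually_elim
        case (elim x)
        show ?case unfolding u_def
          by (rule suminf_mult2[symmetric, OF summable_rabs_cancel[OF Fsum'[OF elim]]])
      qed
    qed measurable
    finally show ?thesis .
  qed
  show thesis
  \<comment> \<open>The transfer function is \<open>- u\<close>: from
    \<open>d x = f x + u x - u (T x)\<close> one gets
    \<open>f x = d x + (- u x) - (- u (T x))\<close>.\<close>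
  proof (rule that[OF u_m u_sq], unfold_locales)
    have uT: "integrable m (\<lambda>x. (u (T x))\<^sup>2)" using u_sq integrable_T[of "\<lambda>x. (u x)\<^sup>2"] by simp
    have *: "(a + b - c)\<^sup>2 \<le> 3 * (a\<^sup>2 + b\<^sup>2 + c\<^sup>2)" for a b c :: real
    proof -
      have "0 \<le> (a - b)\<^sup>2 + (a + c)\<^sup>2 + (b + c)\<^sup>2" by simp
      then show ?thesis by (simp add: power2_eq_square algebra_simps)
    qed
    show "integrable m (\<lambda>x. (f x + u x - u (T x))\<^sup>2)"
      by (rule Bochner_Integration.integrable_bound[where f="\<lambda>x. 3 * ((f x)\<^sup>2 + (u x)\<^sup>2 + (u (T x))\<^sup>2)"])
         (use sq u_sq uT * in auto)
    show "integrable m (\<lambda>x. (- u x)\<^sup>2)" using u_sq by simp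
    fix G :: "real \<Rightarrow> real" assume G[measurable]: "G \<in> borel_measurable m" and G2: "integrable m (\<lambda>x. (G x)\<^sup>2)"
    have GT2: "integrable m (\<lambda>x. (G (T x))\<^sup>2)" using G2 integrable_T[of "\<lambda>x. (G x)\<^sup>2"] by simp
    have i: "integrable m (\<lambda>x. f x * G (T x))" "integrable m (\<lambda>x. u x * G (T x))"
      "integrable m (\<lambda>x. u (T x) * G (T x))"
      by (intro integrable_mult_of_square_integrable sq u_sq uT GT2; measurable)+
    define b where "b n = (\<integral>x. F (Suc n) x * G x \<partial>m)" for n
    \<comment> \<open>Duality shifts the index: pairing \<open>F n\<close> with
      \<open>G (T x)\<close> is pairing \<open>F (Suc n)\<close> with \<open>G\<close>. Pairing
      \<open>u\<close> with \<open>G (T x)\<close> thus gives the series \<open>b\<close> without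
      its first term, and that missing \<open>b 0\<close> is exactly the pairing of
      \<open>f\<close>.\<close>
    have dual: "(\<integral>x. F n x * G (T x) \<partial>m) = b n" for n
      unfolding b_def F_def funpow.simps o_def
      by (rule W_dual(2)[symmetric])
         (use Fi[of n] in \<open>auto simp: F_def intro!: integrable_mult_of_square_integrable GT2 F(2)[unfolded F_def]
             F(1)[unfolded F_def]\<close>)
    have b: "b sums (\<integral>x. u x * G x \<partial>m)" unfolding b_def by (rule pairing[OF G G2])
    have "(\<lambda>n. b (Suc n)) sums (\<integral>x. u x * G (T x) \<partial>m)"
      using pairing[of "\<lambda>x. G (T x)"] GT2 by (simp add: dual)
    moreover have "(\<lambda>n. b (Suc n)) sums ((\<integral>x. u x * G x \<partial>m) - b 0)"
      using b by (simp add: sums_Suc_iff)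
    ultimately have "(\<integral>x. u x * G (T x) \<partial>m) = (\<integral>x. u x * G x \<partial>m) - b 0" by (rule sums_unique2)
    moreover have "(\<integral>x. f x * G (T x) \<partial>m) = b 0" using dual[of 0] by (simp add: F_def)
    moreover have "(\<integral>x. u (T x) * G (T x) \<partial>m) = (\<integral>x. u x * G x \<partial>m)"
      using integral_T[of "\<lambda>x. u x * G x"] by simp
    ultimately show "(\<integral>x. (f x + u x - u (T x)) * G (T x) \<partial>m) = 0"
      using i by (simp add: distrib_right left_diff_distrib)
  qed (auto simp: sq)
qed

end

section \<open>Invariant densities\<close>

context log_lipschitz_kernel
begin

text \<open>Consecutive iterates of 1 are the images under \<open>W ^^ n\<close> of 1 and
  \<open>W 1\<close>, two cone functions of equal mean, so they differ by a geometrically small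
  amount. The cone inequality passes to the limit.\<close>

lemma invariant_density:
  obtains h where "log_lip cone_const h" "\<And>x. x \<in> {0..1} \<Longrightarrow> W h x = h x" "(\<integral>x. h x \<partial>m) = 1"
proof -
  define a where "a n = (W ^^ n) (\<lambda>_. 1 :: real)" for n
  have cone1: "log_lip cone_const (\<lambda>_. 1)" using cone_const_pos by (simp add: log_lip_const)
  have int1: "(\<integral>x. 1 \<partial>m) = (1::real)" by (simp add: prob_space)
  have a_cone: "log_lip cone_const (a n)" for n unfolding a_def by (rule W_pow_cone[OF cone1])
  have a_int: "(\<integral>x. a n x \<partial>m) = 1" for n
    unfolding a_def using integral_W_pow_cone[OF cone1, of n] by (simp add: prob_space)
  have diff: "\<bar>a (Suc n) x - a n x\<bar> \<le> exp cone_const * rate ^ n" if x: "x \<in> {0..1}" for x n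
  proof -
    have "\<bar>(W ^^ n) (\<lambda>_. 1) x - (W ^^ n) (W (\<lambda>_. 1)) x\<bar> \<le> exp cone_const * (\<integral>x. 1 \<partial>m) * rate ^ n"
      by (rule cone_contraction[OF cone1 W_cone[OF cone1] _ x])
         (use integral_W[of "\<lambda>_. 1"] in simp)
    then show ?thesis by (simp add: a_def funpow_swap1 prob_space abs_minus_commute)
  qed
  define h where "h x = lim (\<lambda>n. a n x)" for x
  have lim: "(\<lambda>n. a n x) \<longlonglongrightarrow> h x" if x: "x \<in> {0..1}" for x
  proof -
    have "summable (\<lambda>n. exp cone_const * rate ^ n)"
      using rate by (intro summable_mult summable_geometric) auto
    then have "summable (\<lambda>n. a (Suc n) x - a n x)"
      by (rule summable_comparison_test'[of _ 0]) (use diff[OF x] in auto)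
    then have "convergent (\<lambda>n. \<Sum>i<n. a (Suc i) x - a i x)" by (simp add: summable_iff_convergent)
    then have "convergent (\<lambda>n. a n x - a 0 x)" using sum_lessThan_telescope[of "\<lambda>n. a n x"] by simp
    then have "convergent (\<lambda>n. a n x - a 0 x + a 0 x)" by (intro convergent_add convergent_const)
    then show ?thesis unfolding h_def by (simp add: convergent_LIMSEQ_iff)
  qed
  have bounds: "exp (- cone_const) \<le> a n x" "a n x \<le> exp cone_const" if "x \<in> {0..1}" for n x
    using log_lip_integral_bounds[OF a_cone _ that] cone_const_pos by (simp_all add: a_int)
  have h_cone: "log_lip cone_const h" unfolding log_lip_def
  proof (intro conjI ballI)
    fix x :: real assume x: "x \<in> {0..1}"
    \<comment> \<open>Strict positivity is not preserved by limits; the uniform lower bound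
      is.\<close>
    have "exp (- cone_const) \<le> h x"
      by (rule LIMSEQ_le_const[OF lim[OF x]]) (use bounds x in auto)
    then show "0 < h x" by (rule less_le_trans[rotated]) simp
  next
    fix x y :: real assume xy: "x \<in> {0..1}" "y \<in> {0..1}"
    show "h x \<le> h y * exp (cone_const * \<bar>x - y\<bar>)"
      by (rule LIMSEQ_le[OF lim[OF xy(1)] tendsto_mult_right[OF lim[OF xy(2)]]])
         (use log_lipD[OF a_cone xy] in auto)
  qed
  have "W h x = h x" if x: "x \<in> {0..1}" for x
  proof (rule LIMSEQ_unique)
    show "(\<lambda>n. a (Suc n) x) \<longlonglongrightarrow> h x" using lim[OF x] by (rule LIMSEQ_Suc)
    have "(\<lambda>n. \<Sum>j<k. w j x * a n (v j x)) \<longlonglongrightarrow> (\<Sum>j<k. w j x * h (v j x))"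
      by (intro tendsto_sum tendsto_mult_left lim) (use v_in x in auto)
    then show "(\<lambda>n. a (Suc n) x) \<longlonglongrightarrow> W h x" by (simp add: a_def W_def)
  qed
  moreover have "(\<lambda>n. \<integral>x. a n x \<partial>m) \<longlonglongrightarrow> (\<integral>x. h x \<partial>m)"
  proof (rule integral_dominated_convergence[where w="\<lambda>_. exp cone_const"])
    show "h \<in> borel_measurable m" "a n \<in> borel_measurable m" for n
      using h_cone a_cone cone_const_pos
      by (auto intro!: borel_measurable_integrable continuous_integrable log_lip_continuous[of cone_const])
    show "AE x in m. (\<lambda>n. a n x) \<longlonglongrightarrow> h x" using lim by (intro AE_I2) (simp add: space_m)
    show "AE x in m. norm (a n x) \<le> exp cone_const" for n
      using bounds log_lip_pos[OF a_cone] by (intro AE_I2) (simp add: space_m abs_of_pos)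
  qed simp
  then have "(\<integral>x. h x \<partial>m) = 1" by (simp add: a_int LIMSEQ_const_iff)
  ultimately show thesis using h_cone by (intro that)
qed

text \<open>Conjugating by the invariant density turns the weights into probabilities.\<close>

lemma normalized_transfer_kernel:
  fixes T :: "real \<Rightarrow> real"
  assumes T: "T \<in> measurable m m" and T_v: "AE x in m. \<forall>j<k. T (v j x) = x"
    and transfer: "\<And>F. integrable m F \<Longrightarrow> integrable m (W F) \<and> (\<integral>x. W F x \<partial>m) = (\<integral>x. F x \<partial>m)"
    and h: "log_lip A h" "0 \<le> A" "\<And>x. x \<in> {0..1} \<Longrightarrow> W h x = h x" "(\<integral>x. h x \<partial>m) = 1"
  shows "transfer_kernel (density m h) k (\<lambda>j x. w j x * h (v j x) * (1 / h x)) v \<beta> (D + A * \<beta> + A) T"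
proof -
  have hi: "integrable m h" by (intro continuous_integrable log_lip_continuous[OF h(1,2)])
  have hm[measurable]: "h \<in> borel_measurable m" using hi by simp
  have h0: "AE x in m. 0 \<le> h x" using log_lip_pos[OF h(1)] by (intro AE_I2) (auto simp: space_m less_imp_le)
  have em: "emeasure (density m h) (space (density m h)) = 1"
    using nn_integral_eq_integral[OF hi h0] h(4) by (simp add: emeasure_density cong: nn_integral_cong)
  define w' where "w' j x = w j x * h (v j x) * (1 / h x)" for j x
  \<comment> \<open>The normalized operator is \<open>W\<close> conjugated by multiplication with
    \<open>h\<close>; every property is transported through this identity.\<close>
  have W': "h x * (\<Sum>j<k. w' j x * F (v j x)) = W (\<lambda>x. h x * F x) x" if "x \<in> {0..1}" for F x
    using log_lip_pos[OF h(1) that] by (simp add: W_def w'_def sum_distrib_left mult_ac)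
  have tr: "integrable (density m h) (\<lambda>x. \<Sum>j<k. w' j x * F (v j x)) \<and>
    (\<integral>x. (\<Sum>j<k. w' j x * F (v j x)) \<partial>density m h) = (\<integral>x. F x \<partial>density m h)"
    if F: "integrable (density m h) F" for F
  proof -
    have Fm[measurable]: "F \<in> borel_measurable m" using F by (auto dest: borel_measurable_integrable)
    have hF: "integrable m (\<lambda>x. h x * F x)"
      using F h0 by (subst (asm) integrable_real_density) auto
    have WF: "integrable m (W (\<lambda>x. h x * F x))" "(\<integral>x. W (\<lambda>x. h x * F x) x \<partial>m) = (\<integral>x. h x * F x \<partial>m)"
      using transfer[OF hF] by auto
    have eq: "(\<Sum>j<k. w' j x * F (v j x)) = W (\<lambda>x. h x * F x) x / h x" if "x \<in> {0..1}" for x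
      using W'[OF that, of F] log_lip_pos[OF h(1) that] by (simp add: field_simps)
    have "(\<lambda>x. W (\<lambda>x. h x * F x) x / h x) \<in> borel_measurable m" using WF by measurable
    also have "?this \<longleftrightarrow> (\<lambda>x. \<Sum>j<k. w' j x * F (v j x)) \<in> borel_measurable m"
      by (intro measurable_cong) (simp add: eq space_m)
    finally have Wm[measurable]: "(\<lambda>x. \<Sum>j<k. w' j x * F (v j x)) \<in> borel_measurable m" .
    have "integrable (density m h) (\<lambda>x. \<Sum>j<k. w' j x * F (v j x)) \<longleftrightarrow> integrable m (\<lambda>x. h x * (\<Sum>j<k. w' j x * F (v j x)))"
      using h0 by (subst integrable_real_density) auto
    also have "\<dots> \<longleftrightarrow> integrable m (W (\<lambda>x. h x * F x))"
      by (intro Bochner_Integration.integrable_cong) (auto simp: W' space_m)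
    finally have 1: "integrable (density m h) (\<lambda>x. \<Sum>j<k. w' j x * F (v j x))" using WF by simp
    have "(\<integral>x. (\<Sum>j<k. w' j x * F (v j x)) \<partial>density m h) = (\<integral>x. h x * (\<Sum>j<k. w' j x * F (v j x)) \<partial>m)"
      using h0 by (subst integral_real_density) auto
    also have "\<dots> = (\<integral>x. W (\<lambda>x. h x * F x) x \<partial>m)"
      by (intro Bochner_Integration.integral_cong) (auto simp: W' space_m)
    also have "\<dots> = (\<integral>x. F x \<partial>density m h)"
      unfolding WF(2) using h0 by (subst integral_real_density) auto
    finally show ?thesis using 1 by simp
  qed
  interpret density: prob_space "density m h" by (rule prob_spaceI) (rule em)
  interpret P: log_lipschitz_kernel "density m h" k w' v \<beta> "D + A * \<beta> + A"
  proof
    show "sets (density m h) = sets (restrict_space borel {0..1})" by (simp add: sets_m)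
    show "0 \<le> D + A * \<beta> + A" using D_nonneg h(2) beta by simp
    show "log_lip (D + A * \<beta> + A) (w' j)" if "j < k" for j
      unfolding w'_def
      by (intro log_lip_mult w_log_lip log_lip_inverse log_lip_compose h v_in v_lip that)
    fix \<phi> :: "real \<Rightarrow> real" assume "continuous_on {0..1} \<phi>"
    then have c: "continuous_on {0..1} (\<lambda>x. h x * \<phi> x)"
      by (intro continuous_intros log_lip_continuous[OF h(1,2)])
    have "\<phi> \<in> borel_measurable m" using \<open>continuous_on {0..1} \<phi>\<close> by (intro borel_measurable_integrable continuous_integrable)
    then have "integrable (density m h) \<phi>"
      using continuous_integrable[OF c] h0 by (subst integrable_real_density) auto
    from tr[OF this] show "(\<integral>x. (\<Sum>j<k. w' j x * \<phi> (v j x)) \<partial>density m h) = (\<integral>x. \<phi> x \<partial>density m h)" by simp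
  qed (fact k_pos beta v_in v_lip)+
  have "transfer_kernel (density m h) k w' v \<beta> (D + A * \<beta> + A) T"
  proof
    show "T \<in> measurable (density m h) (density m h)" using T by simp
    show "(\<Sum>j<k. w' j x) = 1" if "x \<in> {0..1}" for x
    proof -
      have "(\<Sum>j<k. w' j x) = W h x * (1 / h x)" unfolding W_def w'_def sum_distrib_right ..
      then show ?thesis using h(3)[OF that] log_lip_pos[OF h(1) that] by simp
    qed
    show "AE x in density m h. \<forall>j<k. T (v j x) = x"
      using T_v by (subst AE_density) auto
    show "integrable (density m h) (P.W F) \<and> (\<integral>x. P.W F x \<partial>density m h) = (\<integral>x. F x \<partial>density m h)"
      if "integrable (density m h) F" for F
      unfolding P.W_def[abs_def] by (rule tr[OF that])
  qed
  then show ?thesis by (simp add: w'_def[abs_def])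
qed

end

section \<open>Uniqueness of the absolutely continuous invariant probability\<close>

context exact_system
begin

text \<open>Exactness is applied to the density \<open>D\<close> of \<open>N\<close>: its integral
  over the preimage of \<open>A\<close> under \<open>T ^^ j\<close> equals
  \<open>measure N A\<close> for every \<open>j\<close> by invariance, yet comes arbitrarily close
  to \<open>measure M A\<close>.\<close>

lemma invariant_absolutely_continuous_unique:
  assumes N: "prob_space N" "sets N = sets M" "absolutely_continuous M N" "distr N N T = N"
  shows "N = M"
proof -
  interpret N: prob_space N by fact
  obtain D where D[measurable]: "D \<in> borel_measurable M" and RN: "AE x in M. RN_deriv M N x = ennreal (D x)"
    and D0: "\<And>x. 0 \<le> D x"
    using real_RN_deriv[OF _ N(3,2)] N.finite_measure_axioms by metis
  have [measurable]: "T \<in> measurable N N" using T_measurable N(2) by (simp cong: measurable_cong_sets)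
  have dens: "N = density M D"
    using density_RN_deriv[OF N(3,2)] density_cong[OF _ _ RN] by simp
  have "(\<integral>\<^sup>+x. ennreal (D x) \<partial>M) = emeasure N (space N)"
    unfolding dens by (simp add: emeasure_density cong: nn_integral_cong)
  then have Di: "integrable M D" "(\<integral>x. D x \<partial>M) = 1"
    using D0 N.emeasure_space_1 nn_integral_eq_integral[of M D]
    by (auto simp: integrable_iff_bounded integral_eq_nn_integral)
  have N_eq: "measure N A = (\<integral>x. D x * indicator A x \<partial>M)" if "A \<in> sets M" for A
  proof -
    have "measure N A = (\<integral>x. indicator A x \<partial>N)" using that N(2) sets.sets_into_space[OF that] by simp
    also have "\<dots> = (\<integral>x. D x * indicator A x \<partial>M)"
      unfolding dens using that D0 by (subst integral_real_density) auto
    finally show ?thesis .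
  qed
  have inv: "measure N ((T ^^ n) -` A \<inter> space N) = measure N A" if "A \<in> sets M" for A n
  proof (induction n)
    case 0
    then show ?case using that N(2) sets.sets_into_space[of A N] by (simp add: Int_absorb2)
  next
    case (Suc n)
    have [measurable]: "(T ^^ n) \<in> measurable N N" by (induction n) auto
    have A[measurable]: "A \<in> sets N" using that N(2) by simp
    have "(T ^^ Suc n) -` A \<inter> space N = T -` ((T ^^ n) -` A \<inter> space N) \<inter> space N"
      using measurable_space[of T N N] by (auto simp: funpow_swap1)
    also have "measure N \<dots> = measure (distr N N T) ((T ^^ n) -` A \<inter> space N)"
      by (subst measure_distr) auto
    finally show ?case unfolding N(4) Suc.IH .
  qed
  have sp: "space N = space M" by (rule sets_eq_imp_space_eq[OF N(2)])
  have close: "\<bar>measure N A - measure M A\<bar> \<le> \<epsilon>" if A[measurable]: "A \<in> sets M" and "\<epsilon> > 0" for A \<epsilon>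
  proof -
    obtain j where j: "\<And>i G. j \<le> i \<Longrightarrow> G \<in> borel_measurable M \<Longrightarrow> (\<And>x. x \<in> space M \<Longrightarrow> \<bar>G x\<bar> \<le> 1) \<Longrightarrow>
       \<bar>(\<integral>x. D x * G ((T ^^ i) x) \<partial>M) - (\<integral>x. D x \<partial>M) * (\<integral>x. G x \<partial>M)\<bar> \<le> \<epsilon>"
      using tail_mixingE[OF exact[OF Di(1)] \<open>\<epsilon> > 0\<close>] by blast
    have "(\<integral>x. D x * indicator A ((T ^^ j) x) \<partial>M) = (\<integral>x. D x * indicator ((T ^^ j) -` A \<inter> space M) x \<partial>M)"
      by (intro Bochner_Integration.integral_cong) (auto simp: indicator_def)
    also have "\<dots> = measure N ((T ^^ j) -` A \<inter> space M)" by (rule N_eq[symmetric]) measurable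
    also have "\<dots> = measure N A" using inv[OF A, of j] by (simp add: sp)
    finally have "(\<integral>x. D x * indicator A ((T ^^ j) x) \<partial>M) = measure N A" .
    moreover have "(\<integral>x. indicator A x \<partial>M) = measure M A"
      using sets.sets_into_space[OF A] by (simp add: Int_absorb2)
    ultimately show ?thesis
      using j[of j "indicator A"] Di(2) by (simp add: indicator_def)
  qed
  have "measure N A = measure M A" if "A \<in> sets M" for A
  proof (rule ccontr)
    assume "measure N A \<noteq> measure M A"
    then have "0 < \<bar>measure N A - measure M A\<bar> / 2" by simp
    from close[OF that this] this show False by simp
  qed
  then show ?thesis
    by (intro measure_eqI) (simp_all add: N(2) emeasure_eq_measure N.emeasure_eq_measure)
qed

end

section \<open>Full-branch expanding maps\<close>

lemma mvt_within_interval: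
  fixes f f' :: "real \<Rightarrow> real"
  assumes d: "\<And>x. x \<in> {p..q} \<Longrightarrow> (f has_real_derivative f' x) (at x within {p..q})"
    and xy: "x \<in> {p..q}" "y \<in> {p..q}"
  obtains z where "z \<in> {p..q}" "f y - f x = f' z * (y - x)"
proof -
  have *: "\<exists>z\<in>{p..q}. f y - f x = f' z * (y - x)" if "x < y" "x \<in> {p..q}" "y \<in> {p..q}" for x y
  proof -
    have "(f has_derivative (\<lambda>h. f' z * h)) (at z within {x..y})" if "x \<le> z" "z \<le> y" for z
      using that \<open>x \<in> {p..q}\<close> \<open>y \<in> {p..q}\<close>
      by (intro has_derivative_subset[OF d[unfolded has_field_derivative_def]]) auto
    from mvt_simple[OF \<open>x < y\<close> this] obtain z where "z \<in> {x<..<y}" "f y - f x = f' z * (y - x)" by auto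
    then show ?thesis using that by (intro bexI[of _ z]) auto
  qed
  consider "x < y" | "y < x" | "x = y" by linarith
  then show thesis
  proof cases
    case 1 then show thesis using *[OF 1 xy] that by blast
  next
    case 2
    from *[OF 2 xy(2,1)] obtain z where "z \<in> {p..q}" "f x - f y = f' z * (x - y)" by blast
    then show thesis using that[of z] by (simp add: algebra_simps)
  next
    case 3 then show thesis using that[of x] xy by simp
  qed
qed

text \<open>By compactness \<open>\<bar>g'\<bar>\<close> has a minimum \<open>\<eta> > 1\<close> and
  \<open>\<bar>g''\<bar>\<close> a bound \<open>D\<close>; then \<open>\<beta>\<close> is
  \<open>1 / \<eta>\<close>. The logarithm of \<open>\<bar>F'\<bar>\<close> has derivative
  \<open>- g''(F) * F' / g'(F)\<close>, which is at most \<open>D\<close> in absolute value because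
  \<open>\<bar>F'\<bar> < 1 < \<bar>g'\<bar>\<close>. This is the bounded distortion
  estimate.\<close>

lemma expanding_branch_inverse:
  fixes g :: "real \<Rightarrow> real"
  assumes pq: "p < q" and C2: "C2_on {p..q} g" and exp: "\<And>x. x \<in> {p..q} \<Longrightarrow> 1 < \<bar>deriv_on {p..q} g x\<bar>"
    and onto: "g ` {p..q} = {0..1}"
  defines "F \<equiv> inv_into {p..q} g"
  obtains F' \<beta> D where "0 < \<beta>" "\<beta> < 1" "0 \<le> D"
    "\<And>y. y \<in> {0..1} \<Longrightarrow> F y \<in> {p..q}" "\<And>y. y \<in> {0..1} \<Longrightarrow> g (F y) = y" "F ` {0..1} = {p..q}"
    "\<And>x y. x \<in> {0..1} \<Longrightarrow> y \<in> {0..1} \<Longrightarrow> \<bar>F x - F y\<bar> \<le> \<beta> * \<bar>x - y\<bar>"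
    "\<And>y. y \<in> {0..1} \<Longrightarrow> (F has_real_derivative F' y) (at y within {0..1})"
    "\<And>y. y \<in> {0..1} \<Longrightarrow> \<bar>F' y\<bar> \<le> 1"
    "log_lip D (\<lambda>y. \<bar>F' y\<bar>)"
    "\<exists>B. \<forall>x\<in>{p..q}. \<bar>deriv_on {p..q} g x\<bar> \<le> B"
proof -
  obtain f' f'' where d: "\<And>x. x \<in> {p..q} \<Longrightarrow> (g has_real_derivative f' x) (at x within {p..q})"
    and d2: "\<And>x. x \<in> {p..q} \<Longrightarrow> (f' has_real_derivative f'' x) (at x within {p..q})"
    and c2: "continuous_on {p..q} f''"
    using C2 unfolding C2_on_def by blast
  have deriv: "deriv_on {p..q} g x = f' x" if "x \<in> {p..q}" for x
    unfolding deriv_on_def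
    by (rule vector_derivative_within_closed_interval[OF pq that])
       (use d[OF that] in \<open>simp add: has_real_derivative_iff_has_vector_derivative\<close>)
  have f'1: "1 < \<bar>f' x\<bar>" if "x \<in> {p..q}" for x using exp[OF that] deriv[OF that] by simp
  have cf': "continuous_on {p..q} f'"
    using d2 by (intro DERIV_continuous_on)
  then have cabs: "continuous_on {p..q} (\<lambda>x. \<bar>f' x\<bar>)" by (intro continuous_intros)
  obtain x0 where x0: "x0 \<in> {p..q}" "\<And>x. x \<in> {p..q} \<Longrightarrow> \<bar>f' x0\<bar> \<le> \<bar>f' x\<bar>"
    using continuous_attains_inf[OF _ _ cabs] pq by (metis atLeastAtMost_iff compact_Icc empty_iff less_eq_real_def)
  define \<eta> where "\<eta> = \<bar>f' x0\<bar>"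
  have \<eta>: "1 < \<eta>" using f'1[OF x0(1)] by (simp add: \<eta>_def)
  have bdd: "\<exists>B. \<forall>x\<in>{p..q}. \<bar>\<phi> x\<bar> \<le> B" if "continuous_on {p..q} \<phi>" for \<phi> :: "real \<Rightarrow> real"
    using compact_imp_bounded[OF compact_continuous_image[OF that compact_Icc]] by (simp add: bounded_iff)
  obtain D where D: "\<And>x. x \<in> {p..q} \<Longrightarrow> \<bar>f'' x\<bar> \<le> D" using bdd[OF c2] by blast
  have D0: "0 \<le> D" using D[OF x0(1)] by linarith
  have expand: "\<eta> * \<bar>x - y\<bar> \<le> \<bar>g x - g y\<bar>" if xy: "x \<in> {p..q}" "y \<in> {p..q}" for x y
  proof -
    obtain z where z: "z \<in> {p..q}" "g x - g y = f' z * (x - y)"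
      using mvt_within_interval[OF d xy(2,1)] by blast
    then show ?thesis using x0(2)[OF z(1)] by (auto simp: abs_mult \<eta>_def intro!: mult_right_mono)
  qed
  have inj: "inj_on g {p..q}"
  proof (rule inj_onI)
    fix x y assume xy: "x \<in> {p..q}" "y \<in> {p..q}" "g x = g y"
    have "\<eta> * \<bar>x - y\<bar> \<le> 0" using expand[OF xy(1,2)] xy(3) by simp
    then show "x = y" using \<eta> by (simp add: mult_le_0_iff)
  qed
  have F_in: "F y \<in> {p..q}" and gF: "g (F y) = y" if "y \<in> {0..1}" for y
  proof -
    have "y \<in> g ` {p..q}" using that onto by simp
    then show "F y \<in> {p..q}" "g (F y) = y" unfolding F_def by (rule inv_into_into, rule f_inv_into_f)
  qed
  have Fg: "F (g x) = x" if "x \<in> {p..q}" for x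
    unfolding F_def using inj that by (rule inv_into_f_f)
  have F_lip: "\<bar>F x - F y\<bar> \<le> 1 / \<eta> * \<bar>x - y\<bar>" if "x \<in> {0..1}" "y \<in> {0..1}" for x y
    using expand[OF F_in F_in, OF that] gF[OF that(1)] gF[OF that(2)] \<eta> by (simp add: field_simps)
  have "continuous_on {0..1} F"
    by (rule lipschitz_on_continuous_on[of "1 / \<eta>"])
       (use F_lip \<eta> in \<open>auto intro!: lipschitz_onI simp: dist_real_def\<close>)
  then have F_cont: "continuous (at y within {0..1}) F" if "y \<in> {0..1}" for y
    using that by (simp add: continuous_on_eq_continuous_within)
  have F_der: "(F has_real_derivative 1 / f' (F y)) (at y within {0..1})" if y: "y \<in> {0..1}" for y
  proof -
    have "(F has_derivative (\<lambda>h. h / f' (F y))) (at (g (F y)) within g ` {p..q})"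
    proof (rule has_derivative_inverse_within)
      show "(g has_derivative (\<lambda>h. f' (F y) * h)) (at (F y) within {p..q})"
        using d[OF F_in[OF y]] by (simp add: has_field_derivative_def)
      show "continuous (at (g (F y)) within g ` {p..q}) F" using F_cont[OF y] by (simp add: onto gF[OF y])
      show "(\<lambda>h. h / f' (F y)) \<circ> (\<lambda>h. f' (F y) * h) = id"
        using f'1[OF F_in[OF y]] by (auto simp: fun_eq_iff)
      show "linear (\<lambda>h. h / f' (F y))" by (simp add: linear_iff add_divide_distrib)
    qed (use F_in[OF y] Fg in auto)
    moreover have "(*) (1 / f' (F y)) = (\<lambda>h. h / f' (F y))" by (simp add: fun_eq_iff)
    ultimately show ?thesis by (simp add: onto gF[OF y] has_field_derivative_def)
  qed
  have ll: "log_lip D (\<lambda>y. \<bar>1 / f' (F y)\<bar>)" unfolding log_lip_def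
  proof (intro conjI ballI)
    fix x :: real assume "x \<in> {0..1}"
    then show "0 < \<bar>1 / f' (F x)\<bar>" using f'1[OF F_in] by force
  next
    fix x y :: real assume xy: "x \<in> {0..1}" "y \<in> {0..1}"
    define a b where "a = \<bar>f' (F x)\<bar>" and "b = \<bar>f' (F y)\<bar>"
    have ab: "1 < a" "1 < b" using f'1 F_in xy by (auto simp: a_def b_def)
    obtain z where z: "z \<in> {p..q}" "f' (F y) - f' (F x) = f'' z * (F y - F x)"
      using mvt_within_interval[OF d2 F_in[OF xy(1)] F_in[OF xy(2)]] by blast
    have "b - a \<le> \<bar>f'' z\<bar> * \<bar>F y - F x\<bar>" unfolding a_def b_def abs_mult[symmetric] z(2)[symmetric] by simp
    also have "\<dots> \<le> D * \<bar>x - y\<bar>"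
    proof (intro mult_mono D z D0)
      have "\<bar>F y - F x\<bar> \<le> 1 / \<eta> * \<bar>x - y\<bar>" using F_lip[OF xy(2,1)] by (simp add: abs_minus_commute)
      also have "\<dots> \<le> 1 * \<bar>x - y\<bar>" using \<eta> by (intro mult_right_mono) auto
      finally show "\<bar>F y - F x\<bar> \<le> \<bar>x - y\<bar>" by simp
    qed auto
    also have "\<dots> \<le> a * (D * \<bar>x - y\<bar>)" using ab D0 mult_right_mono[of 1 a "D * \<bar>x - y\<bar>"] by simp
    finally have "b \<le> a * (1 + D * \<bar>x - y\<bar>)" by (simp add: algebra_simps)
    also have "\<dots> \<le> a * exp (D * \<bar>x - y\<bar>)" using ab by (intro mult_left_mono exp_ge_add_one_self) auto
    finally have "b \<le> a * exp (D * \<bar>x - y\<bar>)" .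
    then have "1 / a \<le> 1 / b * exp (D * \<bar>x - y\<bar>)" using ab by (simp add: field_simps)
    then show "\<bar>1 / f' (F x)\<bar> \<le> \<bar>1 / f' (F y)\<bar> * exp (D * \<bar>x - y\<bar>)" by (simp add: a_def b_def)
  qed
  show thesis
  proof (rule that[of "1 / \<eta>" D "\<lambda>y. 1 / f' (F y)"])
    show "F ` {0..1} = {p..q}"
    proof (intro equalityI subsetI)
      fix x assume x: "x \<in> {p..q}"
      then have "g x \<in> {0..1}" using onto by blast
      then show "x \<in> F ` {0..1}" using Fg[OF x] by (intro image_eqI[of _ _ "g x"]) simp_all
    qed (use F_in in blast)
    show "0 < 1 / \<eta>" "1 / \<eta> < 1" using \<eta> by simp_all
    show "\<bar>1 / f' (F y)\<bar> \<le> 1" if "y \<in> {0..1}" for y using f'1[OF F_in[OF that]] by simp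
    show "\<exists>B. \<forall>x\<in>{p..q}. \<bar>deriv_on {p..q} g x\<bar> \<le> B" using bdd[OF cf'] deriv by simp
  qed (fact D0 F_in gF F_lip F_der ll)+
qed

lemma breakpoints_mono:
  fixes c :: "nat \<Rightarrow> real"
  assumes c: "\<And>j. j < k \<Longrightarrow> c j < c (Suc j)" and ij: "i \<le> j" "j \<le> k"
  shows "c i \<le> c j"
  using ij
proof (induction j rule: dec_induct)
  case (step n)
  then show ?case using c[of n] by simp
qed simp

lemma integral_cells:
  fixes c :: "nat \<Rightarrow> real" and \<phi> :: "real \<Rightarrow> real"
  assumes c: "\<And>j. j < k \<Longrightarrow> c j < c (Suc j)" and \<phi>: "\<phi> integrable_on {c 0..c k}"
  shows "integral {c 0..c k} \<phi> = (\<Sum>j<k. integral (cell c j) \<phi>)"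
proof -
  have mono: "c i \<le> c j" if "i \<le> j" "j \<le> k" for i j
    using breakpoints_mono[where c=c and k=k, OF c that] .
  have "m \<le> k \<Longrightarrow> integral {c 0..c m} \<phi> = (\<Sum>j<m. integral (cell c j) \<phi>)" for m
  proof (induction m)
    case (Suc m)
    have "integral {c 0..c m} \<phi> + integral {c m..c (Suc m)} \<phi> = integral {c 0..c (Suc m)} \<phi>"
      using Suc.prems mono by (intro Henstock_Kurzweil_Integration.integral_combine integrable_subinterval_real[OF \<phi>]) auto
    then show ?case using Suc by (simp add: cell_def)
  qed simp
  then show ?thesis by simp
qed

abbreviation unit_lebesgue :: "real measure" where
  "unit_lebesgue \<equiv> restrict_space lborel {0..1}"

text \<open>Absolute integrability refers to the completed measure, so Borel measurability has to be
  recorded separately. The equivalence gives access to the change of variables theorem of the gauge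
  integral.\<close>

lemma integrable_unit_lebesgue:
  fixes \<phi> :: "real \<Rightarrow> real"
  shows "integrable unit_lebesgue \<phi> \<longleftrightarrow> \<phi> \<in> borel_measurable (restrict_space borel {0..1}) \<and> \<phi> absolutely_integrable_on {0..1}"
    (is "_ \<longleftrightarrow> ?m \<and> _")
    and integral_unit_lebesgue: "integrable unit_lebesgue \<phi> \<Longrightarrow> (\<integral>x. \<phi> x \<partial>unit_lebesgue) = integral {0..1} \<phi>"
proof -
  have sets: "sets unit_lebesgue = sets (restrict_space borel {0..1})" by (simp add: sets_restrict_space)
  have 1: "integrable unit_lebesgue \<phi> \<longleftrightarrow> set_integrable lborel {0..1} \<phi>"
    by (simp add: integrable_restrict_space set_integrable_def)
  have m: "?m \<longleftrightarrow> (\<lambda>x. indicator {0..1} x *\<^sub>R \<phi> x) \<in> borel_measurable borel"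
    by (subst borel_measurable_restrict_space_iff) (auto simp: mult.commute)
  have "set_integrable lborel {0..1} \<phi> \<longleftrightarrow> ?m \<and> set_integrable lborel {0..1} \<phi>"
    unfolding m set_integrable_def by auto
  also have "\<dots> \<longleftrightarrow> ?m \<and> \<phi> absolutely_integrable_on {0..1}"
    unfolding m set_integrable_def by (auto simp: integrable_completion)
  finally show "integrable unit_lebesgue \<phi> \<longleftrightarrow> ?m \<and> \<phi> absolutely_integrable_on {0..1}" by (simp add: 1)
  show "integrable unit_lebesgue \<phi> \<Longrightarrow> (\<integral>x. \<phi> x \<partial>unit_lebesgue) = integral {0..1} \<phi>"
    using set_borel_integral_eq_integral(2)[of "{0..1}" \<phi>] 1
    by (simp add: integral_restrict_space set_lebesgue_integral_def)
qed

section \<open>Lebesgue measure as a log-Lipschitz kernel\<close>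

locale expanding_branches =
  fixes k :: nat and c :: "nat \<Rightarrow> real" and v v' :: "nat \<Rightarrow> real \<Rightarrow> real" and \<beta> D :: real
  assumes k_pos: "0 < k" and c: "c 0 = 0" "c k = 1" "\<And>j. j < k \<Longrightarrow> c j < c (Suc j)"
    and bounds: "0 < \<beta>" "\<beta> < 1" "0 \<le> D"
    and v_image: "\<And>j. j < k \<Longrightarrow> v j ` {0..1} = cell c j"
    and v_contract: "\<And>j x y. j < k \<Longrightarrow> x \<in> {0..1} \<Longrightarrow> y \<in> {0..1} \<Longrightarrow> \<bar>v j x - v j y\<bar> \<le> \<beta> * \<bar>x - y\<bar>"
    and v_inj: "\<And>j. j < k \<Longrightarrow> inj_on (v j) {0..1}"
    and v_deriv: "\<And>j y. j < k \<Longrightarrow> y \<in> {0..1} \<Longrightarrow> (v j has_real_derivative v' j y) (at y within {0..1})"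
    and v'_log_lip: "\<And>j. j < k \<Longrightarrow> log_lip D (\<lambda>y. \<bar>v' j y\<bar>)"
begin

lemma cell_subset: "j < k \<Longrightarrow> cell c j \<subseteq> {0..1}"
proof -
  assume "j < k"
  have mono: "c i \<le> c j" if "i \<le> j" "j \<le> k" for i j
    using breakpoints_mono[where c=c and k=k, OF c(3) that] .
  show ?thesis using mono[of 0 j] mono[of "Suc j" k] \<open>j < k\<close> c by (auto simp: cell_def)
qed

lemma v_unit: "j < k \<Longrightarrow> x \<in> {0..1} \<Longrightarrow> v j x \<in> {0..1}"
  using v_image cell_subset by blast

text \<open>Change of variables along each branch gives the integral of \<open>\<phi>\<close> over
  one cell, and the cells tile the unit interval.\<close>

lemma lebesgue_transfer:
  assumes \<phi>: "integrable unit_lebesgue \<phi>"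
  shows "integrable unit_lebesgue (\<lambda>x. \<Sum>j<k. \<bar>v' j x\<bar> * \<phi> (v j x))"
    and "(\<integral>x. (\<Sum>j<k. \<bar>v' j x\<bar> * \<phi> (v j x)) \<partial>unit_lebesgue) = (\<integral>x. \<phi> x \<partial>unit_lebesgue)"
proof -
  let ?R = "restrict_space borel {0..1::real}"
  have \<phi>m: "\<phi> \<in> borel_measurable ?R" and \<phi>a: "\<phi> absolutely_integrable_on {0..1}"
    using \<phi> integrable_unit_lebesgue by auto
  have branch: "integrable unit_lebesgue (\<lambda>x. \<bar>v' j x\<bar> * \<phi> (v j x)) \<and>
      (\<integral>x. \<bar>v' j x\<bar> * \<phi> (v j x) \<partial>unit_lebesgue) = integral (cell c j) \<phi>" if j: "j < k" for j
  proof -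
    have "\<phi> absolutely_integrable_on cell c j"
      by (rule set_integrable_subset[OF \<phi>a]) (use cell_subset[OF j] in \<open>auto simp: cell_def\<close>)
    then have *: "(\<lambda>x. \<bar>v' j x\<bar> * \<phi> (v j x)) absolutely_integrable_on {0..1}"
        "integral {0..1} (\<lambda>x. \<bar>v' j x\<bar> * \<phi> (v j x)) = integral (cell c j) \<phi>"
      using has_absolute_integral_change_of_variables_1'[of "{0..1}" "v j" "v' j" \<phi> "integral (cell c j) \<phi>"]
        v_deriv[OF j] v_inj[OF j] v_image[OF j] by auto
    have "continuous_on {0..1} (v j)" by (rule DERIV_continuous_on[OF v_deriv[OF j]])
    then have "v j \<in> measurable ?R ?R"
      using v_unit[OF j]
      by (intro measurable_restrict_space2 borel_measurable_continuous_on_restrict)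
         (auto simp: space_restrict_space)
    then have [measurable]: "(\<lambda>x. \<phi> (v j x)) \<in> borel_measurable ?R" using \<phi>m by simp
    have [measurable]: "(\<lambda>x. \<bar>v' j x\<bar>) \<in> borel_measurable ?R"
      by (intro borel_measurable_continuous_on_restrict log_lip_continuous[OF v'_log_lip[OF j]] bounds)
    have i: "integrable unit_lebesgue (\<lambda>x. \<bar>v' j x\<bar> * \<phi> (v j x))"
      unfolding integrable_unit_lebesgue using * by simp
    then show ?thesis using integral_unit_lebesgue[OF i] * by simp
  qed
  then show "integrable unit_lebesgue (\<lambda>x. \<Sum>j<k. \<bar>v' j x\<bar> * \<phi> (v j x))"
    by (intro Bochner_Integration.integrable_sum) auto
  have "(\<integral>x. (\<Sum>j<k. \<bar>v' j x\<bar> * \<phi> (v j x)) \<partial>unit_lebesgue) = (\<Sum>j<k. integral (cell c j) \<phi>)"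
    using branch by (simp add: Bochner_Integration.integral_sum)
  also have "\<dots> = integral {c 0..c k} \<phi>"
    by (rule integral_cells[where c=c and k=k and \<phi>=\<phi>, symmetric, OF c(3)])
       (use \<phi>a c in \<open>auto intro: set_lebesgue_integral_eq_integral\<close>)
  also have "\<dots> = (\<integral>x. \<phi> x \<partial>unit_lebesgue)" using integral_unit_lebesgue[OF \<phi>] c by simp
  finally show "(\<integral>x. (\<Sum>j<k. \<bar>v' j x\<bar> * \<phi> (v j x)) \<partial>unit_lebesgue) = (\<integral>x. \<phi> x \<partial>unit_lebesgue)" .
qed

sublocale lebesgue: log_lipschitz_kernel unit_lebesgue k "\<lambda>j x. \<bar>v' j x\<bar>" v \<beta> D
proof -
  interpret prob_space unit_lebesgue
    by (rule prob_spaceI) (simp add: space_restrict_space emeasure_restrict_space)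
  have sets: "sets unit_lebesgue = sets (restrict_space borel {0..1})" by (simp add: sets_restrict_space)
  show "log_lipschitz_kernel unit_lebesgue k (\<lambda>j x. \<bar>v' j x\<bar>) v \<beta> D"
  proof
    fix \<phi> :: "real \<Rightarrow> real" assume c: "continuous_on {0..1} \<phi>"
    have "integrable unit_lebesgue \<phi>"
      unfolding integrable_unit_lebesgue
      by (intro conjI borel_measurable_continuous_on_restrict c absolutely_integrable_continuous_real)
    then show "(\<integral>x. (\<Sum>j<k. \<bar>v' j x\<bar> * \<phi> (v j x)) \<partial>unit_lebesgue) = (\<integral>x. \<phi> x \<partial>unit_lebesgue)"
      by (rule lebesgue_transfer)
  qed (fact sets k_pos bounds v_unit v_contract v'_log_lip)+
qed

end

section \<open>The given map: inverse branches, growth exponent, identification of the invariant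
  measure\<close>

lemma full_branch_inverse_branches:
  assumes "full_branch_expanding k c g \<theta> \<psi>"
  obtains v' \<beta> D where "expanding_branches k c (inv_branch c g) v' \<beta> D"
    "\<And>j y. j < k \<Longrightarrow> y \<in> {0..1} \<Longrightarrow> g j (inv_branch c g j y) = y"
    "\<And>j y. j < k \<Longrightarrow> y \<in> {0..1} \<Longrightarrow> \<bar>v' j y\<bar> \<le> 1"
    "\<And>j. j < k \<Longrightarrow> \<exists>B. \<forall>x\<in>cell c j. \<bar>deriv_on (cell c j) (g j) x\<bar> \<le> B"
proof -
  let ?v = "inv_branch c g"
  have c: "c 0 = 0" "c k = 1" "\<And>j. j < k \<Longrightarrow> c j < c (Suc j)"
    and g: "\<And>j. j < k \<Longrightarrow> C2_on (cell c j) (g j)" "\<And>j. j < k \<Longrightarrow> g j ` cell c j = {0..1}"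
      "\<And>j x. j < k \<Longrightarrow> x \<in> cell c j \<Longrightarrow> 1 < \<bar>deriv_on (cell c j) (g j) x\<bar>"
    using assms unfolding full_branch_expanding_def by auto
  \<comment> \<open>All data of a branch are packed into one predicate, so that a single choice over
    \<open>j\<close> provides derivative, contraction factor and distortion together; the latter two
    are then maximised over the finitely many branches.\<close>
  define P where "P j F' \<beta> D \<longleftrightarrow> 0 < \<beta> \<and> \<beta> < 1 \<and> 0 \<le> D \<and>
    (\<forall>y\<in>{0..1}. g j (?v j y) = y) \<and> ?v j ` {0..1} = cell c j \<and>
    (\<forall>x\<in>{0..1}. \<forall>y\<in>{0..1}. \<bar>?v j x - ?v j y\<bar> \<le> \<beta> * \<bar>x - y\<bar>) \<and>
    (\<forall>y\<in>{0..1}. (?v j has_real_derivative F' y) (at y within {0..1})) \<and>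
    (\<forall>y\<in>{0..1}. \<bar>F' y\<bar> \<le> 1) \<and> log_lip D (\<lambda>y. \<bar>F' y\<bar>) \<and>
    (\<exists>B. \<forall>x\<in>cell c j. \<bar>deriv_on (cell c j) (g j) x\<bar> \<le> B)"
    for j and F' :: "real \<Rightarrow> real" and \<beta> D :: real
  have "\<exists>F' \<beta> D. P j F' \<beta> D" if j: "j < k" for j
  proof (rule expanding_branch_inverse[OF c(3)[OF j] g(1)[OF j, unfolded cell_def]
        g(3)[OF j, unfolded cell_def] g(2)[OF j, unfolded cell_def]], assumption, goal_cases)
    case (1 F' \<beta> D)
    show ?case unfolding P_def inv_branch_def cell_def
      by (intro exI[of _ F'] exI[of _ \<beta>] exI[of _ D] conjI ballI 1)
  qed
  then have "\<forall>j. \<exists>t. j < k \<longrightarrow> P j (fst t) (fst (snd t)) (snd (snd t))" by (metis fst_conv snd_conv)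
  then obtain t where t: "\<And>j. j < k \<Longrightarrow> P j (fst (t j)) (fst (snd (t j))) (snd (snd (t j)))" by metis
  define v' where "v' j = fst (t j)" for j
  define b where "b j = fst (snd (t j))" for j
  define d where "d j = snd (snd (t j))" for j
  have P: "P j (v' j) (b j) (d j)" if "j < k" for j using t[OF that] by (simp add: v'_def b_def d_def)
  have k: "0 < k" using c(1,2) by (cases k) auto
  define \<beta> D where "\<beta> = Max (b ` {..<k})" and "D = Max (d ` {..<k})"
  have fin: "finite (b ` {..<k})" "b ` {..<k} \<noteq> {}" "finite (d ` {..<k})" "d ` {..<k} \<noteq> {}" using k by auto
  have b_le: "b j \<le> \<beta>" "d j \<le> D" if "j < k" for j using that by (auto simp: \<beta>_def D_def intro!: Max_ge)
  have \<beta>: "\<beta> < 1" unfolding \<beta>_def using P by (subst Max_less_iff[OF fin(1,2)]) (auto simp: P_def)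
  have "expanding_branches k c ?v v' \<beta> D"
  proof
    show "0 < \<beta>" "0 \<le> D" using P[OF k] b_le[OF k] by (auto simp: P_def)
    fix j assume j: "j < k"
    note Pj = P[OF j, unfolded P_def]
    show "?v j ` {0..1} = cell c j" using Pj by blast
    show "inj_on (?v j) {0..1}" using Pj by (intro inj_on_inverseI[where g="g j"]) blast
    show "log_lip D (\<lambda>y. \<bar>v' j y\<bar>)" using Pj b_le(2)[OF j] log_lip_mono by blast
    show "(?v j has_real_derivative v' j y) (at y within {0..1})" if "y \<in> {0..1}" for y using Pj that by blast
    fix x y :: real assume xy: "x \<in> {0..1}" "y \<in> {0..1}"
    have "\<bar>?v j x - ?v j y\<bar> \<le> b j * \<bar>x - y\<bar>" using Pj xy by blast
    also have "\<dots> \<le> \<beta> * \<bar>x - y\<bar>" by (intro mult_right_mono b_le j) auto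
    finally show "\<bar>?v j x - ?v j y\<bar> \<le> \<beta> * \<bar>x - y\<bar>" .
  qed (fact k \<beta> c)+
  then show thesis using P by (intro that[of v' \<beta> D]) (auto simp: P_def)
qed

text \<open>Both logarithms are nonnegative, so the last factor in the growth condition is in \<open>{0..1}\<close>.
  A negative ratio would flip the inequality when \<open>\<theta> < 0\<close>.\<close>

lemma growth_exponent_less_half:
  assumes fb: "full_branch_expanding k c g \<theta> \<psi>" and "0 < a"
    and a: "a < Min {\<theta>, 1 / b, 1 / 2} * min 1 (ln (eta_minus k c g) / ln (eta_plus k c g))"
  shows "a < 1 / 2"
proof -
  obtain v' \<beta> D where eb: "expanding_branches k c (inv_branch c g) v' \<beta> D"
    and le1: "\<And>j y. j < k \<Longrightarrow> y \<in> {0..1} \<Longrightarrow> \<bar>v' j y\<bar> \<le> 1"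
    and bdd: "\<And>j. j < k \<Longrightarrow> \<exists>B. \<forall>x\<in>cell c j. \<bar>deriv_on (cell c j) (g j) x\<bar> \<le> B"
    using full_branch_inverse_branches[OF fb] by metis
  interpret expanding_branches k c "inv_branch c g" v' \<beta> D by fact
  have g3: "1 < \<bar>deriv_on (cell c j) (g j) x\<bar>" if "j < k" "x \<in> cell c j" for j x
    using fb that unfolding full_branch_expanding_def by auto
  have "1 \<le> eta_plus k c g"
  proof -
    obtain B where B: "\<And>x. x \<in> cell c 0 \<Longrightarrow> \<bar>deriv_on (cell c 0) (g 0) x\<bar> \<le> B" using bdd[OF k_pos] by blast
    have "c 0 \<in> cell c 0" using c(3)[OF k_pos] by (simp add: cell_def)
    then have "1 \<le> \<bar>deriv_on (cell c 0) (g 0) (c 0)\<bar>" using g3[OF k_pos] by (simp add: less_imp_le)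
    also have "\<dots> \<le> (SUP x\<in>cell c 0. \<bar>deriv_on (cell c 0) (g 0) x\<bar>)"
      using \<open>c 0 \<in> cell c 0\<close> B by (intro cSUP_upper bdd_aboveI2)
    also have "\<dots> \<le> eta_plus k c g" unfolding eta_plus_def using k_pos by (intro Max_ge) auto
    finally show ?thesis .
  qed
  \<comment> \<open>The value 0 is the convention \<open>1 / 0 = 0\<close> for a vanishing maximum;
    \<open>ln\<close> is nonnegative there as well.\<close>
  moreover have "eta_minus k c g = 0 \<or> 1 \<le> eta_minus k c g"
  proof -
    have d: "deriv_on {0..1} (inv_branch c g j) x = v' j x" if "j < k" "x \<in> {0..1}" for j x
      unfolding deriv_on_def
      by (rule vector_derivative_within_closed_interval)
         (use v_deriv[OF that] that in \<open>auto simp: has_real_derivative_iff_has_vector_derivative\<close>)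
    define s where "s j = (SUP x\<in>{0..1}. \<bar>deriv_on {0..1} (inv_branch c g j) x\<bar>)" for j
    have "s j \<le> 1" if "j < k" for j
      unfolding s_def using le1[OF that] d[OF that] by (intro cSUP_least) auto
    then have m1: "(MAX j\<in>{..<k}. s j) \<le> 1" using k_pos by (subst Max_le_iff) auto
    have "0 \<le> \<bar>deriv_on {0..1} (inv_branch c g 0) 0\<bar>" by simp
    also have "\<dots> \<le> s 0" unfolding s_def
      using le1[OF k_pos] d[OF k_pos] by (intro cSUP_upper bdd_aboveI2[where M=1]) auto
    also have "\<dots> \<le> (MAX j\<in>{..<k}. s j)" using k_pos by (intro Max_ge) auto
    finally have "0 \<le> (MAX j\<in>{..<k}. s j)" .
    moreover have "eta_minus k c g = 1 / (MAX j\<in>{..<k}. s j)" unfolding eta_minus_def s_def ..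
    ultimately show ?thesis using m1 by (cases "(MAX j\<in>{..<k}. s j) = 0") (simp_all add: le_divide_eq)
  qed
  ultimately have "0 \<le> ln (eta_minus k c g) / ln (eta_plus k c g)"
    by (intro divide_nonneg_nonneg) auto
  then have r: "0 \<le> min 1 (ln (eta_minus k c g) / ln (eta_plus k c g))"
    "min 1 (ln (eta_minus k c g) / ln (eta_plus k c g)) \<le> 1" by auto
  have "Min {\<theta>, 1 / b, 1 / 2} * min 1 (ln (eta_minus k c g) / ln (eta_plus k c g)) \<le>
      1 / 2 * min 1 (ln (eta_minus k c g) / ln (eta_plus k c g))"
    by (intro mult_right_mono r) auto
  also have "\<dots> \<le> 1 / 2" using r by linarith
  finally show ?thesis using a by linarith
qed

text \<open>Positivity of \<open>h\<close> makes every null set of its density measure Lebesgue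
  null, so \<open>\<pi>\<close> is absolutely continuous with respect to that measure and uniqueness
  applies. The bound \<open>B\<close> is the cone bound for a function of mean 1.\<close>

lemma invariant_measure_transfer_kernel:
  assumes fb: "full_branch_expanding k c g \<theta> \<psi>" and inv: "abs_cont_invariant_prob \<psi> \<pi>"
  obtains w v \<beta> D and h :: "real \<Rightarrow> real" and B :: real where "transfer_kernel \<pi> k w v \<beta> D \<psi>" "\<pi> = density unit_lebesgue h"
    "h \<in> borel_measurable unit_lebesgue" "\<And>x. x \<in> {0..1} \<Longrightarrow> 0 \<le> h x \<and> h x \<le> B"
proof -
  obtain v' \<beta> D where eb: "expanding_branches k c (inv_branch c g) v' \<beta> D"
    and gv: "\<And>j y. j < k \<Longrightarrow> y \<in> {0..1} \<Longrightarrow> g j (inv_branch c g j y) = y"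
    using full_branch_inverse_branches[OF fb] by metis
  let ?v = "inv_branch c g"
  interpret expanding_branches k c ?v v' \<beta> D by fact
  have \<pi>: "prob_space \<pi>" "sets \<pi> = sets unit_lebesgue" "absolutely_continuous unit_lebesgue \<pi>"
    "\<psi> \<in> measurable \<pi> \<pi>" "distr \<pi> \<pi> \<psi> = \<pi>"
    using inv unfolding abs_cont_invariant_prob_def by auto
  have \<psi>: "\<psi> \<in> measurable unit_lebesgue unit_lebesgue"
    using \<pi>(4) by (simp add: \<pi>(2) cong: measurable_cong_sets)
  have g\<psi>: "g j x = \<psi> x" if "j < k" "x \<in> {c j<..<c (Suc j)}" for j x
    using fb that unfolding full_branch_expanding_def by auto
  \<comment> \<open>For \<open>x\<close> outside this finite set, no inverse branch hits a break
    point, where \<open>\<psi>\<close> may differ from the branch.\<close>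
  define N where "N = (\<Union>j<k. {g j (c j), g j (c (Suc j))})"
  have "AE x in lborel. x \<notin> N"
    by (intro AE_not_in countable_imp_null_set_lborel countable_finite) (simp add: N_def)
  then have "AE x in unit_lebesgue. x \<notin> N"
    by (subst AE_restrict_space_iff) (auto elim: eventually_mono)
  moreover have "AE x in unit_lebesgue. x \<in> {0..1}" by (intro AE_I2) (simp add: space_restrict_space)
  ultimately have T_v: "AE x in unit_lebesgue. \<forall>j<k. \<psi> (?v j x) = x"
  proof eventually_elim
    case (elim x)
    show ?case
    proof (intro allI impI)
      fix j assume j: "j < k"
      have "?v j x \<noteq> c j" "?v j x \<noteq> c (Suc j)"
        using gv[OF j elim(2)] elim(1) j unfolding N_def by auto
      moreover have "?v j x \<in> cell c j" using v_image[OF j] elim(2) by blast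
      ultimately have "?v j x \<in> {c j<..<c (Suc j)}" by (auto simp: cell_def)
      then show "\<psi> (?v j x) = x" using g\<psi>[OF j] gv[OF j elim(2)] by simp
    qed
  qed
  obtain h where h: "log_lip lebesgue.cone_const h" "\<And>x. x \<in> {0..1} \<Longrightarrow> lebesgue.W h x = h x"
    "(\<integral>x. h x \<partial>unit_lebesgue) = 1"
    using lebesgue.invariant_density by metis
  let ?A = "lebesgue.cone_const"
  have A: "0 \<le> ?A" using lebesgue.cone_const_pos by simp
  have tk: "transfer_kernel (density unit_lebesgue h) k (\<lambda>j x. \<bar>v' j x\<bar> * h (?v j x) * (1 / h x)) ?v \<beta>
      (D + ?A * \<beta> + ?A) \<psi>"
    by (rule lebesgue.normalized_transfer_kernel[OF \<psi> T_v _ h(1) A h(2,3)])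
       (auto simp: lebesgue.W_def[abs_def] lebesgue_transfer)
  interpret \<mu>: transfer_kernel "density unit_lebesgue h" k "\<lambda>j x. \<bar>v' j x\<bar> * h (?v j x) * (1 / h x)" ?v \<beta>
    "D + ?A * \<beta> + ?A" \<psi> by fact
  have hm: "h \<in> borel_measurable unit_lebesgue"
    by (intro borel_measurable_integrable lebesgue.continuous_integrable log_lip_continuous[OF h(1) A])
  have "absolutely_continuous (density unit_lebesgue h) \<pi>"
    unfolding absolutely_continuous_def
  proof
    fix X assume "X \<in> null_sets (density unit_lebesgue h)"
    then have X: "X \<in> sets unit_lebesgue" "AE x in unit_lebesgue. x \<in> X \<longrightarrow> ennreal (h x) = 0"
      using hm by (auto simp: null_sets_density_iff)
    have "AE x in unit_lebesgue. x \<in> {0..1}" by (intro AE_I2) (simp add: space_restrict_space)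
    with X(2) have "AE x in unit_lebesgue. x \<notin> X"
    proof eventually_elim
      case (elim x)
      then show ?case using log_lip_pos[OF h(1), of x] by auto
    qed
    then have "X \<in> null_sets unit_lebesgue" using X(1) by (simp add: AE_iff_null_sets)
    then show "X \<in> null_sets \<pi>" using \<pi>(3) unfolding absolutely_continuous_def by blast
  qed
  then have eq: "\<pi> = density unit_lebesgue h"
    using \<pi> by (intro \<mu>.invariant_absolutely_continuous_unique) auto
  have "0 \<le> h x \<and> h x \<le> exp ?A" if "x \<in> {0..1}" for x
    using log_lip_pos[OF h(1) that] lebesgue.log_lip_integral_bounds(2)[OF h(1) A that] h(3) by simp
  then show thesis using tk eq hm by (intro that[of _ _ _ _ h "exp ?A"]) simp_all
qed

text \<open>Corners rule out the mean value theorem. Instead, the estimate with the larger slope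
  \<open>L + e\<close> is followed up to the infimum of the points where it fails, and the right
  derivative carries it beyond.\<close>

lemma lipschitz_of_right_derivative:
  fixes f f' :: "real \<Rightarrow> real"
  assumes cont: "continuous_on {p..q} f"
    and der: "\<And>x. x \<in> {p..<q} \<Longrightarrow> (f has_real_derivative f' x) (at_right x)"
    and bound: "\<And>x. x \<in> {p..<q} \<Longrightarrow> \<bar>f' x\<bar> \<le> L"
    and xy: "x \<in> {p..q}" "y \<in> {p..q}"
  shows "\<bar>f x - f y\<bar> \<le> L * \<bar>x - y\<bar>"
proof -
  have main: "\<bar>f t - f x\<bar> \<le> (L + e) * (t - x)" if "e > 0" and x: "p \<le> x" and t: "x \<le> t" "t \<le> q" for x t e
  proof (rule ccontr)
    define H where "H s = \<bar>f s - f x\<bar> - (L + e) * (s - x)" for s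
    define B where "B = {s \<in> {x..t}. 0 < H s}"
    assume "\<not> ?thesis"
    then have tB: "t \<in> B" using t by (simp add: B_def H_def)
    define s where "s = Inf B"
    have bdd: "bdd_below B" by (rule bdd_belowI[of _ x]) (simp add: B_def)
    have sx: "x \<le> s" unfolding s_def using tB by (intro cInf_greatest) (auto simp: B_def)
    have st: "s \<le> t" unfolding s_def by (rule cInf_lower[OF tB bdd])
    have lower: "s \<le> r" if "r \<in> B" for r unfolding s_def by (rule cInf_lower[OF that bdd])
    have contH: "continuous_on {x..t} H" unfolding H_def
      by (intro continuous_intros continuous_on_subset[OF cont]) (use x t in auto)
    have "s \<notin> B"
    proof
      assume "s \<in> B"
      then have Hs: "0 < H s" by (simp add: B_def)
      then have "s \<noteq> x" by (auto simp: H_def)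
      then have "x < s" using sx by simp
      obtain \<delta> where \<delta>: "\<delta> > 0" "\<And>r. r \<in> {x..t} \<Longrightarrow> dist r s < \<delta> \<Longrightarrow> dist (H r) (H s) < H s"
        using contH Hs sx st unfolding continuous_on_iff by (metis atLeastAtMost_iff)
      define r where "r = max x (s - \<delta> / 2)"
      have r: "r \<in> {x..t}" "r < s" "dist r s < \<delta>" using \<delta>(1) \<open>x < s\<close> st by (auto simp: r_def dist_real_def)
      have "0 < H r" using \<delta>(2)[OF r(1,3)] by (simp add: dist_real_def)
      then have "r \<in> B" using r by (simp add: B_def)
      then show False using lower r(2) by force
    qed
    then have Hs: "H s \<le> 0" and st': "s < t" using sx st tB by (auto simp: B_def not_less order_less_le)
    have s_in: "s \<in> {p..<q}" using sx st' x t by auto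
    have "((\<lambda>r. (f r - f s) / (r - s)) \<longlongrightarrow> f' s) (at_right s)"
      using der[OF s_in] by (simp add: has_field_derivative_iff)
    then have "\<forall>\<^sub>F r in at_right s. dist ((f r - f s) / (r - s)) (f' s) < e"
      using \<open>e > 0\<close> by (rule tendstoD)
    then obtain u where u: "s < u" "\<And>r. s < r \<Longrightarrow> r < u \<Longrightarrow> dist ((f r - f s) / (r - s)) (f' s) < e"
      unfolding eventually_at_right_field by blast
    \<comment> \<open>The estimate up to \<open>s\<close> and the difference quotient after
      \<open>s\<close> add up, so no failure occurs before \<open>min u t > s\<close>, contradicting
      the choice of \<open>s\<close> as an infimum.\<close>
    have "min u t \<le> r" if "r \<in> B" for r
    proof (rule ccontr)
      assume "\<not> min u t \<le> r"
      then have "r < u" by simp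
      have "s < r" using lower[OF that] \<open>s \<notin> B\<close> that by (cases "r = s") auto
      have "\<bar>(f r - f s) / (r - s)\<bar> \<le> L + e"
        using u(2)[OF \<open>s < r\<close> \<open>r < u\<close>] bound[OF s_in] unfolding dist_real_def by linarith
      then have "\<bar>f r - f s\<bar> \<le> (L + e) * (r - s)" using \<open>s < r\<close> by (simp add: pos_divide_le_eq)
      moreover have "\<bar>f s - f x\<bar> \<le> (L + e) * (s - x)" using Hs by (simp add: H_def)
      ultimately have "\<bar>f r - f x\<bar> \<le> (L + e) * (r - s) + (L + e) * (s - x)" by linarith
      then have "H r \<le> 0" by (simp add: H_def algebra_simps)
      then show False using that by (simp add: B_def)
    qed
    then have "min u t \<le> s" unfolding s_def using tB by (intro cInf_greatest) auto
    then show False using u(1) st' by auto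
  qed
  have le: "\<bar>f t - f x\<bar> \<le> L * (t - x)" if "p \<le> x" "x \<le> t" "t \<le> q" for x t
  proof (rule field_le_epsilon)
    fix e :: real assume "e > 0"
    define e' where "e' = e / (t - x + 1)"
    have e': "e' > 0" using \<open>e > 0\<close> that by (simp add: e'_def)
    have "\<bar>f t - f x\<bar> \<le> L * (t - x) + e' * (t - x)" using main[OF e' that] by (simp add: algebra_simps)
    also have "e' * (t - x) \<le> e' * (t - x + 1)" using e' by (intro mult_left_mono) auto
    also have "\<dots> = e" using that by (simp add: e'_def)
    finally show "\<bar>f t - f x\<bar> \<le> L * (t - x) + e" by simp
  qed
  show ?thesis
    using le[of x y] le[of y x] xy by (cases "x \<le> y") (auto simp: abs_minus_commute)
qed

section \<open>Observables with endpoint singularities\<close>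

text \<open>Euler's Beta integral with both parameters equal to \<open>1 - s > 0\<close>.\<close>

lemma integrable_singular_weight:
  fixes s :: real
  assumes "s < 1"
  shows "integrable unit_lebesgue (\<lambda>x. (x * (1 - x)) powr (- s))"
proof -
  have eq: "(x * (1 - x)) powr (- s) = x powr ((1 - s) - 1) * (1 - x) powr ((1 - s) - 1)" if "x \<in> {0..1}" for x
    using that by (simp add: powr_mult)
  have "(\<lambda>x. x powr ((1 - s) - 1) * (1 - x) powr ((1 - s) - 1)) integrable_on {0..1}"
    using has_integral_Beta_real[of "1 - s" "1 - s"] assms by (auto simp: integrable_on_def)
  then have "(\<lambda>x. (x * (1 - x)) powr (- s)) integrable_on {0..1}"
    by (rule integrable_eq) (simp only: eq)
  then show ?thesis unfolding integrable_unit_lebesgue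
    by (intro conjI nonnegative_absolutely_integrable_1) (auto intro!: measurable_restrict_space1)
qed

lemma integral_density_bound:
  fixes h F G :: "real \<Rightarrow> real" and B :: real
  assumes h[measurable]: "h \<in> borel_measurable unit_lebesgue" and hB: "\<And>x. x \<in> {0..1} \<Longrightarrow> 0 \<le> h x \<and> h x \<le> B"
    and F[measurable]: "F \<in> borel_measurable unit_lebesgue" and G: "integrable unit_lebesgue G"
    and FG: "\<And>x. x \<in> {0<..<1} \<Longrightarrow> \<bar>F x\<bar> \<le> G x"
  shows "integrable (density unit_lebesgue h) F" "(\<integral>x. F x \<partial>density unit_lebesgue h) \<le> B * (\<integral>x. G x \<partial>unit_lebesgue)"
proof -
  have "AE x in lborel. x \<notin> {0, 1::real}"
    by (intro AE_not_in countable_imp_null_set_lborel countable_finite) simp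
  then have "AE x in lborel. x \<in> {0..1} \<longrightarrow> x \<in> {0<..<1::real}" by eventually_elim auto
  then have "AE x in unit_lebesgue. x \<in> {0<..<1}" by (subst AE_restrict_space_iff) auto
  then have le: "AE x in unit_lebesgue. \<bar>h x * F x\<bar> \<le> B * G x"
  proof eventually_elim
    case (elim x)
    then show ?case unfolding abs_mult using hB[of x] FG[of x] by (intro mult_mono) auto
  qed
  have h0: "AE x in unit_lebesgue. 0 \<le> h x"
    using hB by (intro AE_I2) (auto simp: space_restrict_space)
  have BG: "integrable unit_lebesgue (\<lambda>x. B * G x)" using G by simp
  have hF: "integrable unit_lebesgue (\<lambda>x. h x * F x)"
    by (rule Bochner_Integration.integrable_bound[OF BG]) (use le in \<open>auto elim!: eventually_mono\<close>)
  then show "integrable (density unit_lebesgue h) F" using h0 by (subst integrable_real_density) auto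
  have "(\<integral>x. F x \<partial>density unit_lebesgue h) = (\<integral>x. h x * F x \<partial>unit_lebesgue)"
    using h0 by (subst integral_real_density) auto
  also have "\<dots> \<le> (\<integral>x. B * G x \<partial>unit_lebesgue)"
    by (rule integral_mono_AE[OF hF BG]) (use le in \<open>auto elim!: eventually_mono\<close>)
  finally show "(\<integral>x. F x \<partial>density unit_lebesgue h) \<le> B * (\<integral>x. G x \<partial>unit_lebesgue)" by simp
qed

lemma borel_measurable_unit_lebesgue:
  fixes f :: "real \<Rightarrow> real"
  assumes "continuous_on {0<..<1} f"
  shows "f \<in> borel_measurable unit_lebesgue"
proof -
  have "(\<lambda>x. indicator {0<..<1} x *\<^sub>R f x) \<in> borel_measurable borel"
    using assms by (intro borel_measurable_continuous_on_indicator) auto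
  \<comment> \<open>Nothing is known about \<open>f\<close> at the endpoints, so its two values
    there are put back by hand.\<close>
  then have "(\<lambda>x. indicator {0<..<1} x *\<^sub>R f x + f 0 * indicator {0} x + f 1 * indicator {1} x) \<in> borel_measurable borel"
    by measurable
  then have "(\<lambda>x. indicator {0<..<1} x *\<^sub>R f x + f 0 * indicator {0} x + f 1 * indicator {1} x) \<in> borel_measurable unit_lebesgue"
    by (intro measurable_restrict_space1) simp
  then show ?thesis
    by (rule measurable_cong[THEN iffD1, rotated]) (auto simp: space_restrict_space indicator_def)
qed

text \<open>The argument is clamped, not the value: an observable composed with this map is frozen
  near both endpoints and becomes Lipschitz under the derivative bound.\<close>

definition truncate :: "real \<Rightarrow> real \<Rightarrow> real" where
  "truncate \<epsilon> x = max \<epsilon> (min (1 - \<epsilon>) x)"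

lemma truncate:
  assumes "0 < \<epsilon>" "\<epsilon> \<le> 1 / 2"
  shows "truncate \<epsilon> x \<in> {\<epsilon>..1 - \<epsilon>}" "\<bar>truncate \<epsilon> x - truncate \<epsilon> y\<bar> \<le> \<bar>x - y\<bar>"
    "x \<in> {\<epsilon>..1 - \<epsilon>} \<Longrightarrow> truncate \<epsilon> x = x"
  using assms by (auto simp: truncate_def)

text \<open>Clamping moves a point towards the middle, where the weight is larger; so the growth
  bound for \<open>chi\<close> at \<open>x\<close> also bounds the truncated observable at
  \<open>x\<close>.\<close>

lemma weight_truncate:
  assumes e: "0 < \<epsilon>" "\<epsilon> \<le> 1 / 2" and x: "x \<in> {0<..<1}"
  shows "x * (1 - x) \<le> truncate \<epsilon> x * (1 - truncate \<epsilon> x)"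
proof -
  consider "x < \<epsilon>" | "1 - \<epsilon> < x" | "x \<in> {\<epsilon>..1 - \<epsilon>}" by fastforce
  then show ?thesis
  proof cases
    case 1
    then have t: "truncate \<epsilon> x = \<epsilon>" using e by (simp add: truncate_def)
    have "0 \<le> (\<epsilon> - x) * (1 - \<epsilon> - x)" using 1 e by (intro mult_nonneg_nonneg) auto
    then show ?thesis unfolding t by (simp add: algebra_simps)
  next
    case 2
    then have t: "truncate \<epsilon> x = 1 - \<epsilon>" using e by (simp add: truncate_def)
    have "0 \<le> (x - (1 - \<epsilon>)) * (x - \<epsilon>)" using 2 e by (intro mult_nonneg_nonneg) auto
    then show ?thesis unfolding t by (simp add: algebra_simps)
  qed (simp add: truncate[OF e])
qed

lemma weight_ge:
  fixes \<epsilon> x :: real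
  assumes "0 < \<epsilon>" "\<epsilon> \<le> 1 / 2" "x \<in> {\<epsilon>..1 - \<epsilon>}"
  shows "\<epsilon> / 2 \<le> x * (1 - x)"
proof (cases "x \<le> 1 / 2")
  case True
  have "\<epsilon> * (1 / 2) \<le> x * (1 - x)" using assms True by (intro mult_mono) auto
  then show ?thesis by simp
next
  case False
  have "(1 / 2) * \<epsilon> \<le> x * (1 - x)" using assms False by (intro mult_mono) auto
  then show ?thesis by simp
qed

context transfer_kernel
begin

text \<open>Two errors compete: truncation at scale \<open>\<epsilon>\<close> costs a positive power
  of \<open>\<epsilon>\<close> in mean square, while the Lipschitz constant of the result is of
  order \<open>\<epsilon> powr (- b)\<close> and must be beaten by \<open>rate ^ n\<close>.\<close>

lemma singular_observable_decay:
  fixes chi chi' h :: "real \<Rightarrow> real" and a b B K L :: real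
  assumes m: "m = density unit_lebesgue h" and h: "h \<in> borel_measurable unit_lebesgue"
    "\<And>x. x \<in> {0..1} \<Longrightarrow> 0 \<le> h x \<and> h x \<le> B"
    and cont: "continuous_on {0<..<1} chi"
    and der: "\<And>x. x \<in> {0<..<1} \<Longrightarrow> (chi has_real_derivative chi' x) (at_right x)"
    and a: "0 < a" "a < 1 / 2" and b: "0 < b" and KL: "0 < K" "0 < L"
    and chi: "\<And>x. x \<in> {0<..<1} \<Longrightarrow> \<bar>chi x\<bar> \<le> K * (x * (1 - x)) powr (- a)"
    and chi': "\<And>x. x \<in> {0<..<1} \<Longrightarrow> \<bar>chi' x\<bar> \<le> L * (x * (1 - x)) powr (- b)"
  shows "chi \<in> borel_measurable m" "integrable m (\<lambda>x. (chi x)\<^sup>2)"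
    "\<exists>C r. 0 < r \<and> r < 1 \<and> (\<forall>n. (\<integral>x. ((W ^^ n) (\<lambda>x. chi x - (\<integral>y. chi y \<partial>m)) x)\<^sup>2 \<partial>m) \<le> C * r ^ n)"
proof -
  define wt where "wt x = x * (1 - x)" for x :: real
  have wt: "0 < wt x" "wt x \<le> 1" if "x \<in> {0<..<1}" for x
    using that mult_le_one[of x "1 - x"] by (auto simp: wt_def)
  have chim[measurable]: "chi \<in> borel_measurable unit_lebesgue" by (rule borel_measurable_unit_lebesgue[OF cont])
  show chim': "chi \<in> borel_measurable m" using chim by (simp add: m)
  \<comment> \<open>The square of \<open>chi\<close> has singularity exponent
    \<open>2 * a < 1\<close>. Half of the gap to 1 is given to \<open>\<gamma>\<close>, the rate of
    the truncation error, and the exponent \<open>s\<close> stays integrable.\<close>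
  define \<gamma> s where "\<gamma> = (1 - 2 * a) / 2" and "s = 2 * a + \<gamma>"
  have \<gamma>: "0 < \<gamma>" "s < 1" using a by (auto simp: \<gamma>_def s_def field_simps)
  have int: "integrable unit_lebesgue (\<lambda>x. wt x powr (- s))"
    unfolding wt_def by (rule integrable_singular_weight[OF \<gamma>(2)])
  define I where "I = (\<integral>x. wt x powr (- s) \<partial>unit_lebesgue)"
  have I0: "0 \<le> I" unfolding I_def by (rule integral_nonneg_AE) simp
  have B0: "0 \<le> B" using h(2)[of 0] by simp
  have sq_bound: "(K * wt x powr (- a))\<^sup>2 = K\<^sup>2 * wt x powr (- 2 * a)" if "x \<in> {0<..<1}" for x
    using wt(1)[OF that] by (simp add: power_mult_distrib powr_power)
  show chi2: "integrable m (\<lambda>x. (chi x)\<^sup>2)" unfolding m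
  proof (rule integral_density_bound(1)[OF h])
    show "integrable unit_lebesgue (\<lambda>x. K\<^sup>2 * wt x powr (- s))" using int by simp
    fix x :: real assume x: "x \<in> {0<..<1}"
    have "\<bar>(chi x)\<^sup>2\<bar> = \<bar>chi x\<bar>\<^sup>2" by simp
    also have "\<dots> \<le> (K * wt x powr (- a))\<^sup>2" using chi[OF x] by (intro power_mono) (auto simp: wt_def)
    also have "\<dots> \<le> K\<^sup>2 * wt x powr (- s)"
      unfolding sq_bound[OF x] using wt[OF x] \<gamma> by (intro mult_left_mono powr_mono') (auto simp: s_def)
    finally show "\<bar>(chi x)\<^sup>2\<bar> \<le> K\<^sup>2 * wt x powr (- s)" .
  qed measurable
  have est: "(\<integral>x. ((W ^^ n) (\<lambda>x. chi x - (\<integral>y. chi y \<partial>m)) x)\<^sup>2 \<partial>m) \<le>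
      2 * (B * (4 * K\<^sup>2 * \<epsilon> powr \<gamma> * I)) + 2 * (decay_const * (L * (\<epsilon> / 2) powr (- b)) * rate ^ n)\<^sup>2"
    if e: "0 < \<epsilon>" "\<epsilon> \<le> 1 / 2" for \<epsilon> n
  proof -
    define \<phi> where "\<phi> x = chi (truncate \<epsilon> x)" for x
    define \<Lambda> where "\<Lambda> = L * (\<epsilon> / 2) powr (- b)"
    have \<Lambda>: "0 < \<Lambda>" using KL e by (simp add: \<Lambda>_def)
    have lip: "\<bar>\<phi> x - \<phi> y\<bar> \<le> \<Lambda> * \<bar>x - y\<bar>" for x y
    proof -
      have "\<bar>\<phi> x - \<phi> y\<bar> \<le> \<Lambda> * \<bar>truncate \<epsilon> x - truncate \<epsilon> y\<bar>" unfolding \<phi>_def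
      proof (rule lipschitz_of_right_derivative[where p=\<epsilon> and q="1 - \<epsilon>" and f'=chi'])
        show "continuous_on {\<epsilon>..1 - \<epsilon>} chi" by (rule continuous_on_subset[OF cont]) (use e in auto)
        fix z assume z: "z \<in> {\<epsilon>..<1 - \<epsilon>}"
        then have z01: "z \<in> {0<..<1}" using e by auto
        show "(chi has_real_derivative chi' z) (at_right z)" by (rule der[OF z01])
        have "\<bar>chi' z\<bar> \<le> L * (z * (1 - z)) powr (- b)" by (rule chi'[OF z01])
        also have "\<dots> \<le> \<Lambda>" unfolding \<Lambda>_def using weight_ge[OF e, of z] z e b KL
          by (intro mult_left_mono powr_mono2') auto
        finally show "\<bar>chi' z\<bar> \<le> \<Lambda>" .
      qed (rule truncate[OF e])+
      also have "\<dots> \<le> \<Lambda> * \<bar>x - y\<bar>" using \<Lambda> truncate(2)[OF e] by (intro mult_left_mono) auto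
      finally show ?thesis .
    qed
    have "\<phi> \<in> borel_measurable m"
      using tail_mixing_lipschitz(1)[OF lip \<Lambda>] by simp
    then have [measurable]: "\<phi> \<in> borel_measurable unit_lebesgue" by (simp add: m)
    have "(\<integral>x. (chi x - \<phi> x)\<^sup>2 \<partial>m) \<le> B * (\<integral>x. 4 * K\<^sup>2 * \<epsilon> powr \<gamma> * wt x powr (- s) \<partial>unit_lebesgue)"
      unfolding m
    proof (rule integral_density_bound(2)[OF h])
      show "integrable unit_lebesgue (\<lambda>x. 4 * K\<^sup>2 * \<epsilon> powr \<gamma> * wt x powr (- s))" using int by simp
      fix x :: real assume x: "x \<in> {0<..<1}"
      show "\<bar>(chi x - \<phi> x)\<^sup>2\<bar> \<le> 4 * K\<^sup>2 * \<epsilon> powr \<gamma> * wt x powr (- s)"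
      proof (cases "x \<in> {\<epsilon>..1 - \<epsilon>}")
        case True
        then show ?thesis by (simp add: \<phi>_def truncate(3)[OF e])
      next
        case False
        have t01: "truncate \<epsilon> x \<in> {0<..<1}" using truncate(1)[OF e, of x] e by auto
        have "\<bar>\<phi> x\<bar> \<le> K * wt (truncate \<epsilon> x) powr (- a)" unfolding \<phi>_def wt_def by (rule chi[OF t01])
        also have "\<dots> \<le> K * wt x powr (- a)"
          using weight_truncate[OF e x] wt[OF x] a KL unfolding wt_def
          by (intro mult_left_mono powr_mono2') auto
        finally have "\<bar>chi x - \<phi> x\<bar> \<le> 2 * (K * wt x powr (- a))"
          using chi[OF x] unfolding wt_def[symmetric] by linarith
        then have "\<bar>chi x - \<phi> x\<bar>\<^sup>2 \<le> (2 * (K * wt x powr (- a)))\<^sup>2" by (rule power_mono) simp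
        also have "\<dots> = 4 * K\<^sup>2 * wt x powr (- 2 * a)"
          by (subst power_mult_distrib) (simp add: sq_bound[OF x])
        also have "\<dots> \<le> 4 * K\<^sup>2 * (\<epsilon> powr \<gamma> * wt x powr (- s))"
        \<comment> \<open>Outside the clamped interval the weight is at most
          \<open>\<epsilon>\<close>, so a factor \<open>wt x powr \<gamma>\<close> can be traded for
          \<open>\<epsilon> powr \<gamma>\<close>.\<close>
        proof (rule mult_left_mono)
          have "wt x \<le> \<epsilon>"
          proof (cases "x < \<epsilon>")
            case True
            have "x * (1 - x) \<le> \<epsilon> * 1" using True x e by (intro mult_mono) auto
            then show ?thesis by (simp add: wt_def)
          next
            assume "\<not> x < \<epsilon>"
            then have "1 - x \<le> \<epsilon>" using False by auto
            then have "x * (1 - x) \<le> 1 * \<epsilon>" using x e by (intro mult_mono) auto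
            then show ?thesis by (simp add: wt_def)
          qed
          then have "wt x powr \<gamma> \<le> \<epsilon> powr \<gamma>" using wt[OF x] \<gamma> by (intro powr_mono2) auto
          then have "wt x powr \<gamma> * wt x powr (- s) \<le> \<epsilon> powr \<gamma> * wt x powr (- s)"
            by (rule mult_right_mono) simp
          moreover have "wt x powr \<gamma> * wt x powr (- s) = wt x powr (- 2 * a)"
            by (simp add: s_def flip: powr_add)
          ultimately show "wt x powr (- 2 * a) \<le> \<epsilon> powr \<gamma> * wt x powr (- s)" by simp
        qed simp
        finally show ?thesis by (simp add: mult.assoc)
      qed
    qed measurable
    also have "\<dots> = B * (4 * K\<^sup>2 * \<epsilon> powr \<gamma> * I)" by (simp add: I_def)
    finally have 1: "(\<integral>x. (chi x - \<phi> x)\<^sup>2 \<partial>m) \<le> B * (4 * K\<^sup>2 * \<epsilon> powr \<gamma> * I)" .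
    show ?thesis
      using W_pow_square_decay[OF chim' chi2 lip \<Lambda>, of n] 1 by (simp add: \<Lambda>_def)
  qed
  text \<open>Truncating at scale \<open>\<tau>\<^sup>n\<close> loses only half of the exponential rate to the Lipschitz norm.\<close>
  define \<tau> where "\<tau> = rate powr (1 / (2 * b))"
  have \<tau>: "0 < \<tau>" "\<tau> < 1" using rate b powr_less_mono2[of "1 / (2 * b)" rate 1] by (auto simp: \<tau>_def)
  \<comment> \<open>With \<open>\<epsilon> = \<tau> ^ n / 2\<close>, the factor
    \<open>(1 / 2) powr \<gamma>\<close> remains from \<open>\<epsilon> powr \<gamma>\<close>, and
    \<open>(1 / 4) powr (- b)\<close> from \<open>(\<epsilon> / 2) powr (- b)\<close>, whose
    \<open>\<epsilon> / 2\<close> is the lower bound of \<open>weight_ge\<close>.\<close>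
  define C1 C2 where "C1 = 8 * B * K\<^sup>2 * I * (1 / 2) powr \<gamma>" and "C2 = 2 * (decay_const * L * (1 / 4) powr (- b))\<^sup>2"
  have C: "0 \<le> C1" "0 \<le> C2" using B0 I0 by (auto simp: C1_def C2_def)
  define r where "r = max (\<tau> powr \<gamma>) rate"
  have r: "0 < r" "r < 1" using \<tau> \<gamma> rate powr_less_mono2[of \<gamma> \<tau> 1] by (auto simp: r_def)
  have "(\<integral>x. ((W ^^ n) (\<lambda>x. chi x - (\<integral>y. chi y \<partial>m)) x)\<^sup>2 \<partial>m) \<le> (C1 + C2) * r ^ n" for n
  proof -
    define \<epsilon> where "\<epsilon> = \<tau> ^ n / 2"
    have e: "0 < \<epsilon>" "\<epsilon> \<le> 1 / 2" using \<tau> by (auto simp: \<epsilon>_def power_le_one)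
    have p1: "\<epsilon> powr \<gamma> = (1 / 2) powr \<gamma> * (\<tau> powr \<gamma>) ^ n"
    proof -
      have "\<epsilon> = (1 / 2) * \<tau> powr real n" using \<tau> by (simp add: \<epsilon>_def powr_realpow)
      then have "\<epsilon> powr \<gamma> = ((1 / 2) * \<tau> powr real n) powr \<gamma>" by (rule arg_cong)
      also have "\<dots> = (1 / 2) powr \<gamma> * (\<tau> powr (real n * \<gamma>))"
        by (subst powr_mult) (auto simp: powr_powr)
      also have "\<tau> powr (real n * \<gamma>) = (\<tau> powr \<gamma>) ^ n" using \<tau> by (simp add: powr_power mult.commute)
      finally show ?thesis .
    qed
    have p2: "((\<epsilon> / 2) powr (- b) * rate ^ n)\<^sup>2 = ((1 / 4) powr (- b))\<^sup>2 * rate ^ n"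
    proof -
      have "\<epsilon> / 2 = (1 / 4) * rate powr (real n / (2 * b))"
        using \<tau> rate by (simp add: \<epsilon>_def \<tau>_def powr_power)
      then have "(\<epsilon> / 2) powr (- b) = ((1 / 4) * rate powr (real n / (2 * b))) powr (- b)" by (rule arg_cong)
      also have "\<dots> = (1 / 4) powr (- b) * rate powr (real n / (2 * b) * (- b))"
        by (subst powr_mult) (auto simp: powr_powr)
      also have "real n / (2 * b) * (- b) = - real n / 2" using b by simp
      finally have "((\<epsilon> / 2) powr (- b))\<^sup>2 = ((1 / 4) powr (- b))\<^sup>2 * rate powr (- real n)"
        using rate by (simp add: power_mult_distrib powr_power)
      then have "((\<epsilon> / 2) powr (- b) * rate ^ n)\<^sup>2 = ((1 / 4) powr (- b))\<^sup>2 * (rate powr (- real n) * (rate ^ n)\<^sup>2)"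
        by (simp add: power_mult_distrib)
      also have "rate powr (- real n) * (rate ^ n)\<^sup>2 = rate ^ n"
        using rate by (simp add: powr_minus powr_realpow power2_eq_square field_simps)
      finally show ?thesis .
    qed
    have "(\<integral>x. ((W ^^ n) (\<lambda>x. chi x - (\<integral>y. chi y \<partial>m)) x)\<^sup>2 \<partial>m) \<le>
      2 * (B * (4 * K\<^sup>2 * \<epsilon> powr \<gamma> * I)) + 2 * (decay_const * (L * (\<epsilon> / 2) powr (- b)) * rate ^ n)\<^sup>2"
      by (rule est[OF e])
    also have "2 * (B * (4 * K\<^sup>2 * \<epsilon> powr \<gamma> * I)) = C1 * (\<tau> powr \<gamma>) ^ n" by (simp add: p1 C1_def)
    also have "2 * (decay_const * (L * (\<epsilon> / 2) powr (- b)) * rate ^ n)\<^sup>2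
        = 2 * (decay_const * L)\<^sup>2 * ((\<epsilon> / 2) powr (- b) * rate ^ n)\<^sup>2"
      by (simp add: power_mult_distrib)
    also have "\<dots> = C2 * rate ^ n" unfolding p2 by (simp add: C2_def power_mult_distrib)
    also have "C1 * (\<tau> powr \<gamma>) ^ n + C2 * rate ^ n \<le> C1 * r ^ n + C2 * r ^ n"
      using C rate by (intro add_mono mult_left_mono power_mono) (auto simp: r_def)
    finally show ?thesis by (simp add: distrib_right)
  qed
  then show "\<exists>C r. 0 < r \<and> r < 1 \<and> (\<forall>n. (\<integral>x. ((W ^^ n) (\<lambda>x. chi x - (\<integral>y. chi y \<partial>m)) x)\<^sup>2 \<partial>m) \<le> C * r ^ n)"
    using r by blast
qed

end

section \<open>The central limit theorem for the observable\<close>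

theorem theorem2p5:
  fixes \<psi> chi dchi_right dchi_left :: "real \<Rightarrow> real"
    and k :: nat and c :: "nat \<Rightarrow> real" and g :: "nat \<Rightarrow> real \<Rightarrow> real"
    and \<pi> :: "real measure" and \<theta> a b \<sigma> :: real
  assumes "full_branch_expanding k c g \<theta> \<psi>"
    and "abs_cont_invariant_prob \<psi> \<pi>"
    and "continuous_on {0<..<1} chi"
    and "\<And>x. x \<in> {0<..<1} \<Longrightarrow> (chi has_real_derivative dchi_right x) (at_right x)"
    and "\<And>x. x \<in> {0<..<1} \<Longrightarrow> (chi has_real_derivative dchi_left x) (at_left x)"
    and "\<not> L2_coboundary \<pi> \<psi> (\<lambda>x. chi x - (\<integral>y. chi y \<partial>\<pi>))"
    and "a > 0" and "b > 0"
    and "lesssim_on {0<..<1} (\<lambda>x. \<bar>chi x\<bar>) (\<lambda>x. x powr (-a) * (1 - x) powr (-a))"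
    and "lesssim_on {0<..<1} (\<lambda>x. max \<bar>dchi_right x\<bar> \<bar>dchi_left x\<bar>)
           (\<lambda>x. x powr (-b) * (1 - x) powr (-b))"
    and "a < Min {\<theta>, 1 / b, 1 / 2} * min 1 (ln (eta_minus k c g) / ln (eta_plus k c g))"
    and "\<sigma> = sqrt (asymp_variance \<pi> \<psi> chi)"
  shows "\<forall>x::real.
           (\<lambda>n. measure \<pi> {\<omega> \<in> space \<pi>.
                   (birkhoff_sum \<psi> chi n \<omega> - real n * (\<integral>y. chi y \<partial>\<pi>)) / (\<sigma> * sqrt (real n)) \<le> x}
                - cdf std_normal_distribution x) \<in> o(\<lambda>_. 1)"
proof -
  obtain w v \<beta> D and h :: "real \<Rightarrow> real" and B :: real where tk: "transfer_kernel \<pi> k w v \<beta> D \<psi>" and dens: "\<pi> = density unit_lebesgue h"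
    and h: "h \<in> borel_measurable unit_lebesgue" "\<And>x. x \<in> {0..1} \<Longrightarrow> 0 \<le> h x \<and> h x \<le> B"
    using invariant_measure_transfer_kernel[OF assms(1,2)] by metis
  interpret transfer_kernel \<pi> k w v \<beta> D \<psi> by fact
  have a: "a < 1 / 2" by (rule growth_exponent_less_half[OF assms(1,7,11)])
  obtain K where K: "0 < K" "\<And>x. x \<in> {0<..<1} \<Longrightarrow> \<bar>chi x\<bar> \<le> K * (x * (1 - x)) powr (- a)"
    using assms(9) unfolding lesssim_on_def by (auto simp: powr_mult)
  obtain L where L: "0 < L" "\<And>x. x \<in> {0<..<1} \<Longrightarrow> \<bar>dchi_right x\<bar> \<le> L * (x * (1 - x)) powr (- b)"
    using assms(10) unfolding lesssim_on_def by (auto simp: powr_mult)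
  note dec = singular_observable_decay[OF dens h assms(3,4) assms(7) a assms(8) K(1) L(1) K(2) L(2)]
  define c0 f where "c0 = (\<integral>y. chi y \<partial>\<pi>)" and "f x = chi x - c0" for x
  have chi_int: "integrable \<pi> chi" by (rule square_integrable_imp_integrable[OF dec(1,2)])
  have f_m[measurable]: "f \<in> borel_measurable \<pi>" unfolding f_def using dec(1) by measurable
  have f_sq: "integrable \<pi> (\<lambda>x. (f x)\<^sup>2)"
    unfolding f_def using dec(2) chi_int by (simp add: power2_diff)
  obtain C r where r: "0 < r" "r < 1" and C: "\<And>n. (\<integral>x. ((W ^^ n) f x)\<^sup>2 \<partial>\<pi>) \<le> C * r ^ n"
    using dec(3) unfolding f_def[abs_def] c0_def by blast
  obtain u where u: "u \<in> borel_measurable \<pi>" "integrable \<pi> (\<lambda>x. (u x)\<^sup>2)"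
    and mc: "martingale_coboundary \<pi> \<psi> (\<lambda>x. f x + u x - u (\<psi> x)) f (\<lambda>x. - u x)"
    using gordin_decomposition[OF f_m f_sq C r] by blast
  interpret M: martingale_coboundary \<pi> \<psi> "\<lambda>x. f x + u x - u (\<psi> x)" f "\<lambda>x. - u x" by fact
  have sum_eq: "birkhoff_sum \<psi> chi n x - real n * (\<integral>y. chi y \<partial>\<pi>) = M.Sf n x" for n x
    by (simp add: birkhoff_sum_def M.Sf_def f_def c0_def sum_subtractf)
  \<comment> \<open>\<open>lim\<close> has a definite value here because
    \<open>variance_limit\<close> proves convergence; the value is the variance of the martingale
    difference.\<close>
  have "asymp_variance \<pi> \<psi> chi = M.var"
    unfolding asymp_variance_def sum_eq by (rule limI[OF M.variance_limit])
  then have \<sigma>: "\<sigma> = sqrt M.var" using assms(12) by simp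
  \<comment> \<open>Zero variance would make \<open>d\<close> vanish almost everywhere and turn
    \<open>f\<close> into the coboundary of \<open>u\<close>.\<close>
  have "M.var \<noteq> 0"
  proof
    assume "M.var = 0"
    then have "AE x in \<pi>. f x = u (\<psi> x) - u x" using M.coboundary_if_var_0 by simp
    then have "L2_coboundary \<pi> \<psi> f"
      unfolding L2_coboundary_def using u by (intro exI[of _ u]) auto
    then show False using assms(6) by (simp add: f_def[abs_def] c0_def)
  qed
  moreover have "0 \<le> M.var" unfolding M.var_def by (rule integral_nonneg_AE) simp
  ultimately have var: "0 < M.var" by simp
  show ?thesis
  proof
    fix x :: real
    have "(\<lambda>n. measure \<pi> {\<omega> \<in> space \<pi>. M.Sf n \<omega> / (\<sigma> * sqrt (real n)) \<le> x} - cdf std_normal_distribution x) \<longlonglongrightarrow> 0"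
      unfolding \<sigma> using M.normalized_sum_cdf_limit[OF var, of x] by (simp add: LIM_zero_iff)
    then show "(\<lambda>n. measure \<pi> {\<omega> \<in> space \<pi>.
                   (birkhoff_sum \<psi> chi n \<omega> - real n * (\<integral>y. chi y \<partial>\<pi>)) / (\<sigma> * sqrt (real n)) \<le> x}
                - cdf std_normal_distribution x) \<in> o(\<lambda>_. 1)"
      unfolding sum_eq by (intro smalloI_tendsto) simp_all
  qed
qed

end
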